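(* For every $\pi\in\mathbb D_r(d)$ and every marking $\Sigma$ of $\pi$, $$\mathcal G^{\pm,\mathrm{col}}_r(\pi,\Sigma)(\mathbf x;t^{-1})=\tilde\chi^{\mathsf P}_r(\pi,\Sigma)(\mathbf x;t).$$
   Context: $\mathbb F=\mathbb Q(q,t)$; $\mathcal P(r)=\mathbb F[x_1,\dots,x_r]\otimes\Lambda_{\mathbb F}(x_{r+1},\dots)$ inside $\mathbb F[[x_1,x_2,\dots]]$. Box $(c,r)$ is the unit square with northeast corner $(c,r)$. $\mathbb D_r(d)$ is the set of north/east lattice paths from $(0,r)$ to $(d,d)$ weakly above the line from $(0,0)$ to $(d,d)$; $\mathrm{Area}(\pi)$ is the set of full boxes below $\pi$ (extended by $r$ north steps from $(0,0)$) and above that diagonal. A corner is a box above $\pi$ whose south and east neighbours are below $\pi$; a marking is a set of corners. Alphabet $\mathcal A$: $1<\bar1<2<\bar2<\cdots$, positive letters $v$, negative letters $\bar v$, $|v|=|\bar v|=v$. For $a,b\in\mathcal A$, $ab$ is column-decreasing if $a>b$ or $a=b$ is negative. A flagged $(\pi,\Sigma)$-column super word is $T:[d]\to\mathcal A$ with $T(j)T(i)$ column-decreasing for all $(i,j)\in\Sigma$ and $T(i)\le i$ for $i\le r$. $\widetilde{\mathrm{inv}}(T)$ is the number of $(i,j)\in\mathrm{Area}(\pi)$ with $T(j)T(i)$ column-decreasing; $m(T)$ the number of negative letters; $\mathbf x^{|T|}=\prod_i x_{|T(i)|}$. Then $\mathcal G^{\pm,\mathrm{col}}_r(\pi,\Sigma)(\mathbf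 x;t)=\sum_T t^{\widetilde{\mathrm{inv}}(T)}(-t)^{-m(T)}\mathbf x^{|T|}$. Operators: $T_if=s_if+(1-t)x_i\frac{f-s_if}{x_i-x_{i+1}}$; $\mathcal B_nf(Z)=\langle u^0\rangle u^nf[Z-u]\Omega[(1-t)u^{-1}Z]$ (plethystic notation, $\Omega[A]=\exp\sum_kp_k[A]/k$); $d_-^{\mathsf P}:\mathcal P(s)\to\mathcal P(s-1)$, $x_1^{\eta_1}\cdots x_s^{\eta_s}g(x_{s+1},\dots)\mapsto x_1^{\eta_1}\cdots x_{s-1}^{\eta_{s-1}}\mathcal B_{\eta_s}(g[x_s+x_{s+1}+\cdots])$; $d_+^{\mathsf P}:\mathcal P(s)\to\mathcal P(s+1)$, $f\mapsto -T_1\cdots T_s(x_{s+1}f)$. $\tilde\chi^{\mathsf P}_r(\pi,\Sigma)$ is obtained from $1\in\mathcal P(0)$ by traversing $\pi$ backwards from $(d,d)$ to $(0,r)$, where at each moment the current element lies in $\mathcal P(s)$ with $s=h-v$ ($h$, $v$ the numbers of horizontal and vertical steps traversed so far), applying: for each east step not in a marked corner, $-t^{-s}d_+^{\mathsf P}$; for each north step not in a marked corner, $d_-^{\mathsf P}$; for each marked corner (its east-side north step and south-side east step), instead the operator $\frac{1}{t^{-1}-1}\big(d_-^{\mathsf P}(-t^{-s}d_+^{\mathsf P})-(-t^{-s+1}d_+^{\mathsf P})d_-^{\mathsf P}\big)$. *)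

theory Defs
  imports
    "HOL-Computational_Algebra.Computational_Algebra"
    "HOL-Library.Multiset"
    "HOL-Library.FuncSet"
    "HOL-Combinatorics.Transposition"
begin

section \<open>Formal power series in infinitely many variables\<close>

text \<open>
  A monomial is a finite multiset of variable indices: the multiset \<open>M\<close> stands for the product of
  the \<open>x\<^sub>i\<close>, \<open>i \<in># M\<close>.  Variables are numbered from 1; the index 0 never occurs in anything
  constructed below.
\<close>

typedef 'a mps = "UNIV :: (nat multiset \<Rightarrow> 'a) set"
  morphisms mcoeff Abs_mps ..

setup_lifting type_definition_mps

lemma mps_eqI: "(\<And>M. mcoeff f M = mcoeff g M) \<Longrightarrow> f = g"
  by transfer auto

lemma finite_submultisets: "finite {A. A \<subseteq># (M :: 'b multiset)}"
proof (induction M)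
  case (add x M)
  have "{A. A \<subseteq># add_mset x M} \<subseteq> {A. A \<subseteq># M} \<union> add_mset x ` {A. A \<subseteq># M}"
  proof
    fix A assume "A \<in> {A. A \<subseteq># add_mset x M}"
    hence A: "A \<subseteq># add_mset x M" by simp
    show "A \<in> {A. A \<subseteq># M} \<union> add_mset x ` {A. A \<subseteq># M}"
    proof (cases "x \<in># A")
      case True
      then obtain B where "A = add_mset x B" by (meson multi_member_split)
      with A show ?thesis by simp
    next
      case False
      hence "A \<subseteq># M" using A
        by (metis add_mset_remove_trivial diff_single_trivial subset_eq_diff_conv add_mset_add_single)
      thus ?thesis by simp
    qed
  qed
  with add.IH show ?case by (meson finite_UnI finite_imageI finite_subset)
qed simp

instantiation mps :: (comm_ring_1) comm_ring_1
begin

lift_definition zero_mps :: "'a mps" is "\<lambda>_. 0" .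
lift_definition one_mps :: "'a mps" is "\<lambda>M. if M = {#} then 1 else 0" .
lift_definition plus_mps :: "'a mps \<Rightarrow> 'a mps \<Rightarrow> 'a mps" is "\<lambda>f g M. f M + g M" .
lift_definition minus_mps :: "'a mps \<Rightarrow> 'a mps \<Rightarrow> 'a mps" is "\<lambda>f g M. f M - g M" .
lift_definition uminus_mps :: "'a mps \<Rightarrow> 'a mps" is "\<lambda>f M. - f M" .
lift_definition times_mps :: "'a mps \<Rightarrow> 'a mps \<Rightarrow> 'a mps"
  is "\<lambda>f g M. \<Sum>A | A \<subseteq># M. f A * g (M - A)" .

instance
proof
  fix f g h :: "'a mps"
  show "f * g * h = f * (g * h)"
  proof (transfer, rule ext)
    fix f g h :: "nat multiset \<Rightarrow> 'a" and M
    have sub1: "B + (A - B) = A" if "B \<subseteq># A" for A B :: "nat multiset"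
      using that by simp
    have sub2: "A - B \<subseteq># M - B" if "A \<subseteq># M" for A B :: "nat multiset"
      using that by (simp add: subseteq_mset_def diff_le_mono)
    have sub3: "M - B - (A - B) = M - A" if "B \<subseteq># A" for A B :: "nat multiset"
      using that by (metis diff_diff_add_mset sub1)
    have sub4: "B + C \<subseteq># M" if "B \<subseteq># M" "C \<subseteq># M - B" for B C :: "nat multiset"
      using that by (metis subset_mset.add_left_mono sub1)
    have "(\<Sum>A | A \<subseteq># M. (\<Sum>B | B \<subseteq># A. f B * g (A - B)) * h (M - A)) =
          (\<Sum>(A, B) \<in> (SIGMA A:{A. A \<subseteq># M}. {B. B \<subseteq># A}). f B * g (A - B) * h (M - A))"
      by (subst sum.Sigma [symmetric]) (auto simp: finite_submultisets sum_distrib_right)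
    also have "\<dots> = (\<Sum>(B, C) \<in> (SIGMA B:{B. B \<subseteq># M}. {C. C \<subseteq># M - B}).
                        f B * g C * h (M - B - C))"
      by (rule sum.reindex_bij_witness
            [where i = "\<lambda>(B, C). (B + C, B)" and j = "\<lambda>(A, B). (B, A - B)"])
         (auto simp: sub1 sub2 sub3 sub4 intro: subset_mset.trans)
    also have "\<dots> = (\<Sum>B | B \<subseteq># M. f B * (\<Sum>C | C \<subseteq># M - B. g C * h (M - B - C)))"
      by (subst sum.Sigma [symmetric])
         (auto simp: finite_submultisets sum_distrib_left mult.assoc)
    finally show "(\<Sum>A | A \<subseteq># M. (\<Sum>B | B \<subseteq># A. f B * g (A - B)) * h (M - A)) =
        (\<Sum>B | B \<subseteq># M. f B * (\<Sum>C | C \<subseteq># M - B. g C * h (M - B - C)))" .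
  qed
  show "f * g = g * f"
  proof (transfer, rule ext)
    fix f g :: "nat multiset \<Rightarrow> 'a" and M :: "nat multiset"
    have dd: "M - (M - A) = A" if "A \<subseteq># M" for A
      using that by (metis add_diff_cancel_right' subset_mset.add_diff_inverse)
    show "(\<Sum>A | A \<subseteq># M. f A * g (M - A)) = (\<Sum>A | A \<subseteq># M. g A * f (M - A))"
      by (rule sum.reindex_bij_witness [where i = "\<lambda>A. M - A" and j = "\<lambda>A. M - A"])
         (auto simp: dd mult.commute)
  qed
  show "1 * f = f"
  proof (transfer, rule ext)
    fix f :: "nat multiset \<Rightarrow> 'a" and M
    have "(\<Sum>A | A \<subseteq># M. (if A = {#} then 1 else 0) * f (M - A)) =
          (\<Sum>A \<in> {A. A \<subseteq># M}. if A = {#} then f M else 0)"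
      by (rule sum.cong) auto
    also have "\<dots> = f M" by (subst sum.delta) (auto simp: finite_submultisets)
    finally show "(\<Sum>A | A \<subseteq># M. (if A = {#} then 1 else 0) * f (M - A)) = f M" .
  qed
  show "(f + g) * h = f * h + g * h"
    by transfer (simp add: algebra_simps sum.distrib)
  show "(0 :: 'a mps) \<noteq> 1"
    by transfer (auto simp: fun_eq_iff)
qed (transfer; simp add: fun_eq_iff algebra_simps)+

end

definition mconst :: "'a :: comm_ring_1 \<Rightarrow> 'a mps" where
  "mconst c = Abs_mps (\<lambda>M. if M = {#} then c else 0)"

definition monomial :: "nat multiset \<Rightarrow> 'a :: comm_ring_1 mps" where
  "monomial A = Abs_mps (\<lambda>M. if M = A then 1 else 0)"

abbreviation var :: "nat \<Rightarrow> 'a :: comm_ring_1 mps" where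
  "var i \<equiv> monomial {#i#}"

section \<open>The ground field and the spaces \<open>P(r)\<close>\<close>

text \<open>\<open>F = Q(q,t)\<close>, with \<open>q\<close> the outer and \<open>t\<close> the inner polynomial variable.\<close>

type_synonym ff = "rat poly poly fract"

definition qvar :: ff where "qvar = to_fract [:0, 1:]"
definition tvar :: ff where "tvar = to_fract [:[:0, 1:]:]"

text \<open>
  \<open>P(r) = F[x\<^sub>1,\<dots>,x\<^sub>r] \<otimes> \<Lambda>(x\<^bsub>r+1\<^esub>,\<dots>)\<close> as a subspace of the power series: bounded degree and
  symmetric in the variables after \<open>x\<^sub>r\<close>.  The operators below are total functions on power
  series; \<open>T\<^sub>i\<close> and \<open>d_plus s\<close>, \<open>d_minus s\<close> have their intended meaning on \<open>P(s)\<close>.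
\<close>

definition P_space :: "nat \<Rightarrow> ff mps set" where
  "P_space r = {f.
     (\<exists>n. \<forall>M. mcoeff f M \<noteq> 0 \<longrightarrow> size M \<le> n \<and> 0 \<notin># M) \<and>
     (\<forall>i > r. \<forall>M. mcoeff f (image_mset (transpose i (Suc i)) M) = mcoeff f M)}"

section \<open>Plethysm\<close>

text \<open>The power sum \<open>p\<^sub>k[x\<^bsub>m+1\<^esub> + x\<^bsub>m+2\<^esub> + \<dots>]\<close>, for \<open>k \<ge> 1\<close>.\<close>

definition psum :: "nat \<Rightarrow> nat \<Rightarrow> ff mps" where
  "psum m k = Abs_mps (\<lambda>M. if \<exists>i > m. M = replicate_mset k i then 1 else 0)"

text \<open>
  Expansion of a symmetric function \<open>f\<close> of \<open>x\<^bsub>m+1\<^esub>, x\<^bsub>m+2\<^esub>, \<dots>\<close> in the basis of power sum products,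
  indexed by partitions, i.e. multisets of positive integers.
\<close>

definition psum_expansion :: "nat \<Rightarrow> ff mps \<Rightarrow> nat multiset \<Rightarrow> ff" where
  "psum_expansion m f = (THE c.
     finite {\<mu>. c \<mu> \<noteq> 0} \<and> (\<forall>\<mu>. c \<mu> \<noteq> 0 \<longrightarrow> 0 \<notin># \<mu>) \<and>
     f = (\<Sum>\<mu> | c \<mu> \<noteq> 0. mconst (c \<mu>) * prod_mset (image_mset (psum m) \<mu>)))"

text \<open>
  \<open>plethysm m \<iota> f p\<close> is \<open>f[A]\<close> for the symmetric function \<open>f\<close> given in the variables
  \<open>x\<^bsub>m+1\<^esub>, x\<^bsub>m+2\<^esub>, \<dots>\<close>, where \<open>p k\<close> is \<open>p\<^sub>k[A]\<close> and \<open>\<iota>\<close> embeds the scalars into the target ring.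
\<close>

definition plethysm ::
    "nat \<Rightarrow> (ff \<Rightarrow> 'b :: comm_ring_1) \<Rightarrow> ff mps \<Rightarrow> (nat \<Rightarrow> 'b) \<Rightarrow> 'b" where
  "plethysm m \<iota> f p =
     (\<Sum>\<mu> | psum_expansion m f \<mu> \<noteq> 0.
        \<iota> (psum_expansion m f \<mu>) * prod_mset (image_mset p \<mu>))"

text \<open>
  \<open>\<Omega>[(1-t)u\<^sup>-\<^sup>1Z] = exp (\<Sum>\<^sub>k (1-t\<^sup>k) u\<^sup>-\<^sup>k p\<^sub>k[Z] / k)\<close> with \<open>Z = x\<^bsub>m+1\<^esub> + x\<^bsub>m+2\<^esub> + \<dots>\<close>, as a power series
  in the variable \<open>u\<^sup>-\<^sup>1\<close>.
\<close>

definition Omega :: "nat \<Rightarrow> ff mps fps" where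
  "Omega m =
     Abs_fps (\<lambda>j. mconst (inverse (fact j))) oo
     Abs_fps (\<lambda>k. if k = 0 then 0 else mconst ((1 - tvar ^ k) / of_nat k) * psum m k)"

text \<open>
  \<open>Bop m n f\<close> is \<open>B\<^sub>n f(Z)\<close> for \<open>Z = x\<^bsub>m+1\<^esub> + x\<^bsub>m+2\<^esub> + \<dots>\<close>.  The Laurent series have \<open>u\<^sup>-\<^sup>1\<close> as
  their variable, so that \<open>u\<close> itself is \<^const>\<open>fls_X_inv\<close>.
\<close>

definition Bop :: "nat \<Rightarrow> nat \<Rightarrow> ff mps \<Rightarrow> ff mps" where
  "Bop m n f =
     fls_nth (fls_X_inv ^ n
        * plethysm m (\<lambda>a. fls_const (mconst a)) f (\<lambda>k. fls_const (psum m k) - fls_X_inv ^ k)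
        * fps_to_fls (Omega m)) 0"

section \<open>The operators\<close>

definition swap_vars :: "nat \<Rightarrow> ff mps \<Rightarrow> ff mps" where
  "swap_vars i f = Abs_mps (\<lambda>M. mcoeff f (image_mset (transpose i (Suc i)) M))"

definition divided_diff :: "nat \<Rightarrow> ff mps \<Rightarrow> ff mps" where
  "divided_diff i f = (THE g. (var i - var (Suc i)) * g = f - swap_vars i f)"

definition T_op :: "nat \<Rightarrow> ff mps \<Rightarrow> ff mps" where
  "T_op i f = swap_vars i f + mconst (1 - tvar) * var i * divided_diff i f"

text \<open>\<open>T\<^sub>1 (T\<^sub>2 (\<dots> (T\<^sub>s (x\<^bsub>s+1\<^esub> f))))\<close> up to sign.\<close>

definition d_plus :: "nat \<Rightarrow> ff mps \<Rightarrow> ff mps" where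
  "d_plus s f = - foldr T_op [1..<Suc s] (var (Suc s) * f)"

text \<open>
  Every \<open>f \<in> P(s)\<close> is the finite sum over \<open>\<eta>\<close>, a multiset on \<open>{1..s}\<close>, of \<open>x\<^sup>\<eta> g\<^sub>\<eta>\<close> with \<open>g\<^sub>\<eta>\<close> the
  symmetric function \<open>tail_coeff s \<eta> f\<close> of \<open>x\<^bsub>s+1\<^esub>, x\<^bsub>s+2\<^esub>, \<dots>\<close>.
\<close>

definition tail_coeff :: "nat \<Rightarrow> nat multiset \<Rightarrow> ff mps \<Rightarrow> ff mps" where
  "tail_coeff s \<eta> f = Abs_mps (\<lambda>M. if set_mset M \<subseteq> {s<..} then mcoeff f (\<eta> + M) else 0)"

text \<open>The inner plethysm is \<open>g\<^sub>\<eta>[x\<^sub>s + x\<^bsub>s+1\<^esub> + \<dots>]\<close>; \<open>d_minus s\<close> is only meant for \<open>s \<ge> 1\<close>.\<close>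

definition d_minus :: "nat \<Rightarrow> ff mps \<Rightarrow> ff mps" where
  "d_minus s f =
     (\<Sum>\<eta> | set_mset \<eta> \<subseteq> {1..s} \<and> tail_coeff s \<eta> f \<noteq> 0.
        monomial (filter_mset (\<lambda>i. i \<noteq> s) \<eta>)
        * Bop (s - 1) (count \<eta> s) (plethysm s mconst (tail_coeff s \<eta> f) (psum (s - 1))))"

definition east_op :: "nat \<Rightarrow> ff mps \<Rightarrow> ff mps" where
  "east_op s f = mconst (- (tvar powi (- int s))) * d_plus s f"

text \<open>On \<open>P(s)\<close> with \<open>s \<ge> 1\<close>.\<close>

definition corner_op :: "nat \<Rightarrow> ff mps \<Rightarrow> ff mps" where
  "corner_op s f =
     mconst (1 / (inverse tvar - 1)) *
       (d_minus (Suc s) (east_op s f) - east_op (s - 1) (d_minus s f))"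

section \<open>Paths\<close>

datatype step = North | East

type_synonym path = "step list"
type_synonym box = "nat \<times> nat"

text \<open>Coordinates of the point reached after \<open>k\<close> steps from \<open>(0,r)\<close>.\<close>

definition xcoord :: "path \<Rightarrow> nat \<Rightarrow> nat" where
  "xcoord \<pi> k = count_list (take k \<pi>) East"

definition ycoord :: "nat \<Rightarrow> path \<Rightarrow> nat \<Rightarrow> nat" where
  "ycoord r \<pi> k = r + count_list (take k \<pi>) North"

definition Dyck_paths :: "nat \<Rightarrow> nat \<Rightarrow> path set" where
  "Dyck_paths r d = {\<pi>.
     xcoord \<pi> (length \<pi>) = d \<and> ycoord r \<pi> (length \<pi>) = d \<and>
     (\<forall>k \<le> length \<pi>. xcoord \<pi> k \<le> ycoord r \<pi> k)}"

text \<open>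
  A box is named by its northeast corner.  Box \<open>(c,j)\<close> lies in column \<open>c\<close>; it is below or above
  \<open>\<pi>\<close> according to its position relative to the east step of \<open>\<pi>\<close> in that column.  The \<open>r\<close> initial
  north steps of the extended path lie on the \<open>y\<close>-axis and do not affect this.
\<close>

definition below :: "nat \<Rightarrow> path \<Rightarrow> box \<Rightarrow> bool" where
  "below r \<pi> = (\<lambda>(c, j). 1 \<le> j \<and>
     (\<exists>k < length \<pi>. \<pi> ! k = East \<and> Suc (xcoord \<pi> k) = c \<and> j \<le> ycoord r \<pi> k))"

definition above :: "nat \<Rightarrow> path \<Rightarrow> box \<Rightarrow> bool" where
  "above r \<pi> = (\<lambda>(c, j).
     (\<exists>k < length \<pi>. \<pi> ! k = East \<and> Suc (xcoord \<pi> k) = c \<and> ycoord r \<pi> k < j))"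

text \<open>The whole box \<open>(i,j)\<close> is above the diagonal iff its southeast corner \<open>(i,j-1)\<close> is weakly so.\<close>

definition Area :: "nat \<Rightarrow> path \<Rightarrow> box set" where
  "Area r \<pi> = {(i, j). below r \<pi> (i, j) \<and> i < j}"

definition corners :: "nat \<Rightarrow> path \<Rightarrow> box set" where
  "corners r \<pi> = {(c, j). above r \<pi> (c, j) \<and> below r \<pi> (c, j - 1) \<and> below r \<pi> (Suc c, j)}"

definition is_marking :: "nat \<Rightarrow> path \<Rightarrow> box set \<Rightarrow> bool" where
  "is_marking r \<pi> S \<longleftrightarrow> S \<subseteq> corners r \<pi>"

section \<open>Flagged column super words\<close>

datatype letter = Pos nat | Neg nat

fun letter_abs :: "letter \<Rightarrow> nat" where
  "letter_abs (Pos v) = v"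
| "letter_abs (Neg v) = v"

fun negative :: "letter \<Rightarrow> bool" where
  "negative (Pos v) = False"
| "negative (Neg v) = True"

definition alphabet :: "letter set" where
  "alphabet = {a. 1 \<le> letter_abs a}"

instantiation letter :: linorder
begin

definition less_letter :: "letter \<Rightarrow> letter \<Rightarrow> bool" where
  "a < b \<longleftrightarrow> letter_abs a < letter_abs b \<or>
             (letter_abs a = letter_abs b \<and> \<not> negative a \<and> negative b)"

definition less_eq_letter :: "letter \<Rightarrow> letter \<Rightarrow> bool" where
  "a \<le> b \<longleftrightarrow> a < b \<or> a = (b :: letter)"

instance
proof
  fix a b c :: letter
  show "a < b \<longleftrightarrow> a \<le> b \<and> \<not> b \<le> a"
    by (auto simp: less_eq_letter_def less_letter_def)
  show "a \<le> a" by (simp add: less_eq_letter_def)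
  show "a \<le> b \<Longrightarrow> b \<le> c \<Longrightarrow> a \<le> c"
    by (auto simp: less_eq_letter_def less_letter_def)
  show "a \<le> b \<Longrightarrow> b \<le> a \<Longrightarrow> a = b"
    by (auto simp: less_eq_letter_def less_letter_def)
  show "a \<le> b \<or> b \<le> a"
    by (cases a; cases b) (auto simp: less_eq_letter_def less_letter_def)
qed

end

definition column_decreasing :: "letter \<Rightarrow> letter \<Rightarrow> bool" where
  "column_decreasing a b \<longleftrightarrow> a > b \<or> (a = b \<and> negative a)"

definition column_super_words :: "nat \<Rightarrow> nat \<Rightarrow> box set \<Rightarrow> (nat \<Rightarrow> letter) set" where
  "column_super_words r d S = {T \<in> {1..d} \<rightarrow>\<^sub>E alphabet.
     (\<forall>(i, j) \<in> S. column_decreasing (T j) (T i)) \<and> (\<forall>i \<in> {1..r}. T i \<le> Pos i)}"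

definition inv_tilde :: "nat \<Rightarrow> path \<Rightarrow> (nat \<Rightarrow> letter) \<Rightarrow> nat" where
  "inv_tilde r \<pi> T = card {(i, j) \<in> Area r \<pi>. column_decreasing (T j) (T i)}"

definition num_negative :: "nat \<Rightarrow> (nat \<Rightarrow> letter) \<Rightarrow> nat" where
  "num_negative d T = card {i \<in> {1..d}. negative (T i)}"

definition word_monomial :: "nat \<Rightarrow> (nat \<Rightarrow> letter) \<Rightarrow> nat multiset" where
  "word_monomial d T = image_mset (\<lambda>i. letter_abs (T i)) (mset_set {1..d})"

text \<open>
  The sum over the infinitely many words \<open>T\<close> is formed coefficientwise: only finitely many words
  contribute to each monomial.
\<close>

definition G_col :: "nat \<Rightarrow> nat \<Rightarrow> path \<Rightarrow> box set \<Rightarrow> ff \<Rightarrow> ff mps" where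
  "G_col r d \<pi> S u = Abs_mps (\<lambda>M.
     \<Sum>T | T \<in> column_super_words r d S \<and> word_monomial d T = M.
       u ^ inv_tilde r \<pi> T * (- u) powi (- int (num_negative d T)))"

section \<open>The characteristic function\<close>

text \<open>
  The list argument contains the steps still to be traversed, in backward order, after \<open>h\<close>
  horizontal and \<open>v\<close> vertical steps; the current point is \<open>(d-h, d-v)\<close>.  If the next two steps are
  North and East, this point is the northeast corner of the box they enclose.
\<close>

fun traverse :: "nat \<Rightarrow> box set \<Rightarrow> nat \<Rightarrow> nat \<Rightarrow> path \<Rightarrow> ff mps \<Rightarrow> ff mps" where
  "traverse d S h v [] f = f"
| "traverse d S h v (East # w) f = traverse d S (Suc h) v w (east_op (h - v) f)"
| "traverse d S h v (North # East # w) f =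
     (if (d - h, d - v) \<in> S
      then traverse d S (Suc h) (Suc v) w (corner_op (h - v) f)
      else traverse d S h (Suc v) (East # w) (d_minus (h - v) f))"
| "traverse d S h v (North # North # w) f =
     traverse d S h (Suc v) (North # w) (d_minus (h - v) f)"
| "traverse d S h v [North] f = d_minus (h - v) f"

definition chi_tilde :: "nat \<Rightarrow> path \<Rightarrow> box set \<Rightarrow> ff mps" where
  "chi_tilde d \<pi> S = traverse d S 0 0 (rev \<pi>) 1"

end

theory Submission
  imports Defs "HOL-Combinatorics.Permutations" "HOL-Library.Multiset_Order"
begin

text \<open>
  For fixed absolute values \<open>|T| = \<kappa>\<close>, summing over the signs of a flagged word factors over the
  positions and vanishes unless \<open>\<kappa>\<close> is a proper colouring of the graph \<open>Area(\<pi>)\<close>.  Since the flagged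
  positions form a clique, properness forces \<open>\<kappa>(i) = i\<close> on them, so for \<open>\<Sigma> = {}\<close> the series is
  \<open>(1-t)\<^bsup>d-r\<^esup>\<close> times a chromatic sum.  In an interval graph the subgraph on two adjacent colours \<open>k\<close>,
  \<open>k+1\<close> is a union of monotone paths; hence if \<open>f\<close> and \<open>g\<close> are the sums in which one fixed position has
  colour \<open>k\<close> and \<open>k+1\<close> respectively, both \<open>f + g\<close> and \<open>t x\<^bsub>k+1\<^esub> f + x\<^sub>k g\<close> are symmetric in \<open>x\<^sub>k\<close>, \<open>x\<^bsub>k+1\<^esub>\<close>.
  These two symmetries determine \<open>g\<close> from \<open>f\<close>: they give \<open>T\<^sub>k(x\<^bsub>k+1\<^esub> f) = x\<^sub>k g\<close>, so \<open>d\<^sub>+\<close> inserts a new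
  first position of colour 1, and they identify \<open>d\<^sub>-\<close> with the sum over all colours of the last flagged
  position, because the Hall--Littlewood coefficients of \<open>\<Omega>[(1-t)u\<^sup>-\<^sup>1Z]\<close>, sorted by their largest
  variable, satisfy the same two symmetries.  A marked corner is the difference of the two paths
  around it, since \<open>(t\<^sup>-\<^sup>1 - 1)[a > b] = t\<^bsup>-[a > b]\<^esup> - 1\<close>.
\<close>

section \<open>Coefficients of power series\<close>

text \<open>\<open>psum_expansion\<close> and \<open>divided_diff\<close> are definite descriptions,
  so the operators cannot be computed before power sum products are known to be a basis of the
  symmetric functions (in characteristic zero) and the power series a domain. The domain property
  also makes the Hecke partner of a series unique. Plethysm is then eliminated: \<open>f\<close> in
  \<open>P_space s\<close> is \<open>P(x_s)\<close> for a polynomial \<open>P\<close> with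
  coefficients symmetric in \<open>x_s, x_{s+1}, ...\<close>, and \<open>d_minus s f\<close> is the
  constant term in \<open>u\<close> of \<open>P(u)\<close> times the series
  \<open>Omega (s - 1)\<close>. The edge sets met on the way need not be areas of one path, because
  every marked corner doubles their number. The state of the traversal is therefore a formal linear
  combination of edge sets on the positions \<open>m + 1, ..., d\<close>. It is matched with the
  marking through its value on single words, where each corner becomes an indicator. Symmetry is
  proved for finitely many colours and carried over to infinitely many by truncating to the
  variables up to \<open>x_N\<close>.\<close>

lemma mcoeff_0 [simp]: "mcoeff 0 M = 0"
  and mcoeff_1: "mcoeff 1 M = (if M = {#} then 1 else 0)"
  and mcoeff_add [simp]: "mcoeff (f + g) M = mcoeff f M + mcoeff g M"
  and mcoeff_diff [simp]: "mcoeff (f - g) M = mcoeff f M - mcoeff g M"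
  and mcoeff_uminus [simp]: "mcoeff (- f) M = - mcoeff f M"
  and mcoeff_times: "mcoeff (f * g) M = (\<Sum>A | A \<subseteq># M. mcoeff f A * mcoeff g (M - A))"
  by (transfer; simp)+

lemma mcoeff_sum [simp]: "mcoeff (sum f A) M = (\<Sum>a\<in>A. mcoeff (f a) M)"
  by (induction A rule: infinite_finite_induct) auto

lemma mcoeff_Abs [simp]: "mcoeff (Abs_mps f) M = f M"
  by (simp add: Abs_mps_inverse)

lemma mcoeff_mconst: "mcoeff (mconst c) M = (if M = {#} then c else 0)"
  by (simp add: mconst_def)

lemma mcoeff_monomial: "mcoeff (monomial A) M = (if M = A then 1 else 0)"
  by (simp add: monomial_def)

lemma mcoeff_monomial_times:
  "mcoeff (monomial A * f) M = (if A \<subseteq># M then mcoeff f (M - A) else 0)"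
proof -
  have "mcoeff (monomial A * f) M = (\<Sum>B\<in>{B. B \<subseteq># M}. if B = A then mcoeff f (M - A) else 0)"
    unfolding mcoeff_times by (rule sum.cong) (auto simp: mcoeff_monomial)
  thus ?thesis by (simp add: sum.delta finite_submultisets)
qed

lemma monomial_empty: "monomial {#} = 1"
  by (rule mps_eqI) (simp add: mcoeff_monomial mcoeff_1)

lemma monomial_add: "monomial (A + B) = (monomial A * monomial B :: 'a :: comm_ring_1 mps)"
proof (rule mps_eqI)
  fix M
  have "M = A + B \<longleftrightarrow> A \<subseteq># M \<and> M - A = B"
    by (metis add_diff_cancel_left' mset_subset_eq_add_left subset_mset.add_diff_inverse)
  thus "mcoeff (monomial (A + B) :: 'a mps) M = mcoeff (monomial A * monomial B) M"
    by (simp add: mcoeff_monomial_times mcoeff_monomial)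
qed

lemma monomial_add_mset: "monomial (add_mset i A) = (var i * monomial A :: 'a :: comm_ring_1 mps)"
  using monomial_add[of "{#i#}" A] by simp

lemma var_power: "var i ^ k = (monomial (replicate_mset k i) :: 'a :: comm_ring_1 mps)"
proof (induction k)
  case (Suc k)
  thus ?case using monomial_add_mset[of i "replicate_mset k i", where 'a = 'a] by simp
qed (simp add: monomial_empty)

lemma mcoeff_mconst_times [simp]: "mcoeff (mconst c * f) M = c * mcoeff f M"
proof -
  have "mcoeff (mconst c * f) M = (\<Sum>B\<in>{B. B \<subseteq># M}. if B = {#} then c * mcoeff f M else 0)"
    unfolding mcoeff_times by (rule sum.cong) (auto simp: mcoeff_mconst)
  thus ?thesis by (simp add: sum.delta finite_submultisets)
qed

lemma mconst_0 [simp]: "mconst 0 = 0" and mconst_1 [simp]: "mconst 1 = 1"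
  and mconst_add: "mconst (a + b) = mconst a + mconst b"
  and mconst_diff: "mconst (a - b) = mconst a - mconst b"
  and mconst_uminus: "mconst (- a) = - mconst a"
  by (rule mps_eqI; simp add: mcoeff_mconst mcoeff_1)+

lemma mconst_mult: "mconst (a * b) = mconst a * mconst b"
  by (rule mps_eqI) (simp add: mcoeff_mconst)

lemma mconst_of_nat: "mconst (of_nat n) = of_nat n"
  by (induction n) (auto simp: mconst_add)

text \<open>The multiset order well-orders the monomials compatibly with multiplication, so the least
  terms of two nonzero series multiply to a nonzero term.\<close>

instance mps :: (idom) idom
proof
  fix f g :: "'a mps"
  assume "f \<noteq> 0" "g \<noteq> 0"
  then obtain A0 B0 where A0: "mcoeff f A0 \<noteq> 0" and B0: "mcoeff g B0 \<noteq> 0"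
    by (metis mcoeff_0 mps_eqI)
  define A where "A = (LEAST A. mcoeff f A \<noteq> 0)"
  define B where "B = (LEAST B. mcoeff g B \<noteq> 0)"
  have A: "mcoeff f A \<noteq> 0" unfolding A_def using A0 by (rule LeastI[of "\<lambda>A. mcoeff f A \<noteq> 0"])
  have B: "mcoeff g B \<noteq> 0" unfolding B_def using B0 by (rule LeastI[of "\<lambda>B. mcoeff g B \<noteq> 0"])
  have Amin: "A \<le> C" if "mcoeff f C \<noteq> 0" for C
    unfolding A_def using that by (rule Least_le[of "\<lambda>A. mcoeff f A \<noteq> 0"])
  have Bmin: "B \<le> C" if "mcoeff g C \<noteq> 0" for C
    unfolding B_def using that by (rule Least_le[of "\<lambda>B. mcoeff g B \<noteq> 0"])
  have "mcoeff f C * mcoeff g (A + B - C) = (if C = A then mcoeff f A * mcoeff g B else 0)"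
    if C: "C \<subseteq># A + B" for C
  proof (cases "C = A")
    case False
    have "\<not> (A \<le> C \<and> B \<le> A + B - C)"
    proof
      assume *: "A \<le> C \<and> B \<le> A + B - C"
      hence "A < C" using False by auto
      hence "A + B < C + (A + B - C)" using * by (intro add_less_le_mono) auto
      thus False using C by simp
    qed
    thus ?thesis using False Amin Bmin by auto
  qed auto
  hence "mcoeff (f * g) (A + B) = (\<Sum>C\<in>{C. C \<subseteq># A + B}. if C = A then mcoeff f A * mcoeff g B else 0)"
    unfolding mcoeff_times by (intro sum.cong) auto
  also have "\<dots> = mcoeff f A * mcoeff g B"
    by (simp add: sum.delta finite_submultisets)
  finally show "f * g \<noteq> 0" using A B by auto
qed

section \<open>Swapping variables\<close>

abbreviation swap :: "nat \<Rightarrow> nat \<Rightarrow> nat" where "swap i \<equiv> transpose i (Suc i)"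

lemma swap_swap_mset [simp]: "image_mset (swap i) (image_mset (swap i) M) = M"
  by (simp add: multiset.map_comp comp_def)

lemma image_mset_subseteq_iff_inj:
  assumes "inj g" shows "image_mset g A \<subseteq># image_mset g M \<longleftrightarrow> A \<subseteq># M"
proof
  assume *: "image_mset g A \<subseteq># image_mset g M"
  have "image_mset (inv g) (image_mset g A) \<subseteq># image_mset (inv g) (image_mset g M)"
    by (rule image_mset_subseteq_mono[OF *])
  thus "A \<subseteq># M" using assms by (simp add: multiset.map_comp)
qed (rule image_mset_subseteq_mono)

lemma swap_mset_subseteq: "image_mset (swap i) A \<subseteq># M \<longleftrightarrow> A \<subseteq># image_mset (swap i) M"
  using image_mset_subseteq_iff_inj[of "swap i" A "image_mset (swap i) M"] by simp

lemma swap_mset_diff: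
  assumes "A \<subseteq># M"
  shows "image_mset (swap i) (M - A) = image_mset (swap i) M - image_mset (swap i) A"
  using assms by (rule image_mset_Diff)

lemma mcoeff_swap: "mcoeff (swap_vars i f) M = mcoeff f (image_mset (swap i) M)"
  by (simp add: swap_vars_def)

lemma swap_vars_add [simp]: "swap_vars i (f + g) = swap_vars i f + swap_vars i g"
  and swap_vars_diff [simp]: "swap_vars i (f - g) = swap_vars i f - swap_vars i g"
  and swap_vars_uminus [simp]: "swap_vars i (- f) = - swap_vars i f"
  and swap_vars_0 [simp]: "swap_vars i 0 = 0"
  and swap_vars_mconst [simp]: "swap_vars i (mconst c) = mconst c"
  and swap_vars_1 [simp]: "swap_vars i 1 = 1"
  and swap_vars_swap_vars [simp]: "swap_vars i (swap_vars i f) = f"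
  by (rule mps_eqI; simp add: mcoeff_swap mcoeff_mconst mcoeff_1)+

lemma swap_vars_monomial: "swap_vars i (monomial A) = monomial (image_mset (swap i) A)"
  by (rule mps_eqI) (auto simp: mcoeff_swap mcoeff_monomial)

lemma swap_vars_mult [simp]: "swap_vars i (f * g) = swap_vars i f * swap_vars i g"
proof (rule mps_eqI)
  fix M
  show "mcoeff (swap_vars i (f * g)) M = mcoeff (swap_vars i f * swap_vars i g) M"
    unfolding mcoeff_swap mcoeff_times
    by (rule sum.reindex_bij_witness
          [where i = "image_mset (swap i)" and j = "image_mset (swap i)"])
       (auto simp: swap_mset_subseteq swap_mset_diff)
qed

lemma swap_vars_sum [simp]: "swap_vars i (sum f A) = (\<Sum>a\<in>A. swap_vars i (f a))"
  by (induction A rule: infinite_finite_induct) auto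

lemma swap_vars_prod [simp]: "swap_vars i (prod f A) = (\<Prod>a\<in>A. swap_vars i (f a))"
  by (induction A rule: infinite_finite_induct) auto

lemma swap_vars_prod_mset [simp]:
  "swap_vars i (prod_mset (image_mset f A)) = prod_mset (image_mset (\<lambda>a. swap_vars i (f a)) A)"
  by (induction A) auto

lemma swap_vars_var [simp]:
  "swap_vars i (var i) = var (Suc i)" "swap_vars i (var (Suc i)) = var i"
  by (simp_all add: swap_vars_monomial)

lemma var_eq_iff [simp]: "var i = (var j :: 'a :: comm_ring_1 mps) \<longleftrightarrow> i = j"
proof
  assume "var i = (var j :: 'a mps)"
  hence "mcoeff (var i :: 'a mps) {#i#} = mcoeff (var j) {#i#}" by simp
  thus "i = j" by (auto simp: mcoeff_monomial split: if_splits)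
qed simp

section \<open>Characteristic zero\<close>

lemma of_nat_fract: "(of_nat n :: 'a :: idom fract) = to_fract (of_nat n)"
  by (induction n) auto

text \<open>Needed twice: the power sum basis has positive integers on its diagonal, and the
  recurrence for \<open>Omega\<close> is solved by cancelling \<open>n\<close>.\<close>

instance fract :: ("{idom, ring_char_0}") ring_char_0
proof
  show "inj (of_nat :: nat \<Rightarrow> 'a fract)"
    by (rule injI) (simp add: of_nat_fract)
qed

instance fract :: ("{idom, ring_char_0}") field_char_0 ..

lemma tvar_nonzero [simp]: "tvar \<noteq> 0" and tvar_neq_1 [simp]: "tvar \<noteq> 1"
proof -
  have "[:[:0, 1:]:] \<noteq> (1 :: rat poly poly)" by (simp add: one_pCons)
  thus "tvar \<noteq> 1" unfolding tvar_def by (metis to_fract_1 to_fract_eq_iff)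
qed (simp add: tvar_def)

section \<open>Power sums\<close>

lemma mcoeff_psum_times:
  assumes "k > 0"
  shows "mcoeff (psum m k * f) M =
         (\<Sum>i | i \<in># M \<and> m < i \<and> k \<le> count M i. mcoeff f (M - replicate_mset k i))"
proof -
  let ?I = "{i. i \<in># M \<and> m < i \<and> k \<le> count M i}"
  have sub: "replicate_mset k i \<subseteq># M \<longleftrightarrow> k \<le> count M i" for i
    by (simp add: count_le_replicate_mset_subset_eq)
  \<comment> \<open>For \<open>k = 0\<close> all \<open>replicate_mset k i\<close> would
    coincide.\<close>
  have inj: "inj_on (replicate_mset k) ?I"
    using assms by (auto simp: inj_on_def replicate_mset_eq_iff)
  have "mcoeff (psum m k * f) M =
        (\<Sum>A\<in>replicate_mset k ` ?I. mcoeff f (M - A))"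
    unfolding mcoeff_times
  proof (rule sum.mono_neutral_cong_right[OF finite_submultisets])
    show "replicate_mset k ` ?I \<subseteq> {A. A \<subseteq># M}" by (auto simp: sub)
    show "\<forall>A\<in>{A. A \<subseteq># M} - replicate_mset k ` ?I. mcoeff (psum m k) A * mcoeff f (M - A) = 0"
    proof
      fix A assume A: "A \<in> {A. A \<subseteq># M} - replicate_mset k ` ?I"
      have "\<not> (\<exists>i>m. A = replicate_mset k i)"
      proof
        assume "\<exists>i>m. A = replicate_mset k i"
        then obtain i where i: "i > m" "A = replicate_mset k i" by blast
        have "k \<le> count M i" using A i sub by auto
        moreover from this have "i \<in># M" using assms
          by (metis count_eq_zero_iff le_zero_eq less_numeral_extra(3))
        ultimately show False using A i by blast
      qed
      hence "mcoeff (psum m k) A = 0" by (simp only: psum_def mcoeff_Abs if_False)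
      thus "mcoeff (psum m k) A * mcoeff f (M - A) = 0" by simp
    qed
  qed (auto simp: psum_def)
  also have "\<dots> = (\<Sum>i\<in>?I. mcoeff f (M - replicate_mset k i))"
    by (simp add: sum.reindex[OF inj])
  finally show ?thesis .
qed

lemma mcoeff_psum: "mcoeff (psum m k) M = (if \<exists>i > m. M = replicate_mset k i then 1 else 0)"
  by (simp add: psum_def)

lemma swap_vars_psum:
  assumes "i > m" shows "swap_vars i (psum m k) = psum m k"
proof (rule mps_eqI)
  fix M
  have *: "(\<exists>j>m. image_mset (swap i) N = replicate_mset k j)" if "\<exists>j>m. N = replicate_mset k j" for N
  proof -
    from that obtain j where j: "j > m" "N = replicate_mset k j" by blast
    have "swap i j > m" using j assms by (auto simp: transpose_def)
    thus ?thesis using j by auto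
  qed
  have "(\<exists>j>m. image_mset (swap i) M = replicate_mset k j) \<longleftrightarrow> (\<exists>j>m. M = replicate_mset k j)"
    using *[of M] *[of "image_mset (swap i) M"] by auto
  thus "mcoeff (swap_vars i (psum m k)) M = mcoeff (psum m k) M"
    by (simp add: mcoeff_swap mcoeff_psum)
qed

lemma psum_split_first:
  assumes "k > 0" "s \<ge> 1"
  shows "psum (s - 1) k = psum s k + var s ^ k"
proof (rule mps_eqI)
  fix M
  have "(\<exists>i>s - 1. M = replicate_mset k i) \<longleftrightarrow> M = replicate_mset k s \<or> (\<exists>i>s. M = replicate_mset k i)"
  proof -
    have "i > s - 1 \<longleftrightarrow> i = s \<or> i > s" for i using assms(2) by auto
    thus ?thesis by (simp only: conj_disj_distribR ex_disj_distrib simp_thms)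
  qed
  moreover have "\<not> (\<exists>i>s. M = replicate_mset k i)" if "M = replicate_mset k s"
    using that assms(1) by (auto simp: replicate_mset_eq_iff)
  ultimately show "mcoeff (psum (s - 1) k) M = mcoeff (psum s k + var s ^ k) M"
    unfolding var_power by (auto simp: mcoeff_psum mcoeff_monomial)
qed

section \<open>Products of power sums as a basis of the symmetric functions\<close>

definition psums :: "nat \<Rightarrow> nat multiset \<Rightarrow> ff mps" where
  "psums m \<mu> = prod_mset (image_mset (psum m) \<mu>)"

lemma swap_vars_psums: "i > m \<Longrightarrow> swap_vars i (psums m \<mu>) = psums m \<mu>"
  by (simp add: psums_def swap_vars_psum)

text \<open>The partition underlying a monomial. By \<open>mcoeff_cong_exponents\<close> a symmetric
  series has one coefficient per partition.\<close>

definition exponents :: "nat multiset \<Rightarrow> nat multiset" where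
  "exponents M = image_mset (count M) (mset_set (set_mset M))"

lemma exponents_empty [simp]: "exponents {#} = {#}"
  by (simp add: exponents_def)

lemma size_exponents: "size (exponents M) = card (set_mset M)"
  by (simp add: exponents_def)

lemma sum_mset_exponents: "sum_mset (exponents M) = size M"
  by (simp add: exponents_def size_multiset_overloaded_eq sum_unfold_sum_mset)

lemma zero_notin_exponents: "0 \<notin># exponents M"
  by (simp add: exponents_def image_iff count_eq_zero_iff)

lemma exponents_add_replicate:
  assumes "i \<notin># M" "k > 0"
  shows "exponents (M + replicate_mset k i) = add_mset k (exponents M)"
proof -
  have "set_mset (M + replicate_mset k i) = insert i (set_mset M)" using assms by auto
  moreover have "image_mset (count (M + replicate_mset k i)) (mset_set (set_mset M)) =
                 image_mset (count M) (mset_set (set_mset M))"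
    using assms by (intro image_mset_cong) auto
  moreover have "count M i = 0" using assms(1) by (simp add: not_in_iff)
  ultimately show ?thesis using assms(1) by (simp add: exponents_def)
qed

lemma exponents_remove:
  assumes "i \<in># M"
  shows "exponents M = add_mset (count M i) (exponents (M - replicate_mset (count M i) i))"
proof -
  let ?N = "M - replicate_mset (count M i) i"
  have "i \<notin># ?N" by (simp add: not_in_iff)
  moreover have "?N + replicate_mset (count M i) i = M"
    by (simp add: count_le_replicate_mset_subset_eq[symmetric])
  ultimately show ?thesis using exponents_add_replicate[of i ?N "count M i"] assms by simp
qed

text \<open>Infinitely many variables are available, so fresh ones beyond \<open>x_m\<close> can
  always be found.\<close>

lemma ex_exponents:
  assumes "0 \<notin># \<mu>"
  shows "\<exists>M. set_mset M \<subseteq> {m<..} \<and> exponents M = \<mu>"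
  using assms
proof (induction \<mu>)
  case (add k \<mu>)
  then obtain M where M: "set_mset M \<subseteq> {m<..}" "exponents M = \<mu>" by auto
  obtain i where i: "i \<notin> {..m} \<union> set_mset M"
    using ex_new_if_finite[OF infinite_UNIV_nat, of "{..m} \<union> set_mset M"] by auto
  have "set_mset (M + replicate_mset k i) \<subseteq> {m<..}" using M i by auto
  thus ?case using exponents_add_replicate[of i M k] M i add.prems by (intro exI[of _ "M + replicate_mset k i"]) auto
qed (rule exI[of _ "{#}"], auto)

text \<open>Products of power sums are triangular in the monomials with respect to the number of parts, with
  nonzero diagonal; this makes them a basis.\<close>

lemma mcoeff_psums:
  assumes "0 \<notin># \<mu>"
  shows "\<exists>n :: nat. mcoeff (psums m \<mu>) M = of_nat n \<and>
           (n > 0 \<longrightarrow> set_mset M \<subseteq> {m<..} \<and> size M = sum_mset \<mu> \<and> card (set_mset M) \<le> size \<mu> \<and>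
                     (card (set_mset M) = size \<mu> \<longrightarrow> exponents M = \<mu>)) \<and>
           (exponents M = \<mu> \<and> set_mset M \<subseteq> {m<..} \<longrightarrow> n > 0)"
  using assms
proof (induction \<mu> arbitrary: M)
  case empty
  have "exponents M = {#} \<longleftrightarrow> M = {#}"
    using size_exponents[of M] by auto
  thus ?case by (auto simp: psums_def mcoeff_1 intro: exI[of _ "if M = {#} then 1 else 0"])
next
  case (add k \<mu>)
  hence k: "k > 0" and \<mu>: "0 \<notin># \<mu>" by auto
  let ?I = "{i. i \<in># M \<and> m < i \<and> k \<le> count M i}"
  let ?N = "\<lambda>i. M - replicate_mset k i"
  have "\<exists>n. \<forall>M. mcoeff (psums m \<mu>) M = of_nat (n M :: nat) \<and>
           (n M > 0 \<longrightarrow> set_mset M \<subseteq> {m<..} \<and> size M = sum_mset \<mu> \<and> card (set_mset M) \<le> size \<mu> \<and>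
                     (card (set_mset M) = size \<mu> \<longrightarrow> exponents M = \<mu>)) \<and>
           (exponents M = \<mu> \<and> set_mset M \<subseteq> {m<..} \<longrightarrow> n M > 0)"
    by (rule choice) (use add.IH[OF \<mu>] in blast)
  then obtain n where n:
    "mcoeff (psums m \<mu>) M = of_nat (n M)"
    "n M > 0 \<Longrightarrow> set_mset M \<subseteq> {m<..}"
    "n M > 0 \<Longrightarrow> size M = sum_mset \<mu>"
    "n M > 0 \<Longrightarrow> card (set_mset M) \<le> size \<mu>"
    "n M > 0 \<Longrightarrow> card (set_mset M) = size \<mu> \<Longrightarrow> exponents M = \<mu>"
    "exponents M = \<mu> \<Longrightarrow> set_mset M \<subseteq> {m<..} \<Longrightarrow> n M > 0" for M
    by blast
  have fin: "finite ?I" by (rule finite_subset[of _ "set_mset M"]) auto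
  show ?case
  proof (intro exI conjI impI)
    have "mcoeff (psums m (add_mset k \<mu>)) M = (\<Sum>i\<in>?I. mcoeff (psums m \<mu>) (?N i))"
      using mcoeff_psum_times[OF k] by (simp add: psums_def)
    thus "mcoeff (psums m (add_mset k \<mu>)) M = of_nat (\<Sum>i\<in>?I. n (?N i))" by (simp add: n(1))
  next
    assume "0 < (\<Sum>i\<in>?I. n (?N i))"
    hence "\<exists>i\<in>?I. n (?N i) > 0" by (metis (no_types, lifting) not_gr_zero sum.neutral)
    then obtain i where i: "i \<in># M" "m < i" "k \<le> count M i" "n (?N i) > 0" by auto
    have M: "?N i + replicate_mset k i = M"
      using i(3) by (simp add: count_le_replicate_mset_subset_eq[symmetric])
    hence set: "set_mset M = insert i (set_mset (?N i))"
      using k by (subst M[symmetric], subst set_mset_union) auto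
    show "set_mset M \<subseteq> {m<..}" using n(2)[OF i(4)] i(2) unfolding set by auto
    show "size M = sum_mset (add_mset k \<mu>)"
      using n(3)[OF i(4)] arg_cong[OF M, of size] by simp
    have le: "card (set_mset M) \<le> Suc (card (set_mset (?N i)))"
      unfolding set by (simp add: card_insert_le_m1 card_insert_if)
    thus "card (set_mset M) \<le> size (add_mset k \<mu>)" using n(4)[OF i(4)] by simp
    assume eq: "card (set_mset M) = size (add_mset k \<mu>)"
    hence c: "card (set_mset (?N i)) = size \<mu>" using le n(4)[OF i(4)] by simp
    \<comment> \<open>If \<open>x_i\<close> still occurred in \<open>?N i\<close>, removing the
      power would not lower the number of distinct variables, which would then be
      \<open>size \<mu>\<close> only.\<close>
    have "i \<notin># ?N i"
    proof
      assume "i \<in># ?N i"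
      hence "set_mset M = set_mset (?N i)" unfolding set by auto
      thus False using eq c by simp
    qed
    thus "exponents M = add_mset k \<mu>"
      using n(5)[OF i(4) c] exponents_add_replicate[of i "?N i" k] k M by simp
  next
    assume *: "exponents M = add_mset k \<mu> \<and> set_mset M \<subseteq> {m<..}"
    hence "k \<in># exponents M" by simp
    then obtain i where i: "i \<in># M" "count M i = k" by (auto simp: exponents_def)
    have "exponents (?N i) = \<mu>" using exponents_remove[OF i(1)] i(2) * by simp
    moreover have "set_mset (?N i) \<subseteq> {m<..}" using * by (auto dest: in_diffD)
    ultimately have "n (?N i) > 0" by (rule n(6))
    moreover have "i \<in> ?I" using i * by auto
    ultimately show "0 < (\<Sum>i\<in>?I. n (?N i))"
      using fin by (meson sum_pos2 zero_le)
  qed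
qed

lemma mcoeff_psums_eq_0:
  assumes "0 \<notin># \<mu>"
  shows "card (set_mset M) > size \<mu> \<Longrightarrow> mcoeff (psums m \<mu>) M = 0"
    and "card (set_mset M) = size \<mu> \<Longrightarrow> exponents M \<noteq> \<mu> \<Longrightarrow> mcoeff (psums m \<mu>) M = 0"
    and "size M \<noteq> sum_mset \<mu> \<Longrightarrow> mcoeff (psums m \<mu>) M = 0"
    and "\<not> set_mset M \<subseteq> {m<..} \<Longrightarrow> mcoeff (psums m \<mu>) M = 0"
  using mcoeff_psums[OF assms, of m M] by auto

lemma mcoeff_psums_diag:
  assumes "set_mset M \<subseteq> {m<..}"
  shows "mcoeff (psums m (exponents M)) M \<noteq> 0"
  using mcoeff_psums[OF zero_notin_exponents, of m M M] assms by auto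

text \<open>In a relation, let \<open>\<nu>\<close> be a longest partition with nonzero coefficient.
  At a monomial with exponents \<open>\<nu>\<close>, shorter partitions cannot reach as many
  variables and other partitions of the same length do not fit, so only the nonzero diagonal term of
  \<open>\<nu>\<close> survives.\<close>

lemma psums_independent:
  assumes fin: "finite {\<mu>. c \<mu> \<noteq> 0}" and pos: "\<And>\<mu>. c \<mu> \<noteq> 0 \<Longrightarrow> 0 \<notin># \<mu>"
    and zero: "(\<Sum>\<mu> | c \<mu> \<noteq> 0. mconst (c \<mu>) * psums m \<mu>) = 0"
  shows "c \<mu> = 0"
proof (rule ccontr)
  assume "c \<mu> \<noteq> 0"
  define l where "l = Max (size ` {\<mu>. c \<mu> \<noteq> 0})"
  have "l \<in> size ` {\<mu>. c \<mu> \<noteq> 0}" unfolding l_def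
    using fin \<open>c \<mu> \<noteq> 0\<close> by (intro Max_in) auto
  then obtain \<nu> where \<nu>: "c \<nu> \<noteq> 0" "size \<nu> = l" by auto
  have le: "size \<kappa> \<le> size \<nu>" if "c \<kappa> \<noteq> 0" for \<kappa>
    unfolding \<nu> l_def using fin that by (intro Max_ge) auto
  obtain M where M: "set_mset M \<subseteq> {m<..}" "exponents M = \<nu>"
    using ex_exponents[OF pos[OF \<nu>(1)]] by blast
  have "c \<kappa> * mcoeff (psums m \<kappa>) M = 0" if "c \<kappa> \<noteq> 0" "\<kappa> \<noteq> \<nu>" for \<kappa>
    using mcoeff_psums_eq_0(1,2)[OF pos[OF that(1)], of M m] le[OF that(1)] that M size_exponents[of M]
    by (cases "size \<kappa> = size \<nu>") auto
  hence "(\<Sum>\<kappa> | c \<kappa> \<noteq> 0. c \<kappa> * mcoeff (psums m \<kappa>) M) =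
         (\<Sum>\<kappa> | c \<kappa> \<noteq> 0. if \<kappa> = \<nu> then c \<nu> * mcoeff (psums m \<nu>) M else 0)"
    by (intro sum.cong) auto
  also have "\<dots> = c \<nu> * mcoeff (psums m \<nu>) M" using fin \<nu> by (simp add: sum.delta)
  finally have "mcoeff (\<Sum>\<mu> | c \<mu> \<noteq> 0. mconst (c \<mu>) * psums m \<mu>) M \<noteq> 0"
    using \<nu> mcoeff_psums_diag[OF M(1)] M(2) by simp
  thus False unfolding zero by simp
qed

text \<open>Resolves the definite description: the difference of two expansions is a relation, hence
  trivial.\<close>

lemma psum_expansion_eqI:
  assumes fin: "finite {\<mu>. c \<mu> \<noteq> 0}" and pos: "\<And>\<mu>. c \<mu> \<noteq> 0 \<Longrightarrow> 0 \<notin># \<mu>"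
    and f: "f = (\<Sum>\<mu> | c \<mu> \<noteq> 0. mconst (c \<mu>) * psums m \<mu>)"
  shows "psum_expansion m f = c"
  unfolding psum_expansion_def psums_def[symmetric]
proof (rule the_equality)
  fix c' assume c': "finite {\<mu>. c' \<mu> \<noteq> 0} \<and> (\<forall>\<mu>. c' \<mu> \<noteq> 0 \<longrightarrow> 0 \<notin># \<mu>) \<and>
    f = (\<Sum>\<mu> | c' \<mu> \<noteq> 0. mconst (c' \<mu>) * psums m \<mu>)"
  let ?I = "{\<mu>. c \<mu> \<noteq> 0} \<union> {\<mu>. c' \<mu> \<noteq> 0}"
  have fin': "finite {\<mu>. c' \<mu> - c \<mu> \<noteq> 0}"
    by (rule finite_subset[of _ ?I]) (use fin c' in auto)
  have I: "(\<Sum>\<mu> | b \<mu> \<noteq> 0. mconst (b \<mu>) * psums m \<mu>) = (\<Sum>\<mu>\<in>?I. mconst (b \<mu>) * psums m \<mu>)"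
    if "{\<mu>. b \<mu> \<noteq> 0} \<subseteq> ?I" for b
    using fin c' that by (intro sum.mono_neutral_left) auto
  have "(\<Sum>\<mu> | c' \<mu> - c \<mu> \<noteq> 0. mconst (c' \<mu> - c \<mu>) * psums m \<mu>) = f - f"
    by (subst I, force)
       (use c' f I[of c] I[of c'] in \<open>simp add: mconst_diff algebra_simps sum_subtractf\<close>)
  hence zero: "(\<Sum>\<mu> | c' \<mu> - c \<mu> \<noteq> 0. mconst (c' \<mu> - c \<mu>) * psums m \<mu>) = 0" by simp
  have "c' \<mu> - c \<mu> = 0" for \<mu>
    by (rule psums_independent[OF fin' _ zero]) (metis pos c' diff_self)
  thus "c' = c" by auto
qed (use assms in blast)

text \<open>Only adjacent swaps are given. Conjugating by the swap of \<open>a + n\<close> and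
  \<open>a + n + 1\<close> lengthens a transposition by one.\<close>

lemma mcoeff_transpose:
  assumes sym: "\<And>i. i > m \<Longrightarrow> swap_vars i f = f" and "a > m" "b > m"
  shows "mcoeff f (image_mset (transpose a b) M) = mcoeff f M"
proof -
  have adj: "mcoeff f (image_mset (swap i) M) = mcoeff f M" if "i > m" for i M
    using sym[OF that] by (metis mcoeff_swap)
  have *: "mcoeff f (image_mset (transpose a (a + n)) M) = mcoeff f M" if "a > m" for a n M
  proof (induction n arbitrary: M)
    case (Suc n)
    show ?case
    proof (cases "n = 0")
      case False
      have "transpose a (a + Suc n) = swap (a + n) \<circ> (transpose a (a + n) \<circ> swap (a + n))"
        using False by (auto simp: fun_eq_iff transpose_def)
      hence "image_mset (transpose a (a + Suc n)) M =
             image_mset (swap (a + n)) (image_mset (transpose a (a + n)) (image_mset (swap (a + n)) M))"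
        by (simp only: multiset.map_comp)
      thus ?thesis using adj[of "a + n"] Suc.IH that by simp
    qed (use adj that in simp)
  qed (simp add: transpose_def)
  show ?thesis
  proof (cases "a \<le> b")
    case True
    thus ?thesis using *[of a "b - a" M] assms by simp
  next
    case False
    thus ?thesis using *[of b "a - b" M] assms by (simp add: transpose_commute)
  qed
qed

lemma mcoeff_permutes:
  assumes sym: "\<And>i. i > m \<Longrightarrow> swap_vars i f = f"
    and "p permutes A" "finite A" "A \<subseteq> {m<..}"
  shows "mcoeff f (image_mset p M) = mcoeff f M"
  using assms(2,3,4)
proof (induction arbitrary: M rule: permutes_induct)
  case (swap a b p)
  have "a > m" "b > m" using swap by auto
  hence "mcoeff f (image_mset (transpose a b) (image_mset p M)) = mcoeff f (image_mset p M)"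
    using mcoeff_transpose[of m f a b] sym by blast
  moreover have "image_mset (transpose a b \<circ> p) M = image_mset (transpose a b) (image_mset p M)"
    by (simp add: multiset.map_comp)
  ultimately show ?case using swap.IH swap.prems by metis
qed simp

lemma count_image_mset_inj:
  assumes "inj g" shows "count (image_mset g M) (g x) = count M x"
  using assms by (induction M) (auto simp: inj_eq)

text \<open>Both monomials are viewed as exponent functions on the union of their supports, padded
  with zeros. There the multisets of values agree, so a permutation of the variables carries one
  function to the other.\<close>

lemma mcoeff_cong_exponents:
  assumes sym: "\<And>i. i > m \<Longrightarrow> swap_vars i f = f"
    and M: "set_mset M \<subseteq> {m<..}" and N: "set_mset N \<subseteq> {m<..}" and eq: "exponents M = exponents N"
  shows "mcoeff f M = mcoeff f N"
proof -
  let ?A = "set_mset M \<union> set_mset N"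
  have ext: "image_mset (count K) (mset_set ?A) = exponents K + replicate_mset (card ?A - card (set_mset K)) 0"
    if "set_mset K \<subseteq> ?A" for K
  proof -
    have "mset_set ?A = mset_set (set_mset K) + mset_set (?A - set_mset K)"
      using that by (metis finite_Un finite_set_mset mset_set_Union finite_Diff Diff_disjoint Un_Diff_cancel sup.absorb2)
    moreover have "image_mset (count K) (mset_set (?A - set_mset K)) =
                   image_mset (\<lambda>_. 0) (mset_set (?A - set_mset K))"
      by (intro image_mset_cong) (auto simp: not_in_iff)
    ultimately show ?thesis using that
      by (simp add: exponents_def image_mset_const_eq card_Diff_subset)
  qed
  have "card (set_mset M) = card (set_mset N)" using eq by (metis size_exponents)
  hence "image_mset (count M) (mset_set ?A) = image_mset (count N) (mset_set ?A)"
    by (subst (1 2) ext) (auto simp: eq)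
  then obtain p where p: "p permutes ?A" "\<forall>x\<in>?A. count M x = count N (p x)"
    by (rule image_mset_eq_implies_permutes[rotated]) auto
  have "image_mset p M = N"
  proof (rule multiset_eqI)
    fix y
    obtain x where x: "y = p x" using p(1) by (metis permutes_surj surjD)
    have "count (image_mset p M) (p x) = count M x"
      using permutes_inj[OF p(1)] by (simp add: count_image_mset_inj inj_eq)
    also have "\<dots> = count N (p x)"
    proof (cases "x \<in> ?A")
      case False
      thus ?thesis using p(1) by (simp add: permutes_not_in not_in_iff)
    qed (use p in auto)
    finally show "count (image_mset p M) y = count N y" using x by simp
  qed
  thus ?thesis using mcoeff_permutes[OF sym p(1)] M N by force
qed

text \<open>An index \<open>k\<close> of least level has \<open>A k j = 0\<close> for all other
  \<open>j\<close>, so \<open>c k\<close> enters no equation but its own: the other equations are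
  solved without it and \<open>c k\<close> is adjusted last.\<close>

lemma triangular_solvable:
  fixes A :: "'i \<Rightarrow> 'i \<Rightarrow> 'a :: field" and l :: "'i \<Rightarrow> nat"
  assumes "finite I"
    and "\<And>i j. i \<in> I \<Longrightarrow> j \<in> I \<Longrightarrow> i \<noteq> j \<Longrightarrow> l i \<le> l j \<Longrightarrow> A i j = 0"
    and "\<And>i. i \<in> I \<Longrightarrow> A i i \<noteq> 0"
  shows "\<exists>c. \<forall>j\<in>I. (\<Sum>i\<in>I. c i * A i j) = b j"
  using assms
proof (induction "card I" arbitrary: I)
  case (Suc n)
  hence "I \<noteq> {}" by auto
  then obtain k where k: "k \<in> I" "\<And>i. i \<in> I \<Longrightarrow> l k \<le> l i"
    using \<open>finite I\<close> by (metis arg_min_if_finite(1) arg_min_if_finite(2) not_less)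
  have "\<exists>c. \<forall>j\<in>I - {k}. (\<Sum>i\<in>I - {k}. c i * A i j) = b j"
    using Suc.hyps(2) k(1) Suc.prems by (intro Suc.hyps(1)) auto
  then obtain c where c: "\<And>j. j \<in> I - {k} \<Longrightarrow> (\<Sum>i\<in>I - {k}. c i * A i j) = b j" by blast
  define c' where "c' = c(k := (b k - (\<Sum>i\<in>I - {k}. c i * A i k)) / A k k)"
  have "(\<Sum>i\<in>I. c' i * A i j) = c' k * A k j + (\<Sum>i\<in>I - {k}. c i * A i j)" for j
    using Suc.prems(1) k(1) by (simp add: sum.remove c'_def)
  hence "(\<Sum>i\<in>I. c' i * A i j) = b j" if "j \<in> I" for j
    using c[of j] that k Suc.prems(2)[of k j] Suc.prems(3)[of k]
    by (cases "j = k") (auto simp: c'_def)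
  thus ?case by blast
qed auto

lemma finite_partitions_le: "finite {\<mu> :: nat multiset. 0 \<notin># \<mu> \<and> sum_mset \<mu> \<le> n}"
proof (rule finite_subset)
  show "{\<mu>. 0 \<notin># \<mu> \<and> sum_mset \<mu> \<le> n} \<subseteq> (\<Union>k\<le>n. {\<mu>. set_mset \<mu> \<subseteq> {..n} \<and> size \<mu> = k})"
  proof safe
    fix \<mu> :: "nat multiset" assume \<mu>: "0 \<notin># \<mu>" "sum_mset \<mu> \<le> n"
    have "size \<mu> \<le> sum_mset \<mu>"
      using \<mu>(1) by (induction \<mu>) auto
    moreover have "k \<le> n" if "k \<in># \<mu>" for k
      using that \<mu>(2) 
      by (metis le_trans multi_member_split sum_mset.add_mset le_add1)
    ultimately show "\<mu> \<in> (\<Union>k\<le>n. {\<mu>. set_mset \<mu> \<subseteq> {..n} \<and> size \<mu> = k})" using \<mu>(2) by auto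
  qed
  show "finite (\<Union>k\<le>n. {\<mu> :: nat multiset. set_mset \<mu> \<subseteq> {..n} \<and> size \<mu> = k})"
    using finite_multisets_of_size[of "{..n}"] by (auto simp: multisets_of_size_def)
qed

text \<open>Bounded degree leaves finitely many partitions, and symmetry leaves one equation per
  partition, at a representative monomial. The system is triangular by the number of parts.\<close>

lemma psums_span:
  assumes sym: "\<And>i. i > m \<Longrightarrow> swap_vars i f = f"
    and supp: "\<And>M. mcoeff f M \<noteq> 0 \<Longrightarrow> size M \<le> n \<and> set_mset M \<subseteq> {m<..}"
  shows "\<exists>c. finite {\<mu>. c \<mu> \<noteq> 0} \<and> (\<forall>\<mu>. c \<mu> \<noteq> 0 \<longrightarrow> 0 \<notin># \<mu>) \<and>
             f = (\<Sum>\<mu> | c \<mu> \<noteq> 0. mconst (c \<mu>) * psums m \<mu>)"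
proof -
  define I where "I = {\<mu> :: nat multiset. 0 \<notin># \<mu> \<and> sum_mset \<mu> \<le> n}"
  have fin: "finite I" unfolding I_def by (rule finite_partitions_le)
  have pos: "0 \<notin># \<mu>" if "\<mu> \<in> I" for \<mu> using that by (simp add: I_def)
  have "\<exists>R. \<forall>\<mu>\<in>I. set_mset (R \<mu>) \<subseteq> {m<..} \<and> exponents (R \<mu>) = \<mu>"
    by (rule bchoice) (use ex_exponents pos in blast)
  then obtain R where R: "\<And>\<mu>. \<mu> \<in> I \<Longrightarrow> set_mset (R \<mu>) \<subseteq> {m<..}" "\<And>\<mu>. \<mu> \<in> I \<Longrightarrow> exponents (R \<mu>) = \<mu>"
    by blast
  have cardR: "card (set_mset (R \<mu>)) = size \<mu>" if "\<mu> \<in> I" for \<mu>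
    using R(2)[OF that] size_exponents[of "R \<mu>"] by simp
  have "\<exists>c. \<forall>\<nu>\<in>I. (\<Sum>\<mu>\<in>I. c \<mu> * mcoeff (psums m \<mu>) (R \<nu>)) = mcoeff f (R \<nu>)"
  proof (rule triangular_solvable[where l = size, OF fin])
    fix \<mu> \<nu> assume "\<mu> \<in> I" "\<nu> \<in> I" "\<mu> \<noteq> \<nu>" "size \<mu> \<le> size \<nu>"
    thus "mcoeff (psums m \<mu>) (R \<nu>) = 0"
      using mcoeff_psums_eq_0(1,2)[OF pos, of \<mu> "R \<nu>" m] cardR R(2) by (cases "size \<mu> = size \<nu>") auto
  next
    fix \<mu> assume "\<mu> \<in> I"
    thus "mcoeff (psums m \<mu>) (R \<mu>) \<noteq> 0" using mcoeff_psums_diag[of "R \<mu>" m] R by auto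
  qed
  then obtain c where c: "\<And>\<nu>. \<nu> \<in> I \<Longrightarrow> (\<Sum>\<mu>\<in>I. c \<mu> * mcoeff (psums m \<mu>) (R \<nu>)) = mcoeff f (R \<nu>)"
    by blast
  define c' where "c' = (\<lambda>\<mu>. if \<mu> \<in> I then c \<mu> else 0)"
  have f: "f = (\<Sum>\<mu>\<in>I. mconst (c \<mu>) * psums m \<mu>)"
  proof (rule mps_eqI)
    fix M
    show "mcoeff f M = mcoeff (\<Sum>\<mu>\<in>I. mconst (c \<mu>) * psums m \<mu>) M"
    proof (cases "size M \<le> n \<and> set_mset M \<subseteq> {m<..}")
      case True
      hence I: "exponents M \<in> I" by (simp add: I_def zero_notin_exponents sum_mset_exponents)
      let ?M = "R (exponents M)"
      have "mcoeff f M = mcoeff f ?M"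
        by (rule mcoeff_cong_exponents[of m]) (use sym R[OF I] True in auto)
      moreover have "mcoeff (psums m \<mu>) M = mcoeff (psums m \<mu>) ?M" for \<mu>
        by (rule mcoeff_cong_exponents[of m]) (use R[OF I] True in \<open>auto simp: swap_vars_psums\<close>)
      ultimately show ?thesis using c[OF I] by simp
    next
      case False
      hence "mcoeff (psums m \<mu>) M = 0" if "\<mu> \<in> I" for \<mu>
        using mcoeff_psums_eq_0(3,4)[OF pos[OF that], of M m] that by (auto simp: I_def)
      moreover have "mcoeff f M = 0" using False supp by blast
      ultimately show ?thesis by simp
    qed
  qed
  also have "\<dots> = (\<Sum>\<mu> | c' \<mu> \<noteq> 0. mconst (c' \<mu>) * psums m \<mu>)"
    using fin by (intro sum.mono_neutral_cong_right) (auto simp: c'_def)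
  finally have "f = (\<Sum>\<mu> | c' \<mu> \<noteq> 0. mconst (c' \<mu>) * psums m \<mu>)" .
  moreover have "finite {\<mu>. c' \<mu> \<noteq> 0}" by (rule finite_subset[OF _ fin]) (auto simp: c'_def)
  ultimately show ?thesis using pos by (intro exI[of _ c']) (auto simp: c'_def)
qed

section \<open>The Hall--Littlewood series\<close>

text \<open>The Hall--Littlewood function \<open>q_n\<close>. In its generating series, with
  \<open>v = 1/u\<close>, each variable \<open>x\<close> has the factor
  \<open>(1 - t x v) / (1 - x v) = 1 + (1 - t) (x v + x^2 v^2 + ...)\<close>.\<close>

definition hl_q :: "nat \<Rightarrow> nat \<Rightarrow> ff mps" where
  "hl_q m n = Abs_mps (\<lambda>M. if size M = n \<and> set_mset M \<subseteq> {m<..}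
                           then (1 - tvar) ^ card (set_mset M) else 0)"

text \<open>The share of one variable of exponent \<open>a + 1\<close> in the recurrence below.
  Removing \<open>k\<close> copies keeps its factor \<open>1 - t\<close> for
  \<open>k \<le> a\<close> and loses it for \<open>k = a + 1\<close>.\<close>

lemma geometric_weight:
  fixes t :: "'a :: comm_ring_1"
  shows "(1 - t) * (\<Sum>k=1..a. 1 - t ^ k) + (1 - t ^ Suc a) = (1 - t) * of_nat (Suc a)"
  by (induction a) (auto simp: algebra_simps)

text \<open>The Newton-type recurrence that also comes from the logarithmic derivative of
  \<open>Omega\<close>, checked on monomials: each variable contributes its own exponent, and the
  exponents add up to \<open>n\<close>.\<close>

lemma hl_q_recurrence:
  "of_nat n * hl_q m n = (\<Sum>k=1..n. mconst (1 - tvar ^ k) * (psum m k * hl_q m (n - k)))"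
proof (rule mps_eqI)
  fix M
  let ?I = "{i. i \<in># M \<and> m < i}"
  let ?q = "\<lambda>n N. mcoeff (hl_q m n) N"
  have fin: "finite ?I" by (rule finite_subset[of _ "set_mset M"]) auto
  have "mcoeff (\<Sum>k=1..n. mconst (1 - tvar ^ k) * (psum m k * hl_q m (n - k))) M =
    (\<Sum>k=1..n. \<Sum>i\<in>?I. if k \<le> count M i then (1 - tvar ^ k) * ?q (n - k) (M - replicate_mset k i) else 0)"
  proof (simp, rule sum.cong[OF refl])
    fix k assume k: "k \<in> {Suc 0..n}"
    have "mcoeff (psum m k * hl_q m (n - k)) M =
          (\<Sum>i | i \<in># M \<and> m < i \<and> k \<le> count M i. ?q (n - k) (M - replicate_mset k i))"
      using k by (intro mcoeff_psum_times) auto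
    also have "\<dots> = (\<Sum>i\<in>?I. if k \<le> count M i then ?q (n - k) (M - replicate_mset k i) else 0)"
      using fin by (intro sum.mono_neutral_cong_left) auto
    finally show "(1 - tvar ^ k) * mcoeff (psum m k * hl_q m (n - k)) M =
      (\<Sum>i\<in>?I. if k \<le> count M i then (1 - tvar ^ k) * ?q (n - k) (M - replicate_mset k i) else 0)"
      by (simp only: sum_distrib_left) (intro sum.cong, auto)
  qed
  also have "\<dots> = (\<Sum>i\<in>?I. \<Sum>k=1..n.
      if k \<le> count M i then (1 - tvar ^ k) * ?q (n - k) (M - replicate_mset k i) else 0)"
    by (rule sum.swap)
  also have "\<dots> = (\<Sum>i\<in>?I. of_nat (count M i) * ?q n M)"
  proof (rule sum.cong[OF refl])
    fix i assume i: "i \<in> ?I"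
    show "(\<Sum>k=1..n. if k \<le> count M i then (1 - tvar ^ k) * ?q (n - k) (M - replicate_mset k i) else 0)
          = of_nat (count M i) * ?q n M"
    proof (cases "size M = n \<and> set_mset M \<subseteq> {m<..}")
      case False
      have "?q (n - k) (M - replicate_mset k i) = 0" if "k \<le> count M i" "k \<le> n" for k
      proof (cases "size M = n")
        case True
        then obtain j where j: "j \<in># M" "\<not> m < j" using False by auto
        hence "j \<noteq> i" using i by auto
        hence "j \<in># M - replicate_mset k i" using j(1) by (simp add: in_diff_count)
        thus ?thesis using j(2) by (auto simp: hl_q_def)
      next
        case False
        have "count M i \<le> size M" by (rule count_le_size)
        hence "size (M - replicate_mset k i) \<noteq> n - k"
          using that False by (subst size_Diff_submset) (auto simp flip: count_le_replicate_mset_subset_eq)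
        thus ?thesis by (simp add: hl_q_def)
      qed
      hence "(\<Sum>k=1..n. if k \<le> count M i then (1 - tvar ^ k) * ?q (n - k) (M - replicate_mset k i) else 0) = 0"
        by (intro sum.neutral) auto
      moreover have "?q n M = 0" using False by (auto simp: hl_q_def)
      ultimately show ?thesis by simp
    next
      case True
      define a where "a = count M i"
      define c where "c = card (set_mset M)"
      have a: "a > 0" using i by (simp add: a_def)
      have an: "a \<le> n" using True count_le_size[of M i] by (simp add: a_def)
      have c: "c > 0" using i unfolding c_def by (auto simp: card_gt_0_iff)
      have q: "?q (n - k) (M - replicate_mset k i) = (1 - tvar) ^ (if k < a then c else c - 1)"
        if "k \<le> a" for k
      proof -
        have "size (M - replicate_mset k i) = n - k"
          using that True by (subst size_Diff_submset) (auto simp: a_def simp flip: count_le_replicate_mset_subset_eq)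
        moreover have "set_mset (M - replicate_mset k i) \<subseteq> {m<..}" using True by (auto dest: in_diffD)
        moreover have "set_mset (M - replicate_mset k i) = (if k < a then set_mset M else set_mset M - {i})"
          using that by (auto simp: a_def in_diff_count split: if_splits simp flip: count_greater_zero_iff)
        ultimately show ?thesis using i by (simp add: hl_q_def c_def)
      qed
      have "(\<Sum>k=1..n. if k \<le> a then (1 - tvar ^ k) * ?q (n - k) (M - replicate_mset k i) else 0) =
            (\<Sum>k=1..a. (1 - tvar ^ k) * (1 - tvar) ^ (if k < a then c else c - 1))"
        using an q by (intro sum.mono_neutral_cong_right) auto
      also have "{1..a} = insert a {1..a - 1}" using a by auto
      also have "(\<Sum>k\<in>insert a {1..a - 1}. (1 - tvar ^ k) * (1 - tvar) ^ (if k < a then c else c - 1)) =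
                 (1 - tvar ^ a) * (1 - tvar) ^ (c - 1) + (\<Sum>k=1..a - 1. (1 - tvar ^ k) * (1 - tvar) ^ c)"
        using a by (subst sum.insert) (auto intro!: sum.cong)
      also have "\<dots> = (1 - tvar) ^ (c - 1) * ((1 - tvar) * (\<Sum>k=1..a - 1. 1 - tvar ^ k) + (1 - tvar ^ Suc (a - 1)))"
        using a power_Suc[of "1 - tvar" "c - 1"] c
        by (simp only: sum_distrib_right[symmetric] Suc_pred' [symmetric]) (simp add: mult_ac distrib_left)
      also have "\<dots> = (1 - tvar) ^ c * of_nat a"
        using a c by (subst geometric_weight) (simp add: power_eq_if[of _ c])
      finally show ?thesis using True by (simp add: hl_q_def a_def c_def)
    qed
  qed
  also have "\<dots> = of_nat n * ?q n M"
  proof (cases "size M = n \<and> set_mset M \<subseteq> {m<..}")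
    case True
    hence "?I = set_mset M" by auto
    thus ?thesis using True
      by (simp add: sum_distrib_right[symmetric] size_multiset_overloaded_eq flip: of_nat_sum)
  qed (auto simp: hl_q_def)
  finally show "mcoeff (of_nat n * hl_q m n) M =
    mcoeff (\<Sum>k=1..n. mconst (1 - tvar ^ k) * (psum m k * hl_q m (n - k))) M"
    by (simp flip: mconst_of_nat)
qed

text \<open>\<open>Omega\<close> is the exponential of a series \<open>?G\<close>, hence its
  derivative is \<open>Omega m * fps_deriv ?G\<close>. Comparing coefficients gives the recurrence
  of \<open>hl_q\<close>, which determines them because \<open>n\<close> can be cancelled.\<close>

lemma fps_nth_Omega: "fps_nth (Omega m) n = hl_q m n"
proof -
  let ?E = "Abs_fps (\<lambda>j. mconst (inverse (fact j))) :: ff mps fps"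
  let ?G = "Abs_fps (\<lambda>k. if k = 0 then 0 else mconst ((1 - tvar ^ k) / of_nat k) * psum m k)"
  have fact_eq: "of_nat (Suc j) * mconst (inverse (fact (Suc j))) = (mconst (inverse (fact j)) :: ff mps)" for j
    by (simp add: mconst_of_nat[symmetric] mconst_mult[symmetric] field_simps del: of_nat_Suc)
  have E: "fps_deriv ?E = ?E"
    by (rule fps_ext) (use fact_eq in \<open>simp add: fps_deriv_def del: of_nat_Suc\<close>)
  have G: "fps_nth (fps_deriv ?G) k = mconst (1 - tvar ^ Suc k) * psum m (Suc k)" for k
  proof -
    have "fps_nth (fps_deriv ?G) k =
          of_nat (Suc k) * (mconst ((1 - tvar ^ Suc k) / of_nat (Suc k)) * psum m (Suc k))"
      by (simp only: fps_deriv_nth fps_nth_Abs_fps) simp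
    also have "\<dots> = mconst (of_nat (Suc k) * ((1 - tvar ^ Suc k) / of_nat (Suc k))) * psum m (Suc k)"
      by (simp only: mconst_mult mconst_of_nat mult.assoc)
    also have "of_nat (Suc k) * ((1 - tvar ^ Suc k) / of_nat (Suc k)) = 1 - tvar ^ Suc k"
      by (simp del: of_nat_Suc)
    finally show ?thesis .
  qed
  have deriv: "fps_deriv (Omega m) = Omega m * fps_deriv ?G"
    unfolding Omega_def by (subst fps_compose_deriv) (simp_all add: E)
  have rec: "of_nat (Suc n) * fps_nth (Omega m) (Suc n) =
             (\<Sum>k=1..Suc n. mconst (1 - tvar ^ k) * (psum m k * fps_nth (Omega m) (Suc n - k)))" for n
  proof -
    have "of_nat (Suc n) * fps_nth (Omega m) (Suc n) = fps_nth (Omega m * fps_deriv ?G) n"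
      by (simp add: deriv[symmetric])
    also have "\<dots> = (\<Sum>i=0..n. fps_nth (Omega m) i * (mconst (1 - tvar ^ Suc (n - i)) * psum m (Suc (n - i))))"
      unfolding fps_mult_nth G ..
    also have "\<dots> = (\<Sum>k=1..Suc n. mconst (1 - tvar ^ k) * (psum m k * fps_nth (Omega m) (Suc n - k)))"
      by (rule sum.reindex_bij_witness[where i = "\<lambda>k. Suc n - k" and j = "\<lambda>i. Suc n - i"])
         (auto simp: Suc_diff_le mult_ac)
    finally show ?thesis .
  qed
  show ?thesis
  proof (induction n rule: less_induct)
    case (less n)
    show ?case
    proof (cases n)
      case 0
      have "hl_q m 0 = 1" by (rule mps_eqI) (auto simp: hl_q_def mcoeff_1)
      thus ?thesis using 0 by (simp add: Omega_def)
    next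
      case (Suc n')
      have "of_nat n * fps_nth (Omega m) n = of_nat n * hl_q m n"
        unfolding Suc rec hl_q_recurrence using less Suc by (intro sum.cong) auto
      hence "mconst (of_nat n) * fps_nth (Omega m) n = mconst (of_nat n) * hl_q m n"
        by (simp add: mconst_of_nat)
      moreover have "mconst (of_nat n :: ff) \<noteq> 0"
      proof
        assume "mconst (of_nat n :: ff) = 0"
        hence "mcoeff (mconst (of_nat n :: ff)) {#} = 0" by simp
        thus False using Suc by (simp add: mcoeff_mconst del: of_nat_Suc)
      qed
      ultimately show ?thesis by simp
    qed
  qed
qed

section \<open>A formula for the lowering operator\<close>

text \<open>Substitutes \<open>u\<close>, whose Laurent series is \<^const>\<open>fls_X_inv\<close>, into a polynomial.\<close>

definition fls_of_poly :: "'a :: comm_ring_1 poly \<Rightarrow> 'a fls" where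
  "fls_of_poly p = poly (map_poly fls_const p) fls_X_inv"

lemma fls_of_poly_pCons: "fls_of_poly (pCons a p) = fls_const a + fls_X_inv * fls_of_poly p"
  by (simp add: fls_of_poly_def map_poly_pCons)

lemma fls_of_poly_0 [simp]: "fls_of_poly 0 = 0"
  by (simp add: fls_of_poly_def)

lemma fls_of_poly_add: "fls_of_poly (p + q) = fls_of_poly p + fls_of_poly q"
  by (induction p q rule: poly_induct2) (auto simp: fls_of_poly_pCons algebra_simps simp flip: fls_plus_const)

lemma fls_of_poly_smult: "fls_of_poly (smult a p) = fls_const a * fls_of_poly p"
  by (induction p) (auto simp: fls_of_poly_pCons algebra_simps simp flip: fls_const_mult_const)

lemma fls_of_poly_mult: "fls_of_poly (p * q) = fls_of_poly p * fls_of_poly q"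
  by (induction p) (auto simp: fls_of_poly_pCons fls_of_poly_add fls_of_poly_smult algebra_simps)

lemma fls_of_poly_1 [simp]: "fls_of_poly 1 = 1"
  by (simp add: one_pCons fls_of_poly_pCons)

lemma fls_of_poly_monom: "fls_of_poly (monom 1 n) = fls_X_inv ^ n"
  by (induction n) (auto simp: monom_Suc fls_of_poly_pCons monom_0)

lemma fls_of_poly_sum: "fls_of_poly (sum f A) = (\<Sum>a\<in>A. fls_of_poly (f a))"
  by (induction A rule: infinite_finite_induct) (auto simp: fls_of_poly_add)

lemma fls_of_poly_prod_mset:
  "fls_of_poly (prod_mset (image_mset f A)) = prod_mset (image_mset (\<lambda>a. fls_of_poly (f a)) A)"
  by (induction A) (auto simp: fls_of_poly_mult)

lemma fls_of_poly_times_fps_nth_0: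
  "fls_nth (fls_of_poly p * fps_to_fls Q) 0 = (\<Sum>i\<le>degree p. coeff p i * fps_nth Q i)"
proof -
  have deg: "degree (map_poly fls_const p) = degree p" by (simp add: degree_map_poly)
  have "fls_of_poly p * fps_to_fls Q = (\<Sum>i\<le>degree p. fls_const (coeff p i) * (fls_X_inv ^ i * fps_to_fls Q))"
    unfolding fls_of_poly_def poly_altdef deg sum_distrib_right by (simp add: coeff_map_poly mult.assoc)
  moreover have "fls_nth (sum F A) 0 = (\<Sum>a\<in>A. fls_nth (F a) 0)" for F :: "nat \<Rightarrow> 'a fls" and A
    by (induction A rule: infinite_finite_induct) auto
  ultimately show ?thesis by (simp add: fls_X_inv_power_times_conv_shift)
qed

text \<open>The coefficient of \<open>u\<^sup>0\<close> in \<open>p(u) \<Omega>[(1-t)u\<^sup>-\<^sup>1Z]\<close>, with \<open>Z = x\<^bsub>m+1\<^esub> + x\<^bsub>m+2\<^esub> + \<dots>\<close>.\<close>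

definition omega_coeff :: "nat \<Rightarrow> ff mps poly \<Rightarrow> ff mps" where
  "omega_coeff m p = fls_nth (fls_of_poly p * fps_to_fls (Omega m)) 0"

lemma omega_coeff_eq: "omega_coeff m p = (\<Sum>i\<le>degree p. coeff p i * hl_q m i)"
  by (simp add: omega_coeff_def fls_of_poly_times_fps_nth_0 fps_nth_Omega)

lemma omega_coeff_smult: "omega_coeff m (smult a p) = a * omega_coeff m p"
  by (simp add: omega_coeff_def fls_of_poly_smult mult.assoc)

lemma omega_coeff_sum: "omega_coeff m (sum f A) = (\<Sum>a\<in>A. omega_coeff m (f a))"
  by (induction A rule: infinite_finite_induct)
     (auto simp: omega_coeff_def fls_of_poly_add algebra_simps)

text \<open>The swaps start at \<open>i = s\<close>, not after it: the coefficients involve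
  \<open>x_s\<close> only symmetrically with the later variables, so they act as scalars on Hecke
  pairs at every \<open>a \<ge> s\<close>.\<close>

definition sym_coeffs :: "nat \<Rightarrow> ff mps poly \<Rightarrow> bool" where
  "sym_coeffs s p \<longleftrightarrow> (\<forall>n. \<forall>i\<ge>s. swap_vars i (coeff p n) = coeff p n)"

lemma sym_coeffs_mult: "sym_coeffs s p \<Longrightarrow> sym_coeffs s q \<Longrightarrow> sym_coeffs s (p * q)"
  by (auto simp: sym_coeffs_def coeff_mult)

lemma sym_coeffs_sum: "(\<And>a. a \<in> A \<Longrightarrow> sym_coeffs s (f a)) \<Longrightarrow> sym_coeffs s (sum f A)"
  by (simp add: sym_coeffs_def coeff_sum)

lemma sym_coeffs_smult:
  "(\<And>i. i \<ge> s \<Longrightarrow> swap_vars i a = a) \<Longrightarrow> sym_coeffs s p \<Longrightarrow> sym_coeffs s (smult a p)"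
  by (simp add: sym_coeffs_def)

lemma sym_coeffs_monom: "(\<And>i. i \<ge> s \<Longrightarrow> swap_vars i a = a) \<Longrightarrow> sym_coeffs s (monom a n)"
  by (simp add: sym_coeffs_def)

text \<open>The polynomial \<open>p(u)\<close> below is \<open>g[Z - u]\<close>; substituting \<open>u = x\<^sub>s\<close> gives back \<open>g\<close>.\<close>

lemma Bop_eq_omega_coeff:
  assumes s: "s \<ge> 1" and sym: "\<And>i. i > s \<Longrightarrow> swap_vars i g = g"
    and supp: "\<And>M. mcoeff g M \<noteq> 0 \<Longrightarrow> size M \<le> N \<and> set_mset M \<subseteq> {s<..}"
  shows "\<exists>p. poly p (var s) = g \<and> sym_coeffs s p \<and>
             (\<forall>n. Bop (s - 1) n (plethysm s mconst g (psum (s - 1))) = omega_coeff (s - 1) (monom 1 n * p))"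
proof -
  obtain c where fin: "finite {\<mu>. c \<mu> \<noteq> 0}" and pos: "\<And>\<mu>. c \<mu> \<noteq> 0 \<Longrightarrow> 0 \<notin># \<mu>"
    and g: "g = (\<Sum>\<mu> | c \<mu> \<noteq> 0. mconst (c \<mu>) * psums s \<mu>)"
    using psums_span[of s g N] sym supp by blast
  have c: "psum_expansion s g = c" by (rule psum_expansion_eqI[OF fin pos g])
  define g' where "g' = (\<Sum>\<mu> | c \<mu> \<noteq> 0. mconst (c \<mu>) * psums (s - 1) \<mu>)"
  have g': "plethysm s mconst g (psum (s - 1)) = g'"
    by (simp add: plethysm_def c g'_def psums_def)
  have c': "psum_expansion (s - 1) g' = c" by (rule psum_expansion_eqI[OF fin pos g'_def])
  \<comment> \<open>This is \<open>p_k[Z - u] = p_k[Z] - u^k\<close> as a polynomial in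
    \<open>u\<close>.\<close>
  define b where "b = (\<lambda>k. [:psum (s - 1) k:] - monom 1 k :: ff mps poly)"
  define p where "p = (\<Sum>\<mu> | c \<mu> \<noteq> 0. smult (mconst (c \<mu>)) (prod_mset (image_mset b \<mu>)))"
  \<comment> \<open>Putting \<open>u = x_s\<close> removes the first variable of
    \<open>Z\<close>.\<close>
  have b: "poly (b k) (var s) = psum s k" if "k > 0" for k
    using psum_split_first[OF that s] by (simp add: b_def poly_monom)
  have "poly (prod_mset (image_mset b \<mu>)) (var s) = psums s \<mu>" if "c \<mu> \<noteq> 0" for \<mu>
    unfolding poly_prod_mset psums_def using b pos[OF that]
    by (intro arg_cong[of _ _ prod_mset] image_mset_cong) (metis not_gr_zero)
  hence 1: "poly p (var s) = g"
    unfolding p_def poly_sum g by (intro sum.cong) auto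
  have symb: "sym_coeffs s (b k)" for k
  proof -
    have "swap_vars i (psum (s - 1) k) = psum (s - 1) k" if "i \<ge> s" for i
      using that s by (intro swap_vars_psum) auto
    thus ?thesis unfolding b_def by (auto simp: sym_coeffs_def coeff_pCons split: nat.splits)
  qed
  have "sym_coeffs s (prod_mset (image_mset b \<mu>))" for \<mu>
  proof (induction \<mu>)
    case empty
    show ?case by (auto simp: sym_coeffs_def coeff_1)
  qed (auto intro: sym_coeffs_mult symb)
  hence 2: "sym_coeffs s p"
    unfolding p_def by (intro sym_coeffs_sum sym_coeffs_smult) auto
  have fb: "fls_of_poly (b k) = fls_const (psum (s - 1) k) - fls_X_inv ^ k" for k
  proof -
    have "fls_of_poly (b k) + fls_of_poly (monom 1 k) = fls_of_poly [:psum (s - 1) k:]"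
      unfolding fls_of_poly_add[symmetric] b_def by simp
    thus ?thesis by (simp add: fls_of_poly_monom fls_of_poly_pCons eq_diff_eq)
  qed
  have "fls_of_poly p = plethysm (s - 1) (\<lambda>a. fls_const (mconst a)) g' (\<lambda>k. fls_const (psum (s - 1) k) - fls_X_inv ^ k)"
    unfolding plethysm_def c' by (simp add: p_def fls_of_poly_sum fls_of_poly_smult fls_of_poly_prod_mset fb)
  hence "Bop (s - 1) n g' = omega_coeff (s - 1) (monom 1 n * p)" for n
    by (simp add: Bop_def omega_coeff_def fls_of_poly_mult fls_of_poly_monom)
  thus ?thesis using 1 2 g' by auto
qed

lemma finite_tail_coeff_support:
  assumes "\<And>M. mcoeff f M \<noteq> 0 \<Longrightarrow> size M \<le> N"
  shows "finite {\<eta>. set_mset \<eta> \<subseteq> {1..s} \<and> tail_coeff s \<eta> f \<noteq> 0}"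
proof (rule finite_subset)
  show "{\<eta>. set_mset \<eta> \<subseteq> {1..s} \<and> tail_coeff s \<eta> f \<noteq> 0} \<subseteq> (\<Union>k\<le>N. multisets_of_size {1..s} k)"
  proof safe
    fix \<eta> assume \<eta>: "set_mset \<eta> \<subseteq> {1..s}" "tail_coeff s \<eta> f \<noteq> 0"
    then obtain M where "mcoeff (tail_coeff s \<eta> f) M \<noteq> 0" by (metis mcoeff_0 mps_eqI)
    hence "mcoeff f (\<eta> + M) \<noteq> 0" by (auto simp: tail_coeff_def split: if_splits)
    hence "size \<eta> \<le> N" using assms by fastforce
    thus "\<eta> \<in> (\<Union>k\<le>N. multisets_of_size {1..s} k)" using \<eta> by (auto simp: multisets_of_size_def)
  qed
qed (auto intro: finite_multisets_of_size)

lemma tail_coeff_decomposition: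
  assumes supp: "\<And>M. mcoeff f M \<noteq> 0 \<Longrightarrow> size M \<le> N \<and> 0 \<notin># M"
  shows "f = (\<Sum>\<eta> | set_mset \<eta> \<subseteq> {1..s} \<and> tail_coeff s \<eta> f \<noteq> 0. monomial \<eta> * tail_coeff s \<eta> f)"
    (is "f = sum _ ?H")
proof (rule mps_eqI)
  fix M
  have fin: "finite ?H" by (rule finite_tail_coeff_support) (use supp in blast)
  \<comment> \<open>The part of \<open>M\<close> in the first \<open>s\<close> variables is the only
    \<open>\<eta>\<close> whose summand has a term at \<open>M\<close>.\<close>
  define \<eta>0 where "\<eta>0 = filter_mset (\<lambda>i. i \<le> s) M"
  have rest: "M - \<eta>0 = filter_mset (\<lambda>i. \<not> i \<le> s) M"
    unfolding \<eta>0_def by (metis add_diff_cancel_left' multiset_partition)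
  have summand: "mcoeff (monomial \<eta> * tail_coeff s \<eta> f) M = (if \<eta> = \<eta>0 then mcoeff f M else 0)"
    if "\<eta> \<in> ?H" for \<eta>
  proof (cases "\<eta> \<subseteq># M \<and> set_mset (M - \<eta>) \<subseteq> {s<..}")
    case True
    hence M: "\<eta> + (M - \<eta>) = M" by simp
    have "filter_mset (\<lambda>i. i \<le> s) (\<eta> + (M - \<eta>)) = filter_mset (\<lambda>i. i \<le> s) \<eta> + filter_mset (\<lambda>i. i \<le> s) (M - \<eta>)"
      by simp
    also have "filter_mset (\<lambda>i. i \<le> s) \<eta> = \<eta>" using that by (auto simp: filter_mset_eq_conv)
    also have "filter_mset (\<lambda>i. i \<le> s) (M - \<eta>) = {#}" unfolding filter_mset_eq_mempty_iff using True by auto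
    finally have "\<eta> = \<eta>0" unfolding M \<eta>0_def by simp
    thus ?thesis using True M by (simp add: mcoeff_monomial_times tail_coeff_def)
  next
    case False
    have "\<eta>0 \<subseteq># M" "set_mset (M - \<eta>0) \<subseteq> {s<..}" unfolding rest by (auto simp: \<eta>0_def)
    hence "\<eta> \<noteq> \<eta>0" using False by auto
    thus ?thesis using False by (auto simp: mcoeff_monomial_times tail_coeff_def)
  qed
  have "mcoeff (\<Sum>\<eta>\<in>?H. monomial \<eta> * tail_coeff s \<eta> f) M = (\<Sum>\<eta>\<in>?H. if \<eta> = \<eta>0 then mcoeff f M else 0)"
    unfolding mcoeff_sum by (rule sum.cong[OF refl summand])
  also have "\<dots> = (if \<eta>0 \<in> ?H then mcoeff f M else 0)" using fin by (rule sum.delta)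
  also have "\<dots> = mcoeff f M"
  proof (cases "mcoeff f M = 0")
    case False
    hence "0 \<notin># M" using supp by blast
    hence "set_mset \<eta>0 \<subseteq> {1..s}" by (auto simp: \<eta>0_def Suc_le_eq) (metis not_gr_zero)
    moreover have "mcoeff (tail_coeff s \<eta>0 f) (M - \<eta>0) = mcoeff f M"
      unfolding rest by (auto simp: tail_coeff_def \<eta>0_def simp flip: multiset_partition)
    hence "tail_coeff s \<eta>0 f \<noteq> 0" using False by auto
    ultimately show ?thesis by auto
  qed auto
  finally show "mcoeff f M = mcoeff (\<Sum>\<eta>\<in>?H. monomial \<eta> * tail_coeff s \<eta> f) M" ..
qed

text \<open>The variable \<open>x_s\<close>, present in \<open>\<eta>\<close> and in the argument of
  the plethysm, is replaced by \<open>u\<close> throughout: \<open>d_minus\<close> lifts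
  \<open>f\<close> to a polynomial in \<open>u\<close> and takes a constant term. If
  \<open>x_s\<close> divides \<open>f\<close>, each \<open>\<eta>\<close> contains \<open>s\<close>,
  and so \<open>u\<close> divides \<open>P\<close>.\<close>

lemma d_minus_eq_omega_coeff:
  assumes f: "f \<in> P_space s" and s: "s \<ge> 1"
  obtains P where "poly P (var s) = f" "sym_coeffs s P"
    "(\<And>M. mcoeff f M \<noteq> 0 \<Longrightarrow> s \<in># M) \<Longrightarrow> coeff P 0 = 0"
    "d_minus s f = omega_coeff (s - 1) P"
proof -
  from f obtain N where supp: "\<And>M. mcoeff f M \<noteq> 0 \<Longrightarrow> size M \<le> N \<and> 0 \<notin># M"
    and sym: "\<And>i M. i > s \<Longrightarrow> mcoeff f (image_mset (swap i) M) = mcoeff f M"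
    unfolding P_space_def by blast
  let ?H = "{\<eta>. set_mset \<eta> \<subseteq> {1..s} \<and> tail_coeff s \<eta> f \<noteq> 0}"
  have "\<exists>p. poly p (var s) = tail_coeff s \<eta> f \<and> sym_coeffs s p \<and>
          (\<forall>n. Bop (s - 1) n (plethysm s mconst (tail_coeff s \<eta> f) (psum (s - 1))) = omega_coeff (s - 1) (monom 1 n * p))"
    if \<eta>: "\<eta> \<in> ?H" for \<eta>
  proof (rule Bop_eq_omega_coeff[OF s])
    fix i assume i: "i > s"
    have e: "image_mset (swap i) \<eta> = \<eta>"
      using \<eta> i by (intro multiset.map_ident_strong) (auto simp: transpose_def)
    have "x \<in> {s<..} \<longleftrightarrow> swap i x \<in> {s<..}" for x using i by (auto simp: transpose_def)
    hence "set_mset (image_mset (swap i) M) \<subseteq> {s<..} \<longleftrightarrow> set_mset M \<subseteq> {s<..}" for M by auto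
    moreover have "mcoeff f (\<eta> + image_mset (swap i) M) = mcoeff f (\<eta> + M)" for M
      using sym[OF i, of "\<eta> + M"] e by simp
    ultimately show "swap_vars i (tail_coeff s \<eta> f) = tail_coeff s \<eta> f"
      by (intro mps_eqI) (simp only: mcoeff_swap tail_coeff_def mcoeff_Abs)
  next
    fix M assume "mcoeff (tail_coeff s \<eta> f) M \<noteq> 0"
    thus "size M \<le> N \<and> set_mset M \<subseteq> {s<..}"
      using supp[of "\<eta> + M"] by (auto simp: tail_coeff_def split: if_splits)
  qed
  hence "\<exists>p. \<forall>\<eta>\<in>?H. poly (p \<eta>) (var s) = tail_coeff s \<eta> f \<and> sym_coeffs s (p \<eta>) \<and>
          (\<forall>n. Bop (s - 1) n (plethysm s mconst (tail_coeff s \<eta> f) (psum (s - 1))) = omega_coeff (s - 1) (monom 1 n * p \<eta>))"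
    by (intro bchoice) blast
  then obtain p where p: "\<And>\<eta>. \<eta> \<in> ?H \<Longrightarrow> poly (p \<eta>) (var s) = tail_coeff s \<eta> f"
    "\<And>\<eta>. \<eta> \<in> ?H \<Longrightarrow> sym_coeffs s (p \<eta>)"
    "\<And>\<eta> n. \<eta> \<in> ?H \<Longrightarrow> Bop (s - 1) n (plethysm s mconst (tail_coeff s \<eta> f) (psum (s - 1))) = omega_coeff (s - 1) (monom 1 n * p \<eta>)"
    by blast
  define \<eta>' where "\<eta>' = (\<lambda>\<eta>. filter_mset (\<lambda>i. i \<noteq> s) \<eta>)"
  \<comment> \<open>The powers of \<open>x_s\<close> that \<open>\<eta>'\<close> drops become powers
    of \<open>u\<close>.\<close>
  define P where "P = (\<Sum>\<eta>\<in>?H. smult (monomial (\<eta>' \<eta>)) (monom 1 (count \<eta> s) * p \<eta>))"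
  show thesis
  proof
    have "\<eta>' \<eta> + replicate_mset (count \<eta> s) s = \<eta>" for \<eta>
      unfolding \<eta>'_def by (rule multiset_eqI) (auto simp: not_in_iff)
    hence "monomial (\<eta>' \<eta>) * var s ^ count \<eta> s = (monomial \<eta> :: ff mps)" for \<eta>
      by (metis monomial_add var_power)
    hence "poly P (var s) = (\<Sum>\<eta>\<in>?H. monomial \<eta> * tail_coeff s \<eta> f)"
      unfolding P_def poly_sum using p(1)
      by (intro sum.cong) (auto simp: poly_monom simp flip: mult.assoc)
    thus "poly P (var s) = f" using tail_coeff_decomposition[of f N s] supp by simp
  next
    have "swap_vars i (monomial (\<eta>' \<eta>)) = monomial (\<eta>' \<eta>)" if "\<eta> \<in> ?H" "i \<ge> s" for i \<eta>
    proof -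
      have "image_mset (swap i) (\<eta>' \<eta>) = \<eta>' \<eta>"
        using that by (intro multiset.map_ident_strong) (auto simp: \<eta>'_def transpose_def)
      thus ?thesis by (simp add: swap_vars_monomial)
    qed
    thus "sym_coeffs s P"
      unfolding P_def using p(2)
      by (intro sym_coeffs_sum sym_coeffs_smult sym_coeffs_mult sym_coeffs_monom) auto
  next
    assume *: "mcoeff f M \<noteq> 0 \<Longrightarrow> s \<in># M" for M
    have "count \<eta> s > 0" if "\<eta> \<in> ?H" for \<eta>
    proof -
      from that obtain M where M: "mcoeff (tail_coeff s \<eta> f) M \<noteq> 0" by (metis (mono_tags) mcoeff_0 mem_Collect_eq mps_eqI)
      hence "mcoeff f (\<eta> + M) \<noteq> 0" "s \<notin># M" by (auto simp: tail_coeff_def split: if_splits)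
      thus ?thesis using *[of "\<eta> + M"] by auto
    qed
    thus "coeff P 0 = 0"
      unfolding P_def coeff_sum by (intro sum.neutral) (auto simp: coeff_monom_mult)
  next
    show "d_minus s f = omega_coeff (s - 1) P"
      unfolding P_def omega_coeff_sum d_minus_def using p(3)
      by (intro sum.cong) (auto simp: omega_coeff_smult \<eta>'_def)
  qed
qed

section \<open>Pairs of series exchanged by a Hecke generator\<close>

text \<open>A division-free condition that implies
  \<open>T_op k (var (Suc k) * f) = var k * g\<close>. Being two invariance conditions, it passes to
  sums with coefficients symmetric in the two variables, and it can be tested on
  truncations.\<close>

definition hecke_pair :: "nat \<Rightarrow> ff mps \<Rightarrow> ff mps \<Rightarrow> bool" where
  "hecke_pair k f g \<longleftrightarrow> swap_vars k (f + g) = f + g \<and>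
     swap_vars k (mconst tvar * var (Suc k) * f + var k * g) = mconst tvar * var (Suc k) * f + var k * g"

lemma var_diff_nonzero: "var k - var (Suc k) \<noteq> (0 :: 'a :: comm_ring_1 mps)"
  by simp

text \<open>For the difference \<open>h\<close> of two partners and its swap \<open>h'\<close>, the
  conditions give \<open>h' = h\<close> and \<open>x_{k+1} h' = x_k h\<close>, so
  \<open>(x_k - x_{k+1}) h = 0\<close> in a domain.\<close>

lemma hecke_pair_unique:
  assumes "hecke_pair k f g" "hecke_pair k f g'"
  shows "g = g'"
proof -
  have "swap_vars k f + swap_vars k g = f + g" "swap_vars k f + swap_vars k g' = f + g'"
    using assms by (simp_all add: hecke_pair_def)
  hence 1: "swap_vars k g - swap_vars k g' = g - g'" by algebra
  have "mconst tvar * var k * swap_vars k f + var (Suc k) * swap_vars k g = mconst tvar * var (Suc k) * f + var k * g"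
       "mconst tvar * var k * swap_vars k f + var (Suc k) * swap_vars k g' = mconst tvar * var (Suc k) * f + var k * g'"
    using assms by (simp_all add: hecke_pair_def)
  hence 2: "var (Suc k) * (swap_vars k g - swap_vars k g') = var k * (g - g')" by algebra
  have "(var k - var (Suc k)) * (g - g') = 0" using 2 unfolding 1 by (simp add: algebra_simps)
  thus "g = g'" using var_diff_nonzero[of k] by (simp only: mult_eq_0_iff right_minus_eq) blast
qed

lemma hecke_pair_lincomb:
  assumes "\<And>i. i \<in> I \<Longrightarrow> hecke_pair k (f i) (g i)" "\<And>i. i \<in> I \<Longrightarrow> swap_vars k (c i) = c i"
  shows "hecke_pair k (\<Sum>i\<in>I. c i * f i) (\<Sum>i\<in>I. c i * g i)"
proof -
  have 1: "(\<Sum>i\<in>I. c i * f i) + (\<Sum>i\<in>I. c i * g i) = (\<Sum>i\<in>I. c i * (f i + g i))"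
    by (simp add: sum.distrib distrib_left)
  have 2: "mconst tvar * var (Suc k) * (\<Sum>i\<in>I. c i * f i) + var k * (\<Sum>i\<in>I. c i * g i) =
           (\<Sum>i\<in>I. c i * (mconst tvar * var (Suc k) * f i + var k * g i))"
    by (simp add: sum.distrib distrib_left sum_distrib_left mult_ac)
  show ?thesis unfolding hecke_pair_def 1 2
    using assms unfolding hecke_pair_def swap_vars_sum swap_vars_mult
    by (intro conjI sum.cong refl) (simp_all del: swap_vars_add swap_vars_mult)
qed

lemma divided_diff_eqI:
  assumes "(var i - var (Suc i)) * g = f - swap_vars i f"
  shows "divided_diff i f = g"
  unfolding divided_diff_def
proof (rule the_equality[of _ g])
  fix g' assume "(var i - var (Suc i)) * g' = f - swap_vars i f"
  hence "(var i - var (Suc i)) * (g' - g) = 0"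
    using assms by (simp only: right_diff_distrib diff_self)
  thus "g' = g" using var_diff_nonzero[of i] by (simp only: mult_eq_0_iff right_minus_eq) blast
qed (fact assms)

text \<open>Eliminating the swap of \<open>g\<close> from the two conditions gives
  \<open>(x - y) (g - f') = (1 - t) (y f - x f')\<close>. So the divided difference of
  \<open>y f\<close> is \<open>(g - f') / (1 - t)\<close>, and the factor \<open>1 - t\<close> in
  \<open>T_op\<close> cancels.\<close>

lemma T_op_hecke_pair:
  assumes "hecke_pair k f g"
  shows "T_op k (var (Suc k) * f) = var k * g"
proof -
  define c where "c = (mconst tvar :: ff mps)"
  define x y where "x = (var k :: ff mps)" and "y = (var (Suc k) :: ff mps)"
  define f' g' where "f' = swap_vars k f" and "g' = swap_vars k g"
  define E where "E = mconst (1 / (1 - tvar)) * (g - f')"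
  have 1: "f' + g' = f + g" and 2: "c * x * f' + y * g' = c * y * f + x * g"
    using assms by (simp_all add: hecke_pair_def c_def x_def y_def f'_def g'_def)
  have key: "(x - y) * (g - f') = (1 - c) * (y * f - x * f')"
    using 1 2 by algebra
  have unit: "mconst (1 / (1 - tvar)) * (1 - c) = 1"
    unfolding c_def mconst_1[symmetric] mconst_diff[symmetric] mconst_mult[symmetric] by simp
  have "(x - y) * E = mconst (1 / (1 - tvar)) * ((x - y) * (g - f'))"
    unfolding E_def by (simp only: mult_ac)
  also have "\<dots> = y * f - x * f'"
    unfolding key mult.assoc[symmetric] unit by simp
  finally have "divided_diff k (y * f) = E"
    by (intro divided_diff_eqI) (simp add: x_def y_def f'_def)
  hence "T_op k (y * f) = x * f' + mconst (1 - tvar) * x * E"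
    by (simp add: T_op_def x_def y_def f'_def)
  also have "mconst (1 - tvar) * x * E = x * (g - f') * (mconst (1 / (1 - tvar)) * (1 - c))"
    unfolding E_def c_def mconst_diff mconst_1 by (simp only: mult_ac)
  finally show ?thesis unfolding unit by (simp add: x_def y_def algebra_simps)
qed

text \<open>The part of \<^const>\<open>hl_q\<close> with largest variable \<open>x\<^sub>a\<close>, divided by \<open>1 - t\<close>.\<close>

definition hl_top :: "nat \<Rightarrow> nat \<Rightarrow> nat \<Rightarrow> ff mps" where
  "hl_top m a n = Abs_mps (\<lambda>M. if size M = n \<and> set_mset M \<subseteq> {m<..a} \<and> a \<in># M
                               then (1 - tvar) ^ (card (set_mset M) - 1) else 0)"

text \<open>For \<open>n > 0\<close> every monomial of \<open>hl_q m n\<close> has a largest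
  variable; for the monomial \<open>M\<close> it is at most \<open>x_N\<close>.\<close>

lemma mcoeff_hl_q_eq_sum_hl_top:
  assumes "n > 0" "set_mset M \<subseteq> {..N}"
  shows "mcoeff (hl_q m n) M = (1 - tvar) * (\<Sum>a\<in>{m<..N}. mcoeff (hl_top m a n) M)"
proof (cases "size M = n \<and> set_mset M \<subseteq> {m<..}")
  case True
  hence "M \<noteq> {#}" using assms by auto
  define b where "b = Max (set_mset M)"
  have b: "b \<in># M" using \<open>M \<noteq> {#}\<close> by (simp add: b_def)
  have bmax: "x \<le> b" if "x \<in># M" for x using that by (simp add: b_def)
  have "mcoeff (hl_top m a n) M = (if a = b then (1 - tvar) ^ (card (set_mset M) - 1) else 0)" for a
  proof (cases "a = b")
    case True
    moreover have "set_mset M \<subseteq> {m<..b}" using bmax \<open>size M = n \<and> set_mset M \<subseteq> {m<..}\<close> by auto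
    ultimately show ?thesis using b \<open>size M = n \<and> set_mset M \<subseteq> {m<..}\<close> by (simp add: hl_top_def)
  next
    case False
    have "\<not> (set_mset M \<subseteq> {m<..a} \<and> a \<in># M)"
    proof
      assume *: "set_mset M \<subseteq> {m<..a} \<and> a \<in># M"
      hence "b \<le> a" using b by auto
      moreover have "a \<le> b" using * bmax by blast
      ultimately show False using False by simp
    qed
    thus ?thesis using False by (simp add: hl_top_def)
  qed
  moreover have "b \<in> {m<..N}" using b True assms by auto
  moreover have "card (set_mset M) > 0" using \<open>M \<noteq> {#}\<close> by (simp add: card_gt_0_iff)
  ultimately show ?thesis using True \<open>M \<noteq> {#}\<close> by (simp add: sum.delta hl_q_def power_eq_if)
next
  case False
  hence "mcoeff (hl_top m a n) M = 0" for a by (auto simp: hl_top_def)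
  thus ?thesis using False by (auto simp: hl_q_def)
qed

text \<open>Thanks to the division by \<open>1 - t\<close> the family starts with a plain power.
  Combining its first members with the coefficients of a polynomial without constant term thus
  evaluates the polynomial at that variable.\<close>

lemma hl_top_Suc: "n > 0 \<Longrightarrow> hl_top m (Suc m) n = var (Suc m) ^ n"
proof (rule mps_eqI)
  fix M
  assume n: "n > 0"
  have "{m<..Suc m} = {Suc m}" by auto
  moreover have "size M = n \<and> set_mset M \<subseteq> {Suc m} \<and> Suc m \<in># M \<longleftrightarrow> M = replicate_mset n (Suc m)"
    using n by (auto simp: set_mset_subset_singletonD)
  ultimately show "mcoeff (hl_top m (Suc m) n) M = mcoeff (var (Suc m) ^ n) M"
    using n unfolding var_power by (auto simp: hl_top_def mcoeff_monomial)
qed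

lemma card_swap_mset [simp]: "card (set_mset (image_mset (swap i) M)) = card (set_mset M)"
  by (simp add: card_image)

lemma swap_mset_subset_iff:
  assumes "swap i ` A = A"
  shows "set_mset (image_mset (swap i) M) \<subseteq> A \<longleftrightarrow> set_mset M \<subseteq> A"
proof -
  have "swap i ` set_mset M \<subseteq> swap i ` A \<longleftrightarrow> set_mset M \<subseteq> A" by (rule inj_image_subset_iff) simp
  thus ?thesis using assms by simp
qed

lemma swap_image_atMost: "a > m \<Longrightarrow> swap a ` {m<..Suc a} = {m<..Suc a}"
proof -
  assume "a > m"
  hence "swap a ` {m<..Suc a} \<subseteq> {m<..Suc a}" by (auto simp: transpose_def)
  moreover from this have "swap a ` swap a ` {m<..Suc a} \<subseteq> swap a ` {m<..Suc a}" by blast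
  ultimately show ?thesis by (simp add: image_image)
qed

lemma count_swap_mset: "count (image_mset (swap i) M) j = count M (swap i j)"
  using count_image_mset_inj[of "swap i" M "swap i j"] by simp

text \<open>The sum of the two series runs over monomials containing \<open>x_a\<close> or
  \<open>x_{a+1}\<close>, weighted by their number of variables, which is symmetric. For the second
  combination the symmetry is read off the case table \<open>?w\<close>.\<close>

lemma hecke_pair_hl_top:
  assumes "a > m"
  shows "hecke_pair a (hl_top m a n) (hl_top m (Suc a) n)"
  unfolding hecke_pair_def
proof
  have set: "set_mset (image_mset (swap a) M) \<subseteq> {m<..Suc a} \<longleftrightarrow> set_mset M \<subseteq> {m<..Suc a}" for M
    by (rule swap_mset_subset_iff[OF swap_image_atMost[OF assms]])
  have mem: "a \<in># image_mset (swap a) M \<longleftrightarrow> Suc a \<in># M" "Suc a \<in># image_mset (swap a) M \<longleftrightarrow> a \<in># M" for M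
    unfolding count_greater_zero_iff[symmetric] count_swap_mset by simp_all
  have 1: "mcoeff (hl_top m a n + hl_top m (Suc a) n) M =
    (if size M = n \<and> set_mset M \<subseteq> {m<..Suc a} \<and> (a \<in># M \<or> Suc a \<in># M)
     then (1 - tvar) ^ (card (set_mset M) - 1) else 0)" for M
  proof (cases "Suc a \<in># M")
    case True
    hence "\<not> set_mset M \<subseteq> {m<..a}" by auto
    thus ?thesis using True by (simp add: hl_top_def)
  next
    case False
    hence "set_mset M \<subseteq> {m<..Suc a} \<longleftrightarrow> set_mset M \<subseteq> {m<..a}"
      by (auto simp: le_Suc_eq subset_iff)
    thus ?thesis using False by (simp add: hl_top_def)
  qed
  show "swap_vars a (hl_top m a n + hl_top m (Suc a) n) = hl_top m a n + hl_top m (Suc a) n"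
    by (rule mps_eqI, unfold mcoeff_swap 1 set mem card_swap_mset size_image_mset) auto
  \<comment> \<open>Here \<open>p\<close>, \<open>q\<close> are the exponents of \<open>x_a\<close>,
    \<open>x_{a+1}\<close>, and one factor \<open>1 - t\<close> for each other variable is split
    off. The first summand gives \<open>t\<close> if \<open>q = 1\<close> and nothing otherwise, the
    second \<open>1\<close> if \<open>p = 1\<close> and \<open>1 - t\<close> otherwise.\<close>
  let ?w = "\<lambda>p q :: nat. if p = 1 \<and> q = 1 then 1 + tvar else if p = 1 \<or> q = 1 then 1 else 1 - tvar"
  have 2: "mcoeff (mconst tvar * var (Suc a) * hl_top m a n + var a * hl_top m (Suc a) n) M =
    (if size M = Suc n \<and> set_mset M \<subseteq> {m<..Suc a} \<and> a \<in># M \<and> Suc a \<in># M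
     then (1 - tvar) ^ (card (set_mset M) - 2) * ?w (count M a) (count M (Suc a)) else 0)" for M
  proof (cases "size M = Suc n \<and> set_mset M \<subseteq> {m<..Suc a} \<and> a \<in># M \<and> Suc a \<in># M")
    case False
    have "mcoeff (var (Suc a) * hl_top m a n) M = 0"
    proof (rule ccontr)
      assume "mcoeff (var (Suc a) * hl_top m a n) M \<noteq> 0"
      hence *: "Suc a \<in># M" "size (M - {#Suc a#}) = n" "set_mset (M - {#Suc a#}) \<subseteq> {m<..a}" "a \<in># M - {#Suc a#}"
        by (auto simp: mcoeff_monomial_times hl_top_def split: if_splits)
      then obtain K where K: "M = add_mset (Suc a) K" by (meson multi_member_split)
      show False using * False assms unfolding K by auto
    qed
    moreover have "mcoeff (var a * hl_top m (Suc a) n) M = 0"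
    proof (rule ccontr)
      assume "mcoeff (var a * hl_top m (Suc a) n) M \<noteq> 0"
      hence *: "a \<in># M" "size (M - {#a#}) = n" "set_mset (M - {#a#}) \<subseteq> {m<..Suc a}" "Suc a \<in># M - {#a#}"
        by (auto simp: mcoeff_monomial_times hl_top_def split: if_splits)
      then obtain K where K: "M = add_mset a K" by (meson multi_member_split)
      show False using * False assms unfolding K by auto
    qed
    ultimately show ?thesis using False by (auto simp: mult.assoc)
  next
    case True
    define l where "l = card (set_mset M) - 2"
    have "card {a, Suc a} \<le> card (set_mset M)" using True by (intro card_mono) auto
    hence l: "card (set_mset M) = l + 2" by (simp add: l_def)
    have "mcoeff (var (Suc a) * hl_top m a n) M = (if count M (Suc a) = 1 then (1 - tvar) ^ l else 0)"
    proof -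
      have "size (M - {#Suc a#}) = n" "a \<in># M - {#Suc a#}"
        using True by (auto simp: size_Diff_singleton in_diff_count)
      moreover have "set_mset (M - {#Suc a#}) \<subseteq> {m<..a} \<longleftrightarrow> count M (Suc a) = 1"
      proof
        assume "set_mset (M - {#Suc a#}) \<subseteq> {m<..a}"
        hence "Suc a \<notin># M - {#Suc a#}" by auto
        thus "count M (Suc a) = 1" using True by (simp add: not_in_iff flip: count_greater_zero_iff)
      next
        assume "count M (Suc a) = 1"
        hence "Suc a \<notin># M - {#Suc a#}" by (simp add: not_in_iff)
        moreover have "set_mset (M - {#Suc a#}) \<subseteq> {m<..Suc a}" using True by (auto dest: in_diffD)
        ultimately show "set_mset (M - {#Suc a#}) \<subseteq> {m<..a}" by (auto simp: le_Suc_eq subset_iff)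
      qed
      moreover have "set_mset (M - {#Suc a#}) = set_mset M - {Suc a}" if "count M (Suc a) = 1"
        using that by (auto simp: in_diff_count split: if_splits simp flip: count_greater_zero_iff)
      ultimately show ?thesis using True l by (simp add: mcoeff_monomial_times hl_top_def)
    qed
    moreover have "mcoeff (var a * hl_top m (Suc a) n) M = (1 - tvar) ^ (if count M a = 1 then l else l + 1)"
    proof -
      have "size (M - {#a#}) = n" "Suc a \<in># M - {#a#}" "set_mset (M - {#a#}) \<subseteq> {m<..Suc a}"
        using True by (auto simp: size_Diff_singleton in_diff_count dest: in_diffD)
      moreover have "set_mset (M - {#a#}) = (if count M a = 1 then set_mset M - {a} else set_mset M)"
        using True by (auto simp: in_diff_count split: if_splits simp flip: count_greater_zero_iff)
      ultimately show ?thesis using True l by (simp add: mcoeff_monomial_times hl_top_def)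
    qed
    moreover have "count M a > 0" "count M (Suc a) > 0" using True by auto
    ultimately show ?thesis using True by (simp add: mult.assoc l algebra_simps)
  qed
  show "swap_vars a (mconst tvar * var (Suc a) * hl_top m a n + var a * hl_top m (Suc a) n) =
        mconst tvar * var (Suc a) * hl_top m a n + var a * hl_top m (Suc a) n"
    by (rule mps_eqI, unfold mcoeff_swap 2 set mem card_swap_mset size_image_mset count_swap_mset) auto
qed

text \<open>Both families are determined by their first member through \<open>hecke_pair_unique\<close>, so the
  expansion of \<open>f s\<close> in powers of \<open>x\<^sub>s\<close> propagates to all \<open>f a\<close>.\<close>

lemma mcoeff_d_minus:
  assumes s: "s \<ge> 1" and P: "f s \<in> P_space s"
    and supp: "\<And>M. mcoeff (f s) M \<noteq> 0 \<Longrightarrow> s \<in># M"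
    and pair: "\<And>a. a \<ge> s \<Longrightarrow> hecke_pair a (f a) (f (Suc a))"
    and M: "set_mset M \<subseteq> {..N}"
  shows "mcoeff (d_minus s (f s)) M = (1 - tvar) * (\<Sum>a=s..N. mcoeff (f a) M)"
proof -
  obtain p where p: "poly p (var s) = f s" "sym_coeffs s p" "coeff p 0 = 0"
    "d_minus s (f s) = omega_coeff (s - 1) p"
    using d_minus_eq_omega_coeff[OF P s] supp by metis
  let ?h = "\<lambda>a. \<Sum>n\<le>degree p. coeff p n * hl_top (s - 1) a n"
  have f: "f a = ?h a" if "a \<ge> s" for a
    using that
  proof (induction rule: dec_induct)
    case base
    have "coeff p n * hl_top (s - 1) s n = coeff p n * var s ^ n" for n
      using hl_top_Suc[of n "s - 1"] s p(3) by (cases "n = 0") auto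
    hence "?h s = poly p (var s)" unfolding poly_altdef by (intro sum.cong refl)
    thus ?case using p(1) by simp
  next
    case (step a)
    have "hecke_pair a (?h a) (?h (Suc a))"
      using step p(2) s by (intro hecke_pair_lincomb hecke_pair_hl_top) (auto simp: sym_coeffs_def)
    thus ?case using hecke_pair_unique pair step by metis
  qed
  have "mcoeff (coeff p n * hl_q (s - 1) n) M =
        (1 - tvar) * (\<Sum>a=s..N. mcoeff (coeff p n * hl_top (s - 1) a n) M)" for n
  \<comment> \<open>\<open>hl_q (s - 1) 0\<close> is \<open>1\<close>, which has no largest
    variable, but \<open>p\<close> has no constant term.\<close>
  proof (cases "n = 0")
    case False
    have "{s - 1<..N} = {s..N}" using s by auto
    moreover have "set_mset (M - A) \<subseteq> {..N}" for A using M by (auto dest: in_diffD)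
    ultimately have "mcoeff (coeff p n * hl_q (s - 1) n) M = (\<Sum>A | A \<subseteq># M. \<Sum>a=s..N.
      (1 - tvar) * (mcoeff (coeff p n) A * mcoeff (hl_top (s - 1) a n) (M - A)))"
      unfolding mcoeff_times
      using False mcoeff_hl_q_eq_sum_hl_top[of n "M - A" N "s - 1" for A]
      by (intro sum.cong refl) (simp add: sum_distrib_left mult_ac)
    also have "\<dots> = (1 - tvar) * (\<Sum>a=s..N. mcoeff (coeff p n * hl_top (s - 1) a n) M)"
      by (subst sum.swap) (simp add: mcoeff_times sum_distrib_left)
    finally show ?thesis .
  qed (simp add: p(3))
  hence "mcoeff (d_minus s (f s)) M =
         (1 - tvar) * (\<Sum>n\<le>degree p. \<Sum>a=s..N. mcoeff (coeff p n * hl_top (s - 1) a n) M)"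
    by (simp add: p(4) omega_coeff_eq sum_distrib_left)
  also have "\<dots> = (1 - tvar) * (\<Sum>a=s..N. mcoeff (f a) M)"
    by (subst sum.swap) (simp add: f)
  finally show ?thesis .
qed

section \<open>Proper colourings of interval graphs\<close>

text \<open>The first argument is the colour of the smaller end of the edge.\<close>

definition edge_weight :: "nat \<Rightarrow> nat \<Rightarrow> ff" where
  "edge_weight a b = (if a = b then 0 else if a < b then inverse tvar else 1)"

definition edges_weight :: "(nat \<times> nat) set \<Rightarrow> (nat \<Rightarrow> nat) \<Rightarrow> ff" where
  "edges_weight A \<kappa> = (\<Prod>e\<in>A. edge_weight (\<kappa> (fst e)) (\<kappa> (snd e)))"

definition colouring_weight :: "nat set \<Rightarrow> (nat \<times> nat) set \<Rightarrow> (nat \<Rightarrow> nat) \<Rightarrow> ff mps" where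
  "colouring_weight V A \<kappa> = (\<Prod>v\<in>V. var (\<kappa> v)) * mconst (edges_weight (A \<inter> V \<times> V) \<kappa>)"

text \<open>Meant for finite lists \<open>L v\<close>; \<open>colour_series\<close> treats infinite
  lists, where this sum would be taken over an infinite set.\<close>

definition colouring_sum :: "nat set \<Rightarrow> (nat \<Rightarrow> nat set) \<Rightarrow> (nat \<times> nat) set \<Rightarrow> ff mps" where
  "colouring_sum V L A = (\<Sum>\<kappa>\<in>PiE V L. colouring_weight V A \<kappa>)"

lemma edges_weight_cong:
  "(\<And>e. e \<in> A \<Longrightarrow> \<kappa> (fst e) = \<kappa>' (fst e) \<and> \<kappa> (snd e) = \<kappa>' (snd e)) \<Longrightarrow> edges_weight A \<kappa> = edges_weight A \<kappa>'"
  by (simp add: edges_weight_def cong: prod.cong)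

lemma colouring_weight_cong:
  "(\<And>v. v \<in> V \<Longrightarrow> \<kappa> v = \<kappa>' v) \<Longrightarrow> colouring_weight V A \<kappa> = colouring_weight V A \<kappa>'"
  by (auto simp: colouring_weight_def cong: prod.cong intro!: arg_cong[of _ _ mconst] edges_weight_cong)

lemma edges_weight_Un:
  "finite A \<Longrightarrow> finite B \<Longrightarrow> A \<inter> B = {} \<Longrightarrow> edges_weight (A \<union> B) \<kappa> = edges_weight A \<kappa> * edges_weight B \<kappa>"
  unfolding edges_weight_def by (rule prod.union_disjoint)

text \<open>On \<open>U\<close> the colour \<open>k\<close> stands for both \<open>k\<close> and \<open>k + 1\<close>, which compare in the same way with any
  other colour.\<close>

definition cross_weight :: "nat \<Rightarrow> nat set \<Rightarrow> nat set \<Rightarrow> (nat \<times> nat) set \<Rightarrow> (nat \<Rightarrow> nat) \<Rightarrow> ff" where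
  "cross_weight k U W A \<rho> = edges_weight (A \<inter> (U \<times> W \<union> W \<times> U)) (\<lambda>v. if v \<in> U then k else \<rho> v)"

lemma edge_weight_neighbours:
  assumes "a \<in> {k, Suc k}" "b \<notin> {k, Suc k}"
  shows "edge_weight a b = edge_weight k b" "edge_weight b a = edge_weight b k"
  using assms by (auto simp: edge_weight_def)

lemma colouring_weight_split:
  assumes "finite V" "U \<subseteq> V" "\<And>v. v \<in> U \<Longrightarrow> \<kappa> v \<in> {k, Suc k}" "\<And>v. v \<in> V - U \<Longrightarrow> \<kappa> v \<notin> {k, Suc k}"
  shows "colouring_weight V A \<kappa> =
         colouring_weight (V - U) A \<kappa> * mconst (cross_weight k U (V - U) A \<kappa>) * colouring_weight U A \<kappa>"
proof -
  let ?W = "V - U"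
  have fin: "finite U" "finite ?W" using assms by (auto intro: finite_subset)
  have "A \<inter> V \<times> V = (A \<inter> ?W \<times> ?W \<union> A \<inter> (U \<times> ?W \<union> ?W \<times> U)) \<union> A \<inter> U \<times> U" using assms by auto
  also have "edges_weight \<dots> \<kappa> = edges_weight (A \<inter> ?W \<times> ?W) \<kappa> *
      edges_weight (A \<inter> (U \<times> ?W \<union> ?W \<times> U)) \<kappa> * edges_weight (A \<inter> U \<times> U) \<kappa>"
    using fin by (subst edges_weight_Un; (subst edges_weight_Un)?) auto
  also have "edges_weight (A \<inter> (U \<times> ?W \<union> ?W \<times> U)) \<kappa> = cross_weight k U ?W A \<kappa>"
    unfolding cross_weight_def edges_weight_def
    using assms(3,4) edge_weight_neighbours by (intro prod.cong) auto
  moreover have "(\<Prod>v\<in>V. var (\<kappa> v)) = (\<Prod>v\<in>?W. var (\<kappa> v)) * (\<Prod>v\<in>U. var (\<kappa> v) :: ff mps)"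
    using assms by (subst prod.subset_diff[of U V]) auto
  ultimately show ?thesis by (simp add: colouring_weight_def mconst_mult mult_ac)
qed

text \<open>\<open>U\<close> collects the positions coloured \<open>k\<close> or
  \<open>k + 1\<close>, and \<open>\<rho>\<close> colours the rest. The factor in front does not
  depend on how \<open>U\<close> is coloured and contains neither variable, so the swap acts on the
  two-coloured sum over \<open>U\<close> alone.\<close>

lemma colouring_sum_decomposition:
  assumes V: "finite V" and L: "\<And>v. v \<in> V \<Longrightarrow> finite (L v)"
  shows "colouring_sum V L A =
    (\<Sum>(U, \<rho>)\<in>(SIGMA U:Pow V. PiE (V - U) (\<lambda>v. L v - {k, Suc k})).
       (colouring_weight (V - U) A \<rho> * mconst (cross_weight k U (V - U) A \<rho>)) *
       colouring_sum U (\<lambda>v. L v \<inter> {k, Suc k}) A)"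
proof -
  let ?S = "SIGMA U:Pow V. PiE (V - U) (\<lambda>v. L v - {k, Suc k})"
  let ?K = "\<lambda>v. L v \<inter> {k, Suc k}"
  have finU: "finite (PiE U ?K)" if "U \<subseteq> V" for U
    using that V L by (intro finite_PiE) (auto intro: finite_subset)
  have finS: "finite ?S"
    using V L by (intro finite_SigmaI finite_PiE) auto
  have "(\<Sum>(U, \<rho>)\<in>?S. (colouring_weight (V - U) A \<rho> * mconst (cross_weight k U (V - U) A \<rho>)) *
           colouring_sum U ?K A) =
        (\<Sum>(U, \<rho>)\<in>?S. \<Sum>\<kappa>\<in>PiE U ?K.
           colouring_weight (V - U) A \<rho> * mconst (cross_weight k U (V - U) A \<rho>) * colouring_weight U A \<kappa>)"
    by (simp add: colouring_sum_def sum_distrib_left)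
  also have "\<dots> = (\<Sum>((U, \<rho>), \<kappa>)\<in>(SIGMA x:?S. PiE (fst x) ?K).
           colouring_weight (V - U) A \<rho> * mconst (cross_weight k U (V - U) A \<rho>) * colouring_weight U A \<kappa>)"
    by (subst sum.Sigma[symmetric]) (use finS finU in \<open>auto simp: case_prod_unfold\<close>)
  also have "\<dots> = (\<Sum>\<kappa>\<in>PiE V L. colouring_weight V A \<kappa>)"
  proof -
    \<comment> \<open>Glues the two partial colourings; \<open>w\<close> below cuts a colouring
      apart again.\<close>
    define m where "m = (\<lambda>x :: (nat set \<times> (nat \<Rightarrow> nat)) \<times> (nat \<Rightarrow> nat).
      \<lambda>v. if v \<in> fst (fst x) then snd x v else snd (fst x) v)"
    define S where "S = (\<lambda>\<kappa>. {v\<in>V. \<kappa> v \<in> {k, Suc k}})"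
    define w where "w = (\<lambda>\<kappa>. ((S \<kappa>, restrict \<kappa> (V - S \<kappa>)), restrict \<kappa> (S \<kappa>)))"
    show ?thesis
    proof (rule sum.reindex_bij_witness[where j = m and i = w])
      fix x assume x: "x \<in> (SIGMA x:?S. PiE (fst x) ?K)"
      obtain U \<rho> \<kappa> where xe: "x = ((U, \<rho>), \<kappa>)" by (metis prod.exhaust)
      have U: "U \<subseteq> V" and \<rho>: "\<rho> \<in> PiE (V - U) (\<lambda>v. L v - {k, Suc k})" and \<kappa>: "\<kappa> \<in> PiE U ?K"
        using x xe by auto
      have mx: "m x = (\<lambda>v. if v \<in> U then \<kappa> v else \<rho> v)" by (auto simp: m_def xe)
      have inU: "\<kappa> v \<in> {k, Suc k}" if "v \<in> U" for v using \<kappa> that by auto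
      have notU: "\<rho> v \<notin> {k, Suc k}" if "v \<in> V" "v \<notin> U" for v using \<rho> that by auto
      have "S (m x) = U"
        using inU notU U unfolding S_def mx by (auto split: if_splits)
      moreover have "restrict (m x) (V - U) = \<rho>"
        using \<rho> unfolding mx by (auto simp: fun_eq_iff restrict_def PiE_def extensional_def)
      moreover have "restrict (m x) U = \<kappa>"
        using \<kappa> unfolding mx by (auto simp: fun_eq_iff restrict_def PiE_def extensional_def)
      ultimately show "w (m x) = x" by (simp add: w_def xe)
      show "m x \<in> PiE V L"
        unfolding mx using \<rho> \<kappa> U by (auto simp: PiE_iff extensional_def)
      have "colouring_weight V A (m x) =
        colouring_weight (V - U) A (m x) * mconst (cross_weight k U (V - U) A (m x)) * colouring_weight U A (m x)"
        unfolding mx using inU notU U V by (intro colouring_weight_split) auto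
      also have "colouring_weight (V - U) A (m x) = colouring_weight (V - U) A \<rho>"
        unfolding mx by (rule colouring_weight_cong) auto
      also have "colouring_weight U A (m x) = colouring_weight U A \<kappa>"
        unfolding mx by (rule colouring_weight_cong) auto
      also have "cross_weight k U (V - U) A (m x) = cross_weight k U (V - U) A \<rho>"
        unfolding cross_weight_def mx by (rule edges_weight_cong) auto
      finally show "colouring_weight V A (m x) =
        (\<lambda>((U, \<rho>), \<kappa>).
           colouring_weight (V - U) A \<rho> * mconst (cross_weight k U (V - U) A \<rho>) * colouring_weight U A \<kappa>) x"
        unfolding xe prod.case .
    next
      fix \<kappa> assume \<kappa>: "\<kappa> \<in> PiE V L"
      show "m (w \<kappa>) = \<kappa>"
        using \<kappa> by (auto simp: m_def w_def S_def fun_eq_iff PiE_iff extensional_def)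
      show "w \<kappa> \<in> (SIGMA x:?S. PiE (fst x) ?K)"
        using \<kappa> by (auto simp: w_def S_def PiE_iff)
    qed
  qed
  finally show ?thesis by (simp add: colouring_sum_def)
qed

section \<open>Interval graphs with two colours, grown from the right\<close>

lemma colouring_weight_insert:
  assumes "finite U" "u \<notin> U" "\<And>i j. (i, j) \<in> A \<Longrightarrow> i < j" "\<And>v. v \<in> U \<Longrightarrow> u < v"
  shows "colouring_weight (insert u U) A \<kappa> =
         var (\<kappa> u) * mconst (\<Prod>v | v \<in> U \<and> (u, v) \<in> A. edge_weight (\<kappa> u) (\<kappa> v)) * colouring_weight U A \<kappa>"
proof -
  have "A \<inter> insert u U \<times> insert u U = Pair u ` {v \<in> U. (u, v) \<in> A} \<union> A \<inter> U \<times> U"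
    using assms(3,4) by fastforce
  also have "edges_weight \<dots> \<kappa> = edges_weight (Pair u ` {v \<in> U. (u, v) \<in> A}) \<kappa> * edges_weight (A \<inter> U \<times> U) \<kappa>"
    using assms by (intro edges_weight_Un) auto
  also have "edges_weight (Pair u ` {v \<in> U. (u, v) \<in> A}) \<kappa> = (\<Prod>v | v \<in> U \<and> (u, v) \<in> A. edge_weight (\<kappa> u) (\<kappa> v))"
    unfolding edges_weight_def by (subst prod.reindex) (auto simp: inj_on_def)
  finally show ?thesis using assms by (simp add: colouring_weight_def mconst_mult mult_ac)
qed

lemma sum_PiE_insert:
  assumes "u \<notin> U"
  shows "(\<Sum>\<kappa>\<in>PiE (insert u U) L. F \<kappa>) = (\<Sum>c\<in>L u. \<Sum>\<kappa>\<in>PiE U L. F (\<kappa>(u := c)))"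
proof -
  have "(\<Sum>\<kappa>\<in>PiE (insert u U) L. F \<kappa>) = (\<Sum>(c, \<kappa>)\<in>L u \<times> PiE U L. F (\<kappa>(u := c)))"
    unfolding PiE_insert_eq using inj_combinator[OF assms, of L]
    by (subst sum.reindex) (auto simp: case_prod_unfold comp_def)
  also have "\<dots> = (\<Sum>c\<in>L u. \<Sum>\<kappa>\<in>PiE U L. F (\<kappa>(u := c)))"
    by (simp add: sum.cartesian_product)
  finally show ?thesis .
qed

lemma colouring_sum_insert:
  assumes "finite U" "u \<notin> U" "\<And>i j. (i, j) \<in> A \<Longrightarrow> i < j" "\<And>v. v \<in> U \<Longrightarrow> u < v"
  shows "colouring_sum (insert u U) L A =
    (\<Sum>c\<in>L u. var c * (\<Sum>\<kappa>\<in>PiE U L. mconst (\<Prod>v | v \<in> U \<and> (u, v) \<in> A. edge_weight c (\<kappa> v)) * colouring_weight U A \<kappa>))"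
proof -
  have "colouring_weight (insert u U) A (\<kappa>(u := c)) =
      var c * (mconst (\<Prod>v | v \<in> U \<and> (u, v) \<in> A. edge_weight c (\<kappa> v)) * colouring_weight U A \<kappa>)" for \<kappa> c
  proof -
    have "colouring_weight U A (\<kappa>(u := c)) = colouring_weight U A \<kappa>"
      using assms(2) by (intro colouring_weight_cong) auto
    moreover have "(\<Prod>v | v \<in> U \<and> (u, v) \<in> A. edge_weight c ((\<kappa>(u := c)) v)) = (\<Prod>v | v \<in> U \<and> (u, v) \<in> A. edge_weight c (\<kappa> v))"
      using assms(2) by (intro prod.cong) auto
    ultimately show ?thesis
      using colouring_weight_insert[of U u A "\<kappa>(u := c)"] assms by (simp add: mult.assoc)
  qed
  thus ?thesis unfolding colouring_sum_def sum_PiE_insert[OF assms(2)] by (simp add: sum_distrib_left)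
qed

text \<open>Typical of areas below a lattice path: under the box \<open>(i, l)\<close> lies
  \<open>(i, j)\<close>, and to its right \<open>(j, l)\<close>. Restricting to \<open>U\<close>
  makes the property hereditary.\<close>

definition interval_on :: "nat set \<Rightarrow> (nat \<times> nat) set \<Rightarrow> bool" where
  "interval_on U A \<longleftrightarrow> (\<forall>i\<in>U. \<forall>j\<in>U. \<forall>l\<in>U. (i, l) \<in> A \<and> i < j \<and> j < l \<longrightarrow> (i, j) \<in> A \<and> (j, l) \<in> A)"

lemma interval_on_subset: "interval_on V A \<Longrightarrow> U \<subseteq> V \<Longrightarrow> interval_on U A"
  unfolding interval_on_def by blast

lemma colouring_sum_cong:
  "(\<And>v. v \<in> V \<Longrightarrow> L v = L' v) \<Longrightarrow> colouring_sum V L A = colouring_sum V L' A"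
  unfolding colouring_sum_def by (metis PiE_cong)

lemma edges_weight_eq_0:
  "finite A \<Longrightarrow> (i, j) \<in> A \<Longrightarrow> \<kappa> i = \<kappa> j \<Longrightarrow> edges_weight A \<kappa> = 0"
  unfolding edges_weight_def by (rule prod_zero) (auto simp: edge_weight_def intro!: bexI[of _ "(i, j)"])

text \<open>In an interval graph the least vertex of a properly two-coloured subset is adjacent to at most
  its successor, so the two-coloured sums are built up from the right by three simple moves, each of
  which preserves \<^const>\<open>hecke_pair\<close>.\<close>

lemma hecke_pair_two_colours:
  assumes "finite U" "p \<notin> U" "\<And>v. v \<in> U \<Longrightarrow> p < v" "interval_on (insert p U) A"
    and A: "\<And>i j. (i, j) \<in> A \<Longrightarrow> i < j"
  shows "hecke_pair k (colouring_sum (insert p U) ((\<lambda>_. {k, Suc k})(p := {k})) A)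
                      (colouring_sum (insert p U) ((\<lambda>_. {k, Suc k})(p := {Suc k})) A)"
  using assms(1-4)
proof (induction "card U" arbitrary: U p)
  case (0 U p)
  hence "U = {}" by simp
  thus ?case
    using A by (subst (1 2) colouring_sum_insert)
      (auto simp: colouring_weight_def edges_weight_def hecke_pair_def algebra_simps)
next
  case (Suc n U p)
  define q where "q = Min U"
  define U' where "U' = U - {q}"
  have "U \<noteq> {}" using Suc by auto
  hence q: "q \<in> U" using Suc.prems(1) by (simp add: q_def)
  have U: "U = insert q U'" "q \<notin> U'" "finite U'" using q Suc.prems(1) by (auto simp: U'_def)
  have lt: "q < v" if "v \<in> U'" for v
    using that Suc.prems(1) unfolding U'_def q_def by (metis Diff_iff Min_le insertI1 order_le_neq_trans)
  have pq: "p < q" using Suc.prems(3) q by blast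
  have IH: "hecke_pair k (colouring_sum U ((\<lambda>_. {k, Suc k})(q := {k})) A)
                         (colouring_sum U ((\<lambda>_. {k, Suc k})(q := {Suc k})) A)"
    unfolding U(1)
  proof (rule Suc.hyps(1))
    show "n = card U'" using Suc.hyps(2) U by simp
    show "interval_on (insert q U') A" using Suc.prems(4) interval_on_subset U by blast
  qed (use U lt in auto)
  define X where "X = (\<lambda>c. colouring_sum U ((\<lambda>_. {k, Suc k})(q := {c})) A)"
  let ?N = "{v. v \<in> U \<and> (p, v) \<in> A}"
  define Y where "Y = (\<lambda>c. \<Sum>\<kappa>\<in>PiE U (\<lambda>_. {k, Suc k}). mconst (\<Prod>v\<in>?N. edge_weight c (\<kappa> v)) * colouring_weight U A \<kappa>)"
  have goal: "colouring_sum (insert p U) ((\<lambda>_. {k, Suc k})(p := {c})) A = var c * Y c" for c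
  proof -
    have "PiE U ((\<lambda>_. {k, Suc k})(p := {c})) = PiE U (\<lambda>_. {k, Suc k})"
      using Suc.prems(2) by (intro PiE_cong) auto
    thus ?thesis using Suc.prems A by (subst colouring_sum_insert) (auto simp: Y_def)
  qed
  have split: "(\<Sum>\<kappa>\<in>PiE U (\<lambda>_. {k, Suc k}). F (\<kappa> q) * colouring_weight U A \<kappa>) = F k * X k + F (Suc k) * X (Suc k)"
    for F :: "nat \<Rightarrow> ff mps"
  proof -
    have "X c = (\<Sum>\<kappa>\<in>PiE U' (\<lambda>_. {k, Suc k}). colouring_weight U A (\<kappa>(q := c)))" for c
    proof -
      have "PiE U' ((\<lambda>_. {k, Suc k})(q := {c})) = PiE U' (\<lambda>_. {k, Suc k})"
        using U(2) by (intro PiE_cong) auto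
      thus ?thesis unfolding X_def colouring_sum_def unfolding U(1) sum_PiE_insert[OF U(2)] by simp
    qed
    thus ?thesis unfolding U(1) sum_PiE_insert[OF U(2)] by (simp add: sum_distrib_left)
  qed
  have XX: "hecke_pair k (X k) (X (Suc k))" using IH by (simp add: X_def)
  have "hecke_pair k (var k * Y k) (var (Suc k) * Y (Suc k))"
  proof -
    consider "?N = {}" | "?N = {q}" | v where "v \<in> ?N" "v \<noteq> q" by blast
    thus ?thesis
    proof cases
      case 1
      \<comment> \<open>No neighbour: the colour of \<open>p\<close> is free, and the new pair is
        one symmetric series times \<open>x_k\<close> and \<open>x_{k+1}\<close>.\<close>
      define S where "S = X k + X (Suc k)"
      have Y: "Y c = S" for c
        using split[of "\<lambda>_. 1"] unfolding Y_def 1 S_def by simp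
      have "swap_vars k S = S" using XX unfolding hecke_pair_def S_def by blast
      thus ?thesis unfolding hecke_pair_def Y by (simp add: algebra_simps)
    next
      case 2
      have Y: "Y c = mconst (edge_weight c k) * X k + mconst (edge_weight c (Suc k)) * X (Suc k)" for c
        using split[of "\<lambda>b. mconst (edge_weight c b)"] unfolding Y_def 2 by simp
      have inv: "mconst tvar * mconst (inverse tvar) = (1 :: ff mps)"
        unfolding mconst_mult[symmetric] by simp
      \<comment> \<open>The edge forces the other colour on \<open>q\<close>; it ascends, with
        weight \<open>inverse tvar\<close>, exactly if \<open>p\<close> has colour
        \<open>k\<close>.\<close>
      have Yk: "Y k = mconst (inverse tvar) * X (Suc k)" "Y (Suc k) = X k"
        by (simp_all add: Y edge_weight_def)
      \<comment> \<open>The two symmetric combinations trade places: each one of the new pair is the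
        other one of the old pair, up to the factor \<open>inverse tvar\<close> or
        \<open>x_k x_{k+1}\<close>.\<close>
      have s1: "var k * Y k + var (Suc k) * Y (Suc k) =
        mconst (inverse tvar) * (mconst tvar * var (Suc k) * X k + var k * X (Suc k))"
        unfolding Yk using inv by algebra
      have s2: "mconst tvar * var (Suc k) * (var k * Y k) + var k * (var (Suc k) * Y (Suc k)) =
        var k * var (Suc k) * (X k + X (Suc k))"
        unfolding Yk using inv by algebra
      show ?thesis unfolding hecke_pair_def s1 s2
        using XX unfolding hecke_pair_def swap_vars_mult swap_vars_mconst swap_vars_var by (simp only: mult_ac simp_thms)
    next
      case (3 v)
      hence v: "v \<in> U'" "(p, v) \<in> A" using U by auto
      \<comment> \<open>Two neighbours of \<open>p\<close> form a triangle with it, which has no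
        proper colouring with two colours.\<close>
      have "(p, q) \<in> A \<and> (q, v) \<in> A"
        using Suc.prems(4) v pq lt[OF v(1)] U unfolding interval_on_def by blast
      hence pqv: "q \<in> ?N" "v \<in> ?N" "(q, v) \<in> A \<inter> U \<times> U" using q v U by auto
      have fin: "finite (A \<inter> U \<times> U)" "finite ?N" using Suc.prems(1) by auto
      have zero: "mconst (\<Prod>v\<in>?N. edge_weight c (\<kappa> v)) * colouring_weight U A \<kappa> = 0"
        if c: "c \<in> {k, Suc k}" and \<kappa>: "\<kappa> \<in> PiE U (\<lambda>_. {k, Suc k})" for c \<kappa>
      proof (cases "\<kappa> q = \<kappa> v")
        case True
        have "edges_weight (A \<inter> U \<times> U) \<kappa> = 0" using True by (rule edges_weight_eq_0[OF fin(1) pqv(3)])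
        thus ?thesis by (simp add: colouring_weight_def)
      next
        case False
        moreover have "\<kappa> q \<in> {k, Suc k}" "\<kappa> v \<in> {k, Suc k}" using \<kappa> q v U by auto
        ultimately have "c = \<kappa> q \<or> c = \<kappa> v" using c by auto
        hence "\<exists>v\<in>?N. edge_weight c (\<kappa> v) = 0" using pqv(1,2) unfolding edge_weight_def by metis
        hence "(\<Prod>v\<in>?N. edge_weight c (\<kappa> v)) = 0" using fin by (meson prod_zero)
        thus ?thesis by simp
      qed
      hence "Y k = 0" "Y (Suc k) = 0" unfolding Y_def by (auto intro!: sum.neutral)
      thus ?thesis by (simp add: hecke_pair_def)
    qed
  qed
  thus ?case unfolding goal .
qed

section \<open>From two colours to arbitrary finite lists\<close>

lemma swap_vars_colouring_weight:
  assumes "\<And>v. v \<in> V \<Longrightarrow> \<kappa> v \<notin> {k, Suc k}"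
  shows "swap_vars k (colouring_weight V A \<kappa>) = colouring_weight V A \<kappa>"
  using assms by (auto simp: colouring_weight_def swap_vars_monomial transpose_def intro!: prod.cong)

lemma swap_vars_colouring_weight_PiE:
  assumes "\<rho> \<in> PiE W (\<lambda>v. L v - {k, Suc k})"
  shows "swap_vars k (colouring_weight W A \<rho>) = colouring_weight W A \<rho>"
proof (rule swap_vars_colouring_weight)
  fix v assume "v \<in> W"
  from PiE_mem[OF assms this] show "\<rho> v \<notin> {k, Suc k}" by simp
qed

text \<open>A part \<open>U\<close> of the decomposition that contributes contains \<open>p\<close>,
  whose list is \<open>{k}\<close> or \<open>{Suc k}\<close>. Its other vertices may all be coloured
  \<open>k\<close>, hence lie after \<open>p\<close>, so \<open>p\<close> is the least vertex and
  the two-colour case applies.\<close>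

lemma hecke_pair_colouring_sum:
  assumes V: "finite V" "p \<in> V" and L: "\<And>v. v \<in> V \<Longrightarrow> finite (L v)"
    and k: "\<And>v. v \<in> V - {p} \<Longrightarrow> k \<in> L v \<longleftrightarrow> Suc k \<in> L v"
    and p: "\<And>v. v \<in> V - {p} \<Longrightarrow> k \<in> L v \<Longrightarrow> p < v"
    and A: "interval_on {v\<in>V. v = p \<or> k \<in> L v} A" "\<And>i j. (i, j) \<in> A \<Longrightarrow> i < j"
  shows "hecke_pair k (colouring_sum V (L(p := {k})) A) (colouring_sum V (L(p := {Suc k})) A)"
proof -
  let ?S = "SIGMA U:{U. U \<subseteq> V \<and> p \<in> U}. PiE (V - U) (\<lambda>v. L v - {k, Suc k})"
  let ?c = "\<lambda>x. colouring_weight (V - fst x) A (snd x) * mconst (cross_weight k (fst x) (V - fst x) A (snd x))"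
  have dec: "colouring_sum V (L(p := {c})) A =
    (\<Sum>x\<in>?S. ?c x * colouring_sum (fst x) (\<lambda>v. (L(p := {c})) v \<inter> {k, Suc k}) A)" if "c \<in> {k, Suc k}" for c
  proof -
    have S: "(SIGMA U:Pow V. PiE (V - U) (\<lambda>v. (L(p := {c})) v - {k, Suc k})) = ?S"
    proof -
      have "PiE (V - U) (\<lambda>v. (L(p := {c})) v - {k, Suc k}) =
            (if p \<in> U then PiE (V - U) (\<lambda>v. L v - {k, Suc k}) else {})" for U
      proof (cases "p \<in> U")
        case True
        hence "(L(p := {c})) v - {k, Suc k} = L v - {k, Suc k}" if "v \<in> V - U" for v
          using that by auto
        thus ?thesis using True by (simp only: if_True) (rule PiE_cong)
      next
        case False
        hence "p \<in> V - U" using V by auto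
        thus ?thesis using that False by (auto simp: PiE_eq_empty_iff)
      qed
      thus ?thesis by (auto split: if_splits)
    qed
    have "finite ((L(p := {c})) v)" if "v \<in> V" for v using L[OF that] by auto
    thus ?thesis
      using colouring_sum_decomposition[of V "L(p := {c})" A k] V unfolding S case_prod_unfold by blast
  qed
  have pair: "hecke_pair k (colouring_sum U (\<lambda>v. (L(p := {k})) v \<inter> {k, Suc k}) A)
                           (colouring_sum U (\<lambda>v. (L(p := {Suc k})) v \<inter> {k, Suc k}) A)"
    if U: "U \<subseteq> V" "p \<in> U" for U
  proof (cases "\<forall>v\<in>U - {p}. k \<in> L v")
    case True
    have U': "U = insert p (U - {p})" using U by auto
    have "colouring_sum U (\<lambda>v. (L(p := {c})) v \<inter> {k, Suc k}) A =
          colouring_sum (insert p (U - {p})) ((\<lambda>_. {k, Suc k})(p := {c})) A" if "c \<in> {k, Suc k}" for c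
      unfolding U'[symmetric] using True k U that by (intro colouring_sum_cong) auto
    moreover have "hecke_pair k (colouring_sum (insert p (U - {p})) ((\<lambda>_. {k, Suc k})(p := {k})) A)
        (colouring_sum (insert p (U - {p})) ((\<lambda>_. {k, Suc k})(p := {Suc k})) A)"
    proof (rule hecke_pair_two_colours)
      show "finite (U - {p})" using U V by (auto intro: finite_subset)
      show "p < v" if "v \<in> U - {p}" for v using that U True p by auto
      show "interval_on (insert p (U - {p})) A"
        by (rule interval_on_subset[OF A(1)]) (use U True in auto)
    qed (use A in auto)
    ultimately show ?thesis by simp
  next
    case False
    then obtain v where v: "v \<in> U - {p}" "k \<notin> L v" by auto
    hence "Suc k \<notin> L v" using k[of v] U by auto
    hence "PiE U (\<lambda>v. (L(p := {c})) v \<inter> {k, Suc k}) = {}" for c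
      using v by (auto simp: PiE_eq_empty_iff intro!: bexI[of _ v])
    thus ?thesis by (simp add: colouring_sum_def hecke_pair_def)
  qed
  have "hecke_pair k (\<Sum>x\<in>?S. ?c x * colouring_sum (fst x) (\<lambda>v. (L(p := {k})) v \<inter> {k, Suc k}) A)
                     (\<Sum>x\<in>?S. ?c x * colouring_sum (fst x) (\<lambda>v. (L(p := {Suc k})) v \<inter> {k, Suc k}) A)"
  proof (rule hecke_pair_lincomb)
    fix x assume "x \<in> ?S"
    thus "swap_vars k (?c x) = ?c x" by (auto simp: swap_vars_colouring_weight_PiE)
  qed (use pair in auto)
  thus ?thesis using dec by simp
qed

text \<open>On a nonempty two-coloured part the sum is \<open>f + g\<close> for the Hecke pair
  obtained by fixing the colour of its least vertex.\<close>

lemma swap_vars_colouring_sum: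
  assumes V: "finite V" and L: "\<And>v. v \<in> V \<Longrightarrow> finite (L v)"
    and k: "\<And>v. v \<in> V \<Longrightarrow> k \<in> L v \<longleftrightarrow> Suc k \<in> L v"
    and A: "interval_on {v\<in>V. k \<in> L v} A" "\<And>i j. (i, j) \<in> A \<Longrightarrow> i < j"
  shows "swap_vars k (colouring_sum V L A) = colouring_sum V L A"
proof -
  have *: "swap_vars k (colouring_sum U (\<lambda>v. L v \<inter> {k, Suc k}) A) = colouring_sum U (\<lambda>v. L v \<inter> {k, Suc k}) A"
    if U: "U \<subseteq> V" for U
  proof (cases "\<forall>v\<in>U. k \<in> L v")
    case True
    have eq: "colouring_sum U (\<lambda>v. L v \<inter> {k, Suc k}) A = colouring_sum U (\<lambda>_. {k, Suc k}) A"
      using True k U by (intro colouring_sum_cong) auto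
    show ?thesis
    proof (cases "U = {}")
      case False
      have fin: "finite U" using U V by (auto intro: finite_subset)
      define p where "p = Min U"
      define U' where "U' = U - {p}"
      have "p \<in> U" using False fin by (simp add: p_def)
      hence U': "U = insert p U'" "p \<notin> U'" by (auto simp: U'_def)
      have "hecke_pair k (colouring_sum (insert p U') ((\<lambda>_. {k, Suc k})(p := {k})) A)
                         (colouring_sum (insert p U') ((\<lambda>_. {k, Suc k})(p := {Suc k})) A)"
      proof (rule hecke_pair_two_colours)
        show "p < v" if "v \<in> U'" for v
          using that fin unfolding U'_def p_def by (metis Diff_iff Min_le insertI1 order_le_neq_trans)
        show "interval_on (insert p U') A"
          by (rule interval_on_subset[OF A(1)]) (use U' U True in auto)
      qed (use fin U' A in auto)
      moreover have "colouring_sum U (\<lambda>_. {k, Suc k}) A =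
        colouring_sum (insert p U') ((\<lambda>_. {k, Suc k})(p := {k})) A + colouring_sum (insert p U') ((\<lambda>_. {k, Suc k})(p := {Suc k})) A"
      proof -
        have "PiE U' ((\<lambda>_. {k, Suc k})(p := {c})) = PiE U' (\<lambda>_. {k, Suc k})" for c
          using U' by (intro PiE_cong) auto
        thus ?thesis unfolding U'(1) colouring_sum_def sum_PiE_insert[OF U'(2)] by simp
      qed
      ultimately show ?thesis unfolding eq hecke_pair_def by simp
    qed (simp add: colouring_sum_def colouring_weight_def edges_weight_def)
  next
    case False
    then obtain v where v: "v \<in> U" "k \<notin> L v" by auto
    hence "Suc k \<notin> L v" using k[of v] U by auto
    hence "PiE U (\<lambda>v. L v \<inter> {k, Suc k}) = {}"
      using v by (auto simp: PiE_eq_empty_iff intro!: bexI[of _ v])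
    thus ?thesis by (simp add: colouring_sum_def)
  qed
  define F where "F = (\<lambda>(U, \<rho>). (colouring_weight (V - U) A \<rho> * mconst (cross_weight k U (V - U) A \<rho>)) *
       colouring_sum U (\<lambda>v. L v \<inter> {k, Suc k}) A)"
  let ?S = "SIGMA U:Pow V. PiE (V - U) (\<lambda>v. L v - {k, Suc k})"
  have "swap_vars k (sum F ?S) = sum F ?S"
    unfolding swap_vars_sum
    by (rule sum.cong[OF refl]) (auto simp: F_def * swap_vars_colouring_weight_PiE)
  moreover have "colouring_sum V L A = sum F ?S"
    unfolding F_def by (rule colouring_sum_decomposition[OF V L])
  ultimately show ?thesis by (simp only:)
qed

section \<open>Infinite lists of colours, treated by truncating the variables\<close>

definition colour_series :: "nat set \<Rightarrow> (nat \<Rightarrow> nat set) \<Rightarrow> (nat \<times> nat) set \<Rightarrow> ff mps" where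
  "colour_series V L A = Abs_mps (\<lambda>M. \<Sum>\<kappa> | \<kappa> \<in> PiE V L \<and> image_mset \<kappa> (mset_set V) = M.
     edges_weight (A \<inter> V \<times> V) \<kappa>)"

text \<open>Congruence modulo the monomials with a variable beyond \<open>x_N\<close>. It respects
  products, and also the swap of \<open>k\<close> and \<open>k + 1\<close> once
  \<open>k + 1 \<le> N\<close>.\<close>

definition agree :: "nat \<Rightarrow> 'a :: comm_ring_1 mps \<Rightarrow> 'a mps \<Rightarrow> bool" where
  "agree N f g \<longleftrightarrow> (\<forall>M. set_mset M \<subseteq> {..N} \<longrightarrow> mcoeff f M = mcoeff g M)"

lemma agree_refl: "agree N f f"
  by (simp add: agree_def)

lemma agree_add: "agree N f f' \<Longrightarrow> agree N g g' \<Longrightarrow> agree N (f + g) (f' + g')"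
  by (simp add: agree_def)

lemma agree_mult: "agree N f f' \<Longrightarrow> agree N g g' \<Longrightarrow> agree N (f * g) (f' * g')"
  unfolding agree_def mcoeff_times
proof (intro allI impI sum.cong refl)
  fix M B assume *: "\<forall>M. set_mset M \<subseteq> {..N} \<longrightarrow> mcoeff f M = mcoeff f' M"
    "\<forall>M. set_mset M \<subseteq> {..N} \<longrightarrow> mcoeff g M = mcoeff g' M"
    and M: "set_mset M \<subseteq> {..N}" "B \<in> {B. B \<subseteq># M}"
  have "set_mset B \<subseteq> {..N}" "set_mset (M - B) \<subseteq> {..N}"
    using M by (auto dest: mset_subset_eqD in_diffD)
  thus "mcoeff f B * mcoeff g (M - B) = mcoeff f' B * mcoeff g' (M - B)" using * by simp
qed

lemma agree_swap_vars:
  assumes "agree N f g" "Suc k \<le> N" shows "agree N (swap_vars k f) (swap_vars k g)"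
proof -
  have "set_mset (image_mset (swap k) M) \<subseteq> {..N}" if "set_mset M \<subseteq> {..N}" for M
    using that assms(2) by (force simp: transpose_def)
  thus ?thesis using assms(1) by (simp add: agree_def mcoeff_swap del: set_image_mset)
qed

lemma agree_trans: "agree N f g \<Longrightarrow> agree N g h \<Longrightarrow> agree N f h"
  and agree_sym: "agree N f g \<Longrightarrow> agree N g f"
  by (simp_all add: agree_def)

lemma agree_eqI:
  assumes "\<And>N. N \<ge> K \<Longrightarrow> agree N f g" shows "f = g"
proof (rule mps_eqI)
  fix M
  have "set_mset M \<subseteq> {..max K (Max (set_mset M))}"
    using Max_ge[of "set_mset M"] by (auto simp: le_max_iff_disj)
  thus "mcoeff f M = mcoeff g M" using assms[of "max K (Max (set_mset M))"] by (simp add: agree_def)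
qed

text \<open>The invariant approximant \<open>f'\<close> may change with \<open>N\<close>, since each
  coefficient is settled by one large \<open>N\<close>.\<close>

lemma swap_vars_agreeI:
  assumes "\<And>N. N \<ge> Suc k \<Longrightarrow> \<exists>f'. agree N f f' \<and> swap_vars k f' = f'"
  shows "swap_vars k f = f"
proof (rule agree_eqI)
  fix N assume N: "N \<ge> Suc k"
  then obtain f' where f': "agree N f f'" "swap_vars k f' = f'" using assms by blast
  have "agree N (swap_vars k f) f'" using agree_swap_vars[OF f'(1) N] f'(2) by simp
  thus "agree N (swap_vars k f) f" using agree_trans agree_sym f'(1) by blast
qed

lemma hecke_pair_agreeI:
  assumes "\<And>N. N \<ge> Suc k \<Longrightarrow> \<exists>f' g'. agree N f f' \<and> agree N g g' \<and> hecke_pair k f' g'"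
  shows "hecke_pair k f g"
  unfolding hecke_pair_def
proof (intro conjI swap_vars_agreeI)
  fix N assume "N \<ge> Suc k"
  then obtain f' g' where *: "agree N f f'" "agree N g g'" "hecke_pair k f' g'" using assms by blast
  show "\<exists>h. agree N (f + g) h \<and> swap_vars k h = h"
    using * by (intro exI[of _ "f' + g'"] conjI agree_add) (auto simp: hecke_pair_def)
  show "\<exists>h. agree N (mconst tvar * var (Suc k) * f + var k * g) h \<and> swap_vars k h = h"
    using *(3) unfolding hecke_pair_def
    by (intro exI[of _ "mconst tvar * var (Suc k) * f' + var k * g'"] conjI agree_add agree_mult agree_refl *) blast
qed

lemma prod_var: "finite V \<Longrightarrow> (\<Prod>v\<in>V. var (\<kappa> v)) = (monomial (image_mset \<kappa> (mset_set V)) :: 'a :: comm_ring_1 mps)"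
proof (induction V rule: finite_induct)
  case (insert v V)
  thus ?case using monomial_add_mset[of "\<kappa> v" "image_mset \<kappa> (mset_set V)", where 'a = 'a] by simp
qed (simp add: monomial_empty)

lemma mcoeff_colouring_weight:
  assumes "finite V"
  shows "mcoeff (colouring_weight V A \<kappa>) M =
         (if image_mset \<kappa> (mset_set V) = M then edges_weight (A \<inter> V \<times> V) \<kappa> else 0)"
  unfolding colouring_weight_def prod_var[OF assms] mult.commute[of "monomial _"]
  by (simp add: mcoeff_monomial)

text \<open>The colours are the variables of the monomial, so a monomial in the variables up to
  \<open>x_N\<close> sees only colours up to \<open>N\<close>.\<close>

lemma agree_colour_series:
  assumes "finite V"
  shows "agree N (colour_series V L A) (colouring_sum V (\<lambda>v. L v \<inter> {..N}) A)"
  unfolding agree_def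
proof (intro allI impI)
  fix M assume M: "set_mset M \<subseteq> {..N}"
  have fin: "finite (PiE V (\<lambda>v. L v \<inter> {..N}))" using assms by (intro finite_PiE) auto
  have "{\<kappa>. \<kappa> \<in> PiE V L \<and> image_mset \<kappa> (mset_set V) = M} =
        {\<kappa> \<in> PiE V (\<lambda>v. L v \<inter> {..N}). image_mset \<kappa> (mset_set V) = M}"
  proof -
    have "\<kappa> v \<le> N" if "image_mset \<kappa> (mset_set V) = M" "v \<in> V" for \<kappa> v
    proof -
      have "\<kappa> v \<in># M" using that assms by auto
      thus ?thesis using subsetD[OF M] by simp
    qed
    thus ?thesis by (auto simp: PiE_iff)
  qed
  thus "mcoeff (colour_series V L A) M = mcoeff (colouring_sum V (\<lambda>v. L v \<inter> {..N}) A) M"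
    using fin by (simp add: colour_series_def colouring_sum_def mcoeff_colouring_weight[OF assms] sum.inter_filter)
qed

lemma finite_colourings:
  assumes "finite V"
  shows "finite {\<kappa>. \<kappa> \<in> PiE V L \<and> image_mset \<kappa> (mset_set V) = M}"
proof (rule finite_subset)
  show "{\<kappa>. \<kappa> \<in> PiE V L \<and> image_mset \<kappa> (mset_set V) = M} \<subseteq> PiE V (\<lambda>_. set_mset M)"
    using assms by (auto simp: PiE_iff extensional_def)
qed (use assms in \<open>auto intro: finite_PiE\<close>)

lemma hecke_pair_colour_series:
  assumes V: "finite V" "p \<in> V"
    and k: "\<And>v. v \<in> V - {p} \<Longrightarrow> k \<in> L v \<longleftrightarrow> Suc k \<in> L v"
    and p: "\<And>v. v \<in> V - {p} \<Longrightarrow> k \<in> L v \<Longrightarrow> p < v"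
    and A: "interval_on V A" "\<And>i j. (i, j) \<in> A \<Longrightarrow> i < j"
  shows "hecke_pair k (colour_series V (L(p := {k})) A) (colour_series V (L(p := {Suc k})) A)"
proof (rule hecke_pair_agreeI)
  fix N assume N: "N \<ge> Suc k"
  let ?L = "\<lambda>v. L v \<inter> {..N}"
  have eq: "(\<lambda>v. (L(p := {c})) v \<inter> {..N}) = ?L(p := {c})" if "c \<in> {k, Suc k}" for c
    using that N by (auto simp: fun_eq_iff)
  have "hecke_pair k (colouring_sum V (?L(p := {k})) A) (colouring_sum V (?L(p := {Suc k})) A)"
  proof (rule hecke_pair_colouring_sum)
    show "interval_on {v \<in> V. v = p \<or> k \<in> ?L v} A" by (rule interval_on_subset[OF A(1)]) auto
  qed (use V k p A(2) N in auto)
  thus "\<exists>f' g'. agree N (colour_series V (L(p := {k})) A) f' \<and>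
      agree N (colour_series V (L(p := {Suc k})) A) g' \<and> hecke_pair k f' g'"
    using agree_colour_series[OF V(1), of N "L(p := {k})" A] agree_colour_series[OF V(1), of N "L(p := {Suc k})" A]
    unfolding eq[OF insertI1] eq[OF insertI2[OF singletonI]] by blast
qed

lemma swap_vars_colour_series:
  assumes V: "finite V"
    and k: "\<And>v. v \<in> V \<Longrightarrow> k \<in> L v \<longleftrightarrow> Suc k \<in> L v"
    and A: "interval_on V A" "\<And>i j. (i, j) \<in> A \<Longrightarrow> i < j"
  shows "swap_vars k (colour_series V L A) = colour_series V L A"
proof (rule swap_vars_agreeI)
  fix N assume N: "N \<ge> Suc k"
  have "swap_vars k (colouring_sum V (\<lambda>v. L v \<inter> {..N}) A) = colouring_sum V (\<lambda>v. L v \<inter> {..N}) A"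
  proof (rule swap_vars_colouring_sum)
    show "interval_on {v \<in> V. k \<in> L v \<inter> {..N}} A" by (rule interval_on_subset[OF A(1)]) auto
  qed (use V k A(2) N in auto)
  thus "\<exists>f'. agree N (colour_series V L A) f' \<and> swap_vars k f' = f'"
    using agree_colour_series[OF V] by blast
qed

section \<open>From super words to colourings\<close>

text \<open>Positions \<open>m + 1, \<dots>, d\<close>, of which those up to \<open>y\<close> are flagged: this is the state reached when the
  point \<open>(m, y)\<close> of the path has been traversed backwards.\<close>

definition good_area :: "nat \<Rightarrow> nat \<Rightarrow> nat \<Rightarrow> (nat \<times> nat) set \<Rightarrow> bool" where
  "good_area m y d A \<longleftrightarrow> A \<subseteq> {(i, j). m < i \<and> i < j \<and> j \<le> d} \<and>
     (\<forall>i j l. (i, l) \<in> A \<and> i < j \<and> j < l \<longrightarrow> (i, j) \<in> A \<and> (j, l) \<in> A) \<and>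
     (\<forall>i j. m < i \<and> i < j \<and> j \<le> y \<longrightarrow> (i, j) \<in> A)"

text \<open>Flagged positions are pinned to the colours \<open>1, ..., y - m\<close>. Colours are
  counted from the current column because each later \<open>d_plus\<close> inserts a new first
  colour and shifts the flagged ones.\<close>

definition flags :: "nat \<Rightarrow> nat \<Rightarrow> nat \<Rightarrow> nat set" where
  "flags m y = (\<lambda>p. if p \<le> y then {p - m} else {1..})"

lemma good_area_less: "good_area m y d A \<Longrightarrow> (i, j) \<in> A \<Longrightarrow> i < j"
  and good_area_bounds: "good_area m y d A \<Longrightarrow> (i, j) \<in> A \<Longrightarrow> m < i \<and> j \<le> d"
  and good_area_closed: "good_area m y d A \<Longrightarrow> (i, l) \<in> A \<Longrightarrow> i < j \<Longrightarrow> j < l \<Longrightarrow> (i, j) \<in> A \<and> (j, l) \<in> A"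
  and good_area_clique: "good_area m y d A \<Longrightarrow> m < i \<Longrightarrow> i < j \<Longrightarrow> j \<le> y \<Longrightarrow> (i, j) \<in> A"
  unfolding good_area_def by blast+

lemma good_area_subset: "good_area m y d A \<Longrightarrow> A \<subseteq> {m<..d} \<times> {m<..d}"
  using good_area_less good_area_bounds by fastforce

lemma good_area_finite: "good_area m y d A \<Longrightarrow> finite A"
  by (rule finite_subset[OF good_area_subset]) auto

lemma good_area_interval_on: "good_area m y d A \<Longrightarrow> interval_on V A"
  unfolding interval_on_def using good_area_closed by blast

definition inversions :: "(nat \<times> nat) set \<Rightarrow> (nat \<Rightarrow> letter) \<Rightarrow> nat" where
  "inversions A T = card {(i, j) \<in> A. column_decreasing (T j) (T i)}"

lemma column_decreasing_iff:
  "column_decreasing a b \<longleftrightarrow> letter_abs b < letter_abs a \<or> (letter_abs a = letter_abs b \<and> negative a)"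
  by (cases a; cases b) (auto simp: column_decreasing_def less_letter_def)

definition signed :: "nat set \<Rightarrow> (nat \<Rightarrow> nat) \<Rightarrow> nat set \<Rightarrow> nat \<Rightarrow> letter" where
  "signed V \<kappa> N = (\<lambda>v\<in>V. if v \<in> N then Neg (\<kappa> v) else Pos (\<kappa> v))"

lemma signed_simps:
  "v \<in> V \<Longrightarrow> letter_abs (signed V \<kappa> N v) = \<kappa> v" "v \<in> V \<Longrightarrow> negative (signed V \<kappa> N v) \<longleftrightarrow> v \<in> N"
  by (auto simp: signed_def)

text \<open>Two equally coloured ends of an edge admit a sign-reversing cancellation: the least vertex \<open>j\<close> with
  an equally coloured lower neighbour has exactly one such neighbour, hence its two signs contribute
  \<open>1 - t \<cdot> t\<^sup>-\<^sup>1 = 0\<close>.\<close>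

lemma sum_over_signs:
  assumes A: "good_area 0 r d A" and r: "r \<le> d"
    and \<kappa>: "\<kappa> \<in> PiE {0<..d} (\<lambda>_. {1..})" "\<And>i. i \<in> {0<..r} \<Longrightarrow> \<kappa> i \<le> i"
  shows "(\<Sum>N\<in>Pow {v\<in>{0<..d}. \<not> (v \<le> r \<and> \<kappa> v = v)}.
            inverse tvar ^ inversions A (signed {0<..d} \<kappa> N) * (- tvar) ^ card N) =
         (if \<kappa> \<in> PiE {0<..d} (flags 0 r) then (1 - tvar) ^ (d - r) * edges_weight A \<kappa> else 0)"
proof -
  let ?V = "{0<..d}"
  \<comment> \<open>The positions whose sign is free: \<open>T v \<le> Pos v\<close> rules out
    \<open>Neg v\<close>.\<close>
  let ?E = "{v\<in>?V. \<not> (v \<le> r \<and> \<kappa> v = v)}"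
  \<comment> \<open>A negative letter at \<open>j\<close> turns the edges from its equally coloured
    lower neighbours into inversions.\<close>
  define deg where "deg = (\<lambda>j. card {i. (i, j) \<in> A \<and> \<kappa> i = \<kappa> j})"
  define inv where "inv = card {(i, j) \<in> A. \<kappa> i < \<kappa> j}"
  have sub: "A \<subseteq> ?V \<times> ?V" and fin: "finite A"
    using good_area_subset[OF A] good_area_finite[OF A] by auto
  have finE: "finite ?E" by simp
  have count: "inversions A (signed ?V \<kappa> N) = inv + (\<Sum>j\<in>N. deg j)" if N: "N \<subseteq> ?E" for N
  proof -
    have finN: "finite N" using N finE by (rule finite_subset)
    have "column_decreasing (signed ?V \<kappa> N j) (signed ?V \<kappa> N i) \<longleftrightarrow> \<kappa> i < \<kappa> j \<or> (\<kappa> i = \<kappa> j \<and> j \<in> N)"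
      if "(i, j) \<in> A" for i j
    proof -
      have "i \<in> ?V" "j \<in> ?V" using that sub by auto
      thus ?thesis by (auto simp: column_decreasing_iff signed_simps)
    qed
    hence "{(i, j) \<in> A. column_decreasing (signed ?V \<kappa> N j) (signed ?V \<kappa> N i)} =
      {(i, j) \<in> A. \<kappa> i < \<kappa> j} \<union> {(i, j) \<in> A. \<kappa> i = \<kappa> j \<and> j \<in> N}" by auto
    hence "inversions A (signed ?V \<kappa> N) = inv + card {(i, j) \<in> A. \<kappa> i = \<kappa> j \<and> j \<in> N}"
      unfolding inversions_def inv_def by (simp only:) (rule card_Un_disjoint, use fin in \<open>auto intro: finite_subset\<close>)
    also have "{(i, j) \<in> A. \<kappa> i = \<kappa> j \<and> j \<in> N} = (\<lambda>(j, i). (i, j)) ` (SIGMA j:N. {i. (i, j) \<in> A \<and> \<kappa> i = \<kappa> j})"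
      by (auto simp: image_iff)
    also have "card \<dots> = card (SIGMA j:N. {i. (i, j) \<in> A \<and> \<kappa> i = \<kappa> j})"
      by (rule card_image) (auto simp: inj_on_def)
    also have "\<dots> = (\<Sum>j\<in>N. deg j)"
      unfolding deg_def
    proof (rule card_SigmaI[OF finN], intro ballI)
      fix j
      show "finite {i. (i, j) \<in> A \<and> \<kappa> i = \<kappa> j}"
        by (rule finite_subset[of _ "fst ` A"]) (use fin in force)+
    qed
    finally show ?thesis .
  qed
  have "(\<Sum>N\<in>Pow ?E. inverse tvar ^ inversions A (signed ?V \<kappa> N) * (- tvar) ^ card N) =
        (\<Sum>N\<in>Pow ?E. inverse tvar ^ inv * ((\<Prod>j\<in>N. - tvar * inverse tvar ^ deg j) * (\<Prod>j\<in>?E - N. 1)))"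
  proof (intro sum.cong refl)
    fix N assume "N \<in> Pow ?E"
    hence N: "N \<subseteq> ?E" by blast
    have "(\<Prod>j\<in>N. - tvar * inverse tvar ^ deg j) = (- tvar) ^ card N * inverse tvar ^ sum deg N"
      by (simp only: prod.distrib prod_constant power_sum)
    thus "inverse tvar ^ inversions A (signed ?V \<kappa> N) * (- tvar) ^ card N =
          inverse tvar ^ inv * ((\<Prod>j\<in>N. - tvar * inverse tvar ^ deg j) * (\<Prod>j\<in>?E - N. 1))"
      by (simp only: count[OF N] power_add prod.neutral_const mult_1_right mult_ac)
  qed
  also have "\<dots> = inverse tvar ^ inv * (\<Prod>j\<in>?E. - tvar * inverse tvar ^ deg j + 1)"
    by (simp only: sum_distrib_left[symmetric] prod_add[OF finE])
  finally have sum_eq: "(\<Sum>N\<in>Pow ?E. inverse tvar ^ inversions A (signed ?V \<kappa> N) * (- tvar) ^ card N) =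
     inverse tvar ^ inv * (\<Prod>j\<in>?E. - tvar * inverse tvar ^ deg j + 1)" .
  show ?thesis
  proof (cases "\<exists>(i, j)\<in>A. \<kappa> i = \<kappa> j")
    case True
    hence ex: "\<exists>j i. (i, j) \<in> A \<and> \<kappa> i = \<kappa> j" by auto
    define j where "j = (LEAST j. \<exists>i. (i, j) \<in> A \<and> \<kappa> i = \<kappa> j)"
    obtain i where i: "(i, j) \<in> A" "\<kappa> i = \<kappa> j"
      unfolding j_def using LeastI_ex[OF ex] by blast
    have min: "j \<le> j'" if "(i', j') \<in> A" "\<kappa> i' = \<kappa> j'" for i' j'
      unfolding j_def using that by (intro Least_le) blast
    have uniq: "i' = i''" if "(i', j) \<in> A" "\<kappa> i' = \<kappa> j" "(i'', j) \<in> A" "\<kappa> i'' = \<kappa> j" for i' i''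
    proof -
      have F: False if "i' < i''" "(i', j) \<in> A" "\<kappa> i' = \<kappa> j" "(i'', j) \<in> A" "\<kappa> i'' = \<kappa> j" for i' i''
      proof -
        have "i'' < j" using good_area_less[OF A] that by blast
        hence "(i', i'') \<in> A" using good_area_closed[OF A] that by blast
        hence "j \<le> i''" using min that by simp
        thus False using \<open>i'' < j\<close> by simp
      qed
      show ?thesis using F[of i' i''] F[of i'' i'] that by (metis linorder_neqE_nat)
    qed
    have "{i. (i, j) \<in> A \<and> \<kappa> i = \<kappa> j} = {i}" using i uniq by blast
    hence "deg j = 1" by (simp add: deg_def)
    hence z: "- tvar * inverse tvar ^ deg j + 1 = 0" by simp
    \<comment> \<open>A flagged \<open>j\<close> has
      \<open>\<kappa> j = \<kappa> i \<le> i < j\<close>, so its sign is free.\<close>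
    have "j \<in> ?E"
    proof -
      have ij: "i < j" "i \<in> ?V" "j \<in> ?V" using i good_area_less[OF A] sub by auto
      have "\<not> (j \<le> r \<and> \<kappa> j = j)" using \<kappa>(2)[of i] ij i(2) by auto
      thus ?thesis using ij by auto
    qed
    hence "(\<Prod>j\<in>?E. - tvar * inverse tvar ^ deg j + 1) = 0" using z finE by (meson prod_zero)
    moreover have "edges_weight A \<kappa> = 0" by (rule edges_weight_eq_0[of A i j \<kappa>]) (use fin i in auto)
    ultimately show ?thesis unfolding sum_eq by simp
  next
    case False
    hence proper: "\<kappa> i \<noteq> \<kappa> j" if "(i, j) \<in> A" for i j using that by auto
    have flag: "\<kappa> v = v" if "v \<in> {0<..r}" for v
      using that
    proof (induction v rule: less_induct)
      case (less v)
      have ne: "\<kappa> v \<noteq> u" if "u \<in> {0<..<v}" for u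
      proof -
        have "\<kappa> u = u" using less that by auto
        moreover have "(u, v) \<in> A" using good_area_clique[OF A, of u v] that less.prems by auto
        ultimately show ?thesis using proper[of u v] by simp
      qed
      have "\<kappa> v \<ge> 1" using PiE_mem[OF \<kappa>(1), of v] less.prems r by auto
      thus ?case using \<kappa>(2)[OF less.prems] ne[of "\<kappa> v"] by fastforce
    qed
    have mem: "\<kappa> \<in> PiE ?V (flags 0 r)"
      using \<kappa>(1) flag by (auto simp: PiE_iff flags_def)
    have E: "?E = {r<..d}" using flag r by force
    have "{i. (i, j) \<in> A \<and> \<kappa> i = \<kappa> j} = {}" for j using proper by blast
    hence "deg j = 0" for j by (simp only: deg_def card.empty)
    hence "(\<Prod>j\<in>?E. - tvar * inverse tvar ^ deg j + 1) = (1 - tvar) ^ (d - r)"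
      unfolding E by simp
    moreover have "edges_weight A \<kappa> = inverse tvar ^ inv"
    proof -
      have "edges_weight A \<kappa> = (\<Prod>e\<in>A. if \<kappa> (fst e) < \<kappa> (snd e) then inverse tvar else 1)"
        unfolding edges_weight_def using proper by (intro prod.cong) (auto simp: edge_weight_def)
      also have "\<dots> = (\<Prod>e\<in>{e\<in>A. \<kappa> (fst e) < \<kappa> (snd e)}. inverse tvar)"
        by (rule prod.inter_filter[OF fin, symmetric])
      also have "{e\<in>A. \<kappa> (fst e) < \<kappa> (snd e)} = {(i, j) \<in> A. \<kappa> i < \<kappa> j}" by auto
      finally show ?thesis by (simp add: inv_def)
    qed
    ultimately show ?thesis unfolding sum_eq using mem by simp
  qed
qed

text \<open>Since \<open>Pos i < Neg i\<close>, the flag condition at \<open>i\<close> says that the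
  absolute value is at most \<open>i\<close> and the letter is not \<open>Neg i\<close>. The marking
  is left out here; \<open>weight_right\<close> restores it.\<close>

lemma column_super_words_empty:
  assumes "r \<le> d"
  shows "column_super_words r d {} =
    (\<lambda>(\<kappa>, N). signed {0<..d} \<kappa> N) ` (SIGMA \<kappa>:{\<kappa> \<in> PiE {0<..d} (\<lambda>_. {1..}). \<forall>i\<in>{0<..r}. \<kappa> i \<le> i}.
       Pow {v\<in>{0<..d}. \<not> (v \<le> r \<and> \<kappa> v = v)})"
proof (intro equalityI subsetI)
  let ?V = "{0<..d}"
  have V: "{1..d} = ?V" "{1..r} = {0<..r}" by auto
  fix T assume T: "T \<in> column_super_words r d {}"
  define \<kappa> N where "\<kappa> = (\<lambda>v\<in>?V. letter_abs (T v))" and "N = {v\<in>?V. negative (T v)}"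
  have TV: "T \<in> ?V \<rightarrow>\<^sub>E alphabet" and flag: "\<And>i. i \<in> {0<..r} \<Longrightarrow> T i \<le> Pos i"
    using T unfolding column_super_words_def V by simp_all
  have "T = signed ?V \<kappa> N"
  proof
    fix v
    show "T v = signed ?V \<kappa> N v"
      using TV by (cases "T v") (auto simp: signed_def \<kappa>_def N_def PiE_iff extensional_def)
  qed
  moreover have "\<kappa> \<in> PiE ?V (\<lambda>_. {1..})" using TV by (auto simp: \<kappa>_def PiE_iff alphabet_def)
  moreover have "\<kappa> i \<le> i \<and> \<not> (\<kappa> i = i \<and> i \<in> N)" if "i \<in> {0<..r}" for i
    using flag[OF that] that assms
    by (cases "T i") (auto simp: \<kappa>_def N_def less_eq_letter_def less_letter_def)
  moreover have "N \<subseteq> ?V" by (auto simp: N_def)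
  ultimately show "T \<in> (\<lambda>(\<kappa>, N). signed ?V \<kappa> N) ` (SIGMA \<kappa>:{\<kappa> \<in> PiE ?V (\<lambda>_. {1..}). \<forall>i\<in>{0<..r}. \<kappa> i \<le> i}.
       Pow {v\<in>?V. \<not> (v \<le> r \<and> \<kappa> v = v)})"
    by (intro image_eqI[of _ _ "(\<kappa>, N)"]) auto
next
  let ?V = "{0<..d}"
  have V: "{1..d} = ?V" "{1..r} = {0<..r}" by auto
  fix T assume "T \<in> (\<lambda>(\<kappa>, N). signed ?V \<kappa> N) ` (SIGMA \<kappa>:{\<kappa> \<in> PiE ?V (\<lambda>_. {1..}). \<forall>i\<in>{0<..r}. \<kappa> i \<le> i}.
       Pow {v\<in>?V. \<not> (v \<le> r \<and> \<kappa> v = v)})"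
  then obtain \<kappa> N where T: "T = signed ?V \<kappa> N" and \<kappa>: "\<kappa> \<in> PiE ?V (\<lambda>_. {1..})" "\<And>i. i \<in> {0<..r} \<Longrightarrow> \<kappa> i \<le> i"
    and N: "N \<subseteq> {v\<in>?V. \<not> (v \<le> r \<and> \<kappa> v = v)}" by auto
  have "T v \<in> alphabet" if "v \<in> ?V" for v
    using PiE_mem[OF \<kappa>(1) that] that unfolding T by (simp add: alphabet_def signed_simps)
  moreover have "T i \<le> Pos i" if "i \<in> {0<..r}" for i
    using \<kappa>(2)[OF that] N that assms unfolding T by (auto simp: signed_def less_eq_letter_def less_letter_def)
  ultimately show "T \<in> column_super_words r d {}"
    unfolding column_super_words_def V by (auto simp: PiE_iff T signed_def)
qed

lemma sum_column_super_words:
  assumes A: "good_area 0 r d A" and r: "r \<le> d"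
  shows "(\<Sum>T | T \<in> column_super_words r d {} \<and> word_monomial d T = M.
            inverse tvar ^ inversions A T * (- tvar) ^ num_negative d T) =
         (1 - tvar) ^ (d - r) * mcoeff (colour_series {0<..d} (flags 0 r) A) M"
proof -
  let ?V = "{0<..d}"
  have V: "{1..d} = ?V" by auto
  let ?P = "\<lambda>\<kappa>. image_mset \<kappa> (mset_set ?V) = M"
  let ?K = "{\<kappa>. \<kappa> \<in> PiE ?V (\<lambda>_. {1..}) \<and> ?P \<kappa> \<and> (\<forall>i\<in>{0<..r}. \<kappa> i \<le> i)}"
  let ?E = "\<lambda>\<kappa>. {v\<in>?V. \<not> (v \<le> r \<and> \<kappa> v = v)}"
  have finK: "finite ?K"
    by (rule finite_subset[OF _ finite_colourings[of ?V "\<lambda>_. {1..}" M]]) auto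
  have mono: "word_monomial d (signed ?V \<kappa> N) = image_mset \<kappa> (mset_set ?V)" for \<kappa> N
    unfolding word_monomial_def V by (intro image_mset_cong) (simp add: signed_simps)
  have neg: "num_negative d (signed ?V \<kappa> N) = card N" if "N \<subseteq> ?V" for \<kappa> N
    unfolding num_negative_def V using that by (intro arg_cong[of _ _ card]) (auto simp: signed_simps)
  let ?s = "\<lambda>(\<kappa>, N). signed ?V \<kappa> N"
  have set: "{T. T \<in> column_super_words r d {} \<and> word_monomial d T = M} = ?s ` (SIGMA \<kappa>:?K. Pow (?E \<kappa>))"
    unfolding column_super_words_empty[OF r] using mono by (auto simp: image_iff)
  have inj: "inj_on ?s (SIGMA \<kappa>:?K. Pow (?E \<kappa>))"
  proof (rule inj_onI, clarify)
    fix \<kappa> N \<kappa>' N'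
    assume *: "signed ?V \<kappa> N = signed ?V \<kappa>' N'" "N \<subseteq> ?E \<kappa>" "N' \<subseteq> ?E \<kappa>'"
      "\<kappa> \<in> PiE ?V (\<lambda>_. {1..})" "\<kappa>' \<in> PiE ?V (\<lambda>_. {1..})"
    have "\<kappa> v = \<kappa>' v" if "v \<in> ?V" for v using *(1) signed_simps(1)[OF that] by metis
    hence "\<kappa> = \<kappa>'" using *(4,5) by (intro PiE_ext)
    moreover have "v \<in> N \<longleftrightarrow> v \<in> N'" if "v \<in> ?V" for v using *(1) signed_simps(2)[OF that] by metis
    hence "N = N'" using *(2,3) by blast
    ultimately show "\<kappa> = \<kappa>' \<and> N = N'" by simp
  qed
  have "(\<Sum>T | T \<in> column_super_words r d {} \<and> word_monomial d T = M.
            inverse tvar ^ inversions A T * (- tvar) ^ num_negative d T) =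
        (\<Sum>(\<kappa>, N)\<in>(SIGMA \<kappa>:?K. Pow (?E \<kappa>)).
            inverse tvar ^ inversions A (signed ?V \<kappa> N) * (- tvar) ^ card N)"
    unfolding set sum.reindex[OF inj]
  proof (rule sum.cong[OF refl], clarify)
    fix \<kappa> N assume "N \<subseteq> ?E \<kappa>"
    hence "N \<subseteq> ?V" by blast
    thus "((\<lambda>T. inverse tvar ^ inversions A T * (- tvar) ^ num_negative d T) \<circ> ?s) (\<kappa>, N) =
          inverse tvar ^ inversions A (signed ?V \<kappa> N) * (- tvar) ^ card N"
      by (simp add: neg)
  qed
  also have "\<dots> = (\<Sum>\<kappa>\<in>?K. \<Sum>N\<in>Pow (?E \<kappa>). inverse tvar ^ inversions A (signed ?V \<kappa> N) * (- tvar) ^ card N)"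
    by (rule sum.Sigma[symmetric]) (use finK in auto)
  also have "\<dots> = (\<Sum>\<kappa>\<in>?K. if \<kappa> \<in> PiE ?V (flags 0 r) then (1 - tvar) ^ (d - r) * edges_weight A \<kappa> else 0)"
    using sum_over_signs[OF A r] by (intro sum.cong) auto
  also have "\<dots> = (\<Sum>\<kappa>\<in>{\<kappa>\<in>?K. \<kappa> \<in> PiE ?V (flags 0 r)}. (1 - tvar) ^ (d - r) * edges_weight A \<kappa>)"
    by (rule sum.inter_filter[OF finK, symmetric])
  also have "{\<kappa>\<in>?K. \<kappa> \<in> PiE ?V (flags 0 r)} = {\<kappa>. \<kappa> \<in> PiE ?V (flags 0 r) \<and> ?P \<kappa>}"
  proof -
    have "\<kappa> \<in> ?K" if \<kappa>: "\<kappa> \<in> PiE ?V (flags 0 r)" "?P \<kappa>" for \<kappa>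
    proof -
      have "\<kappa> v \<in> {1..} \<and> (v \<le> r \<longrightarrow> \<kappa> v \<le> v)" if "v \<in> ?V" for v
        using PiE_mem[OF \<kappa>(1) that] that by (auto simp: flags_def split: if_splits)
      thus ?thesis using \<kappa> r by (auto simp: PiE_iff)
    qed
    thus ?thesis by auto
  qed
  moreover have "A \<inter> ?V \<times> ?V = A" using good_area_subset[OF A] by auto
  ultimately show ?thesis by (simp add: colour_series_def sum_distrib_left)
qed

section \<open>The operators on sums of colourings\<close>

text \<open>The list stands for a formal combination of edge sets; a corner replaces each entry by
  two of opposite sign, and equal sets may recur.\<close>

definition lincomb :: "(ff \<times> (nat \<times> nat) set) list \<Rightarrow> ((nat \<times> nat) set \<Rightarrow> ff mps) \<Rightarrow> ff mps" where
  "lincomb L F = (\<Sum>(c, A)\<leftarrow>L. mconst c * F A)"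

lemma lincomb_simps [simp]:
  "lincomb [] F = 0" "lincomb ((c, A) # L) F = mconst c * F A + lincomb L F"
  "lincomb (L @ L') F = lincomb L F + lincomb L' F"
  by (simp_all add: lincomb_def)

lemma lincomb_cong:
  "(\<And>c A. (c, A) \<in> set L \<Longrightarrow> F A = G A) \<Longrightarrow> lincomb L F = lincomb L G"
  by (induction L) (auto, metis)

lemma mult_lincomb: "g * lincomb L F = lincomb L (\<lambda>A. g * F A)"
  by (induction L) (auto simp: algebra_simps)

lemma mcoeff_lincomb: "mcoeff (lincomb L F) M = (\<Sum>(c, A)\<leftarrow>L. c * mcoeff (F A) M)"
  by (induction L) auto

lemma lincomb_map:
  "lincomb (map (\<lambda>(c, A). (b * c, h A)) L) F = mconst b * lincomb L (\<lambda>A. F (h A))"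
  by (induction L) (auto simp: mconst_mult algebra_simps)

lemma swap_vars_lincomb:
  "(\<And>c A. (c, A) \<in> set L \<Longrightarrow> swap_vars k (F A) = F A) \<Longrightarrow> swap_vars k (lincomb L F) = lincomb L F"
  by (induction L) (auto, metis)

lemma hecke_pair_0 [simp]: "hecke_pair k 0 0"
  by (simp add: hecke_pair_def)

lemma hecke_pair_add:
  assumes "hecke_pair k f g" "hecke_pair k f' g'"
  shows "hecke_pair k (f + f') (g + g')"
proof -
  have "hecke_pair k (if b then f else f') (if b then g else g')" for b using assms by simp
  thus ?thesis
    using hecke_pair_lincomb[of "UNIV :: bool set" k "\<lambda>b. if b then f else f'" "\<lambda>b. if b then g else g'" "\<lambda>_. 1"]
    by (simp add: UNIV_bool add.commute)
qed

lemma hecke_pair_mconst: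
  assumes "hecke_pair k f g"
  shows "hecke_pair k (mconst c * f) (mconst c * g)"
  using hecke_pair_lincomb[of "{()}" k "\<lambda>_. f" "\<lambda>_. g" "\<lambda>_. mconst c"] assms by simp

lemma hecke_pair_lincomb_list:
  "(\<And>c A. (c, A) \<in> set L \<Longrightarrow> hecke_pair k (F A) (G A)) \<Longrightarrow> hecke_pair k (lincomb L F) (lincomb L G)"
proof (induction L)
  case (Cons x L)
  obtain c A where "x = (c, A)" by force
  thus ?case using Cons by (auto intro!: hecke_pair_add hecke_pair_mconst)
qed simp

text \<open>The power of \<open>1 - t\<close> has one factor for each unflagged position, as in
  \<open>sum_over_signs\<close>; \<open>d_minus\<close> unflags one position and supplies the next
  factor.\<close>

definition colour_comb :: "nat \<Rightarrow> nat \<Rightarrow> nat \<Rightarrow> (ff \<times> (nat \<times> nat) set) list \<Rightarrow> ff mps" where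
  "colour_comb m y d L = mconst ((1 - tvar) ^ (d - y)) * lincomb L (colour_series {m<..d} (flags m y))"

definition add_column :: "nat \<Rightarrow> nat \<Rightarrow> (nat \<times> nat) set \<Rightarrow> (nat \<times> nat) set" where
  "add_column m y A = A \<union> Pair m ` {m<..y}"

text \<open>Under a new box \<open>(m, l)\<close> lies the new box \<open>(m, j)\<close>, and
  \<open>(j, l)\<close> is already present because the positions after \<open>m\<close> up to
  \<open>y\<close> form a clique, which position \<open>m\<close> now joins.\<close>

lemma good_area_add_column:
  assumes A: "good_area m y d A" and m: "m \<ge> 1" and y: "y \<le> d"
  shows "good_area (m - 1) y d (add_column m y A)"
proof -
  let ?B = "add_column m y A"
  have mem: "(i, j) \<in> ?B \<longleftrightarrow> (i, j) \<in> A \<or> (i = m \<and> m < j \<and> j \<le> y)" for i j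
    by (auto simp: add_column_def)
  have "m - 1 < i \<and> i < j \<and> j \<le> d" if "(i, j) \<in> ?B" for i j
    using that good_area_less[OF A, of i j] good_area_bounds[OF A, of i j] m y unfolding mem by auto
  moreover have "(i, j) \<in> ?B \<and> (j, l) \<in> ?B" if "(i, l) \<in> ?B" "i < j" "j < l" for i j l
    using that good_area_closed[OF A, of i l j] good_area_clique[OF A, of j l] unfolding mem by auto
  moreover have "(i, j) \<in> ?B" if "m - 1 < i" "i < j" "j \<le> y" for i j
    using that good_area_clique[OF A, of i j] m unfolding mem by (cases "i = m") auto
  ultimately show ?thesis unfolding good_area_def by blast
qed

lemma good_area_lower_flag: "good_area m y d A \<Longrightarrow> y' \<le> y \<Longrightarrow> good_area m y' d A"
  unfolding good_area_def by (meson order_trans)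

lemma colour_series_cong:
  assumes "\<And>v. v \<in> V \<Longrightarrow> L v = L' v"
  shows "colour_series V L A = colour_series V L' A"
proof -
  have "PiE V L = PiE V L'" by (rule PiE_cong[OF assms])
  thus ?thesis by (simp add: colour_series_def)
qed

text \<open>The lists at the intermediate stages of the east step: the first positions carry the colours
  \<open>1, \<dots>, k - 1, k + 1, \<dots>\<close>, with \<open>k\<close> left out.\<close>

definition flags_skip :: "nat \<Rightarrow> nat \<Rightarrow> nat \<Rightarrow> nat \<Rightarrow> nat set" where
  "flags_skip m y k = (\<lambda>p. if p \<le> y then {if p - m < k then p - m else Suc (p - m)} else {1..})"

text \<open>Moving the gap from \<open>k + 1\<close> to \<open>k\<close> recolours only position
  \<open>m + k\<close>, from \<open>k\<close> to \<open>k + 1\<close>. No other flagged position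
  uses these colours, and the unflagged ones all lie after \<open>m + k\<close>.\<close>

lemma hecke_pair_flags_skip:
  assumes A: "good_area m y d A" and k: "1 \<le> k" "k \<le> y - m" and y: "y \<le> d"
  shows "hecke_pair k (colour_series {m<..d} (flags_skip m y (Suc k)) A) (colour_series {m<..d} (flags_skip m y k) A)"
proof -
  let ?L = "flags_skip m y k"
  have 1: "colour_series {m<..d} (flags_skip m y (Suc k)) A = colour_series {m<..d} (?L(m + k := {k})) A"
    using k by (intro colour_series_cong) (auto simp: flags_skip_def)
  have 2: "colour_series {m<..d} (flags_skip m y k) A = colour_series {m<..d} (?L(m + k := {Suc k})) A"
    using k by (intro colour_series_cong) (auto simp: flags_skip_def)
  show ?thesis
    unfolding 1 2
  proof (rule hecke_pair_colour_series)
    show "m + k \<in> {m<..d}" using k y by auto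
    show "k \<in> ?L v \<longleftrightarrow> Suc k \<in> ?L v" if "v \<in> {m<..d} - {m + k}" for v
      using that k by (auto simp: flags_skip_def)
    show "m + k < v" if "v \<in> {m<..d} - {m + k}" "k \<in> ?L v" for v
      using that k by (auto simp: flags_skip_def split: if_splits)
    show "interval_on {m<..d} A" by (rule good_area_interval_on[OF A])
    show "i < j" if "(i, j) \<in> A" for i j by (rule good_area_less[OF A that])
  qed simp
qed

text \<open>The new position \<open>m\<close> has colour \<open>1\<close> and each of its neighbours
  \<open>m + 1, ..., y\<close> a larger one, so every new edge ascends and contributes
  \<open>inverse tvar\<close>.\<close>

lemma colour_series_add_column:
  assumes A: "good_area m y d A" and m: "m \<ge> 1" and y: "m \<le> y" "y \<le> d"
  shows "colour_series {m - 1<..d} (flags (m - 1) y) (add_column m y A) =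
         mconst (inverse tvar ^ (y - m)) * (var 1 * colour_series {m<..d} (flags_skip m y 1) A)"
proof (rule agree_eqI)
  fix N :: nat assume N: "N \<ge> 1"
  let ?V = "{m<..d}" and ?B = "add_column m y A"
  let ?L = "\<lambda>v. flags_skip m y 1 v \<inter> {..N}" and ?L' = "\<lambda>v. flags (m - 1) y v \<inter> {..N}"
  have V: "{m - 1<..d} = insert m ?V" using m y by auto
  have L: "PiE ?V ?L' = PiE ?V ?L"
    by (intro PiE_cong) (use m in \<open>auto simp: flags_def flags_skip_def\<close>)
  have Lm: "?L' m = {1}" using m y N by (auto simp: flags_def)
  have neighbours: "{v. v \<in> ?V \<and> (m, v) \<in> ?B} = {m<..y}"
    using y good_area_bounds[OF A, of m] by (auto simp: add_column_def)
  have restr: "colouring_weight ?V ?B \<kappa> = colouring_weight ?V A \<kappa>" for \<kappa>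
  proof -
    have "?B \<inter> ?V \<times> ?V = A \<inter> ?V \<times> ?V" by (auto simp: add_column_def)
    thus ?thesis by (simp add: colouring_weight_def)
  qed
  have "(\<Prod>v\<in>{m<..y}. edge_weight 1 (\<kappa> v)) = inverse tvar ^ (y - m)" if \<kappa>: "\<kappa> \<in> PiE ?V ?L" for \<kappa>
  proof -
    have "edge_weight 1 (\<kappa> v) = inverse tvar" if v: "v \<in> {m<..y}" for v
    proof -
      have "v \<in> ?V" using v y by auto
      with \<kappa> have "\<kappa> v \<in> ?L v" by (rule PiE_mem)
      hence "\<kappa> v = Suc (v - m)" using v by (auto simp: flags_skip_def)
      thus ?thesis using v by (simp add: edge_weight_def)
    qed
    thus ?thesis by simp
  qed
  hence inner: "(\<Sum>\<kappa>\<in>PiE ?V ?L. mconst (\<Prod>v\<in>{m<..y}. edge_weight 1 (\<kappa> v)) * colouring_weight ?V A \<kappa>) =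
    mconst (inverse tvar ^ (y - m)) * colouring_sum ?V ?L A"
    unfolding colouring_sum_def sum_distrib_left by (intro sum.cong refl) (simp only:)
  have "colouring_sum (insert m ?V) ?L' ?B = (\<Sum>c\<in>?L' m. var c *
      (\<Sum>\<kappa>\<in>PiE ?V ?L'. mconst (\<Prod>v | v \<in> ?V \<and> (m, v) \<in> ?B. edge_weight c (\<kappa> v)) * colouring_weight ?V ?B \<kappa>))"
    using good_area_less[OF good_area_add_column[OF A m y(2)]] by (intro colouring_sum_insert) auto
  also have "\<dots> = var 1 * (mconst (inverse tvar ^ (y - m)) * colouring_sum ?V ?L A)"
    unfolding Lm L neighbours restr inner[symmetric]
    by (simp only: sum.insert finite.emptyI empty_iff not_False_eq_True sum.empty add_0_right)
  finally have "colouring_sum (insert m ?V) ?L' ?B = mconst (inverse tvar ^ (y - m)) * (var 1 * colouring_sum ?V ?L A)"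
    by (simp only: mult.left_commute)
  hence "agree N (colour_series (insert m ?V) (flags (m - 1) y) ?B)
     (mconst (inverse tvar ^ (y - m)) * (var 1 * colouring_sum ?V ?L A))"
    using agree_colour_series[of "insert m ?V" N "flags (m - 1) y" ?B] by simp
  moreover have "agree N (mconst (inverse tvar ^ (y - m)) * (var 1 * colour_series ?V (flags_skip m y 1) A))
     (mconst (inverse tvar ^ (y - m)) * (var 1 * colouring_sum ?V ?L A))"
    by (intro agree_mult agree_refl agree_colour_series) simp
  ultimately show "agree N (colour_series {m - 1<..d} (flags (m - 1) y) ?B)
      (mconst (inverse tvar ^ (y - m)) * (var 1 * colour_series ?V (flags_skip m y 1) A))"
    unfolding V using agree_trans agree_sym by blast
qed

text \<open>With \<open>s = y - m\<close>, the gap starts just after the flagged colours, at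
  \<open>s + 1\<close>. The operators \<open>T_op s, ..., T_op 1\<close> move it to
  \<open>1\<close>, where the new position takes it. The sign in \<open>east_op\<close> cancels that
  of \<open>d_plus\<close>, and its power of \<open>t\<close> is the weight of the \<open>s\<close>
  new edges.\<close>

lemma east_op_colour_comb:
  assumes L: "\<And>c A. (c, A) \<in> set L \<Longrightarrow> good_area m y d A" and m: "m \<ge> 1" and y: "m \<le> y" "y \<le> d"
  shows "east_op (y - m) (colour_comb m y d L) =
         colour_comb (m - 1) y d (map (\<lambda>(c, A). (c, add_column m y A)) L)"
proof -
  define s where "s = y - m"
  define g where "g = (\<lambda>k. mconst ((1 - tvar) ^ (d - y)) * lincomb L (colour_series {m<..d} (flags_skip m y k)))"
  have pair: "hecke_pair k (g (Suc k)) (g k)" if "1 \<le> k" "k \<le> s" for k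
    unfolding g_def using that L y unfolding s_def
    by (intro hecke_pair_mconst hecke_pair_lincomb_list hecke_pair_flags_skip) auto
  have fold: "foldr T_op [k..<Suc s] (var (Suc s) * g (Suc s)) = var k * g k" if "1 \<le> k" "k \<le> Suc s" for k
    using that(2,1)
  proof (induction rule: inc_induct)
    case (step k)
    have "foldr T_op [k..<Suc s] (var (Suc s) * g (Suc s)) = T_op k (var (Suc k) * g (Suc k))"
      using step by (simp add: upt_conv_Cons del: upt_Suc)
    thus ?case using T_op_hecke_pair[OF pair[of k]] step by simp
  qed simp
  have "colour_comb m y d L = g (Suc s)"
  proof -
    have "colour_series {m<..d} (flags m y) A = colour_series {m<..d} (flags_skip m y (Suc s)) A" for A
      by (intro colour_series_cong) (auto simp: flags_def flags_skip_def s_def)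
    thus ?thesis unfolding colour_comb_def g_def by (auto intro!: lincomb_cong)
  qed
  hence "east_op s (colour_comb m y d L) = mconst (tvar powi (- int s)) * (var 1 * g 1)"
    using fold[of 1] by (simp add: east_op_def d_plus_def mconst_uminus)
  also have "tvar powi (- int s) = inverse tvar ^ s"
    by (simp add: power_int_minus power_inverse)
  also have "mconst (inverse tvar ^ s) * (var 1 * g 1) =
    mconst ((1 - tvar) ^ (d - y)) * lincomb L (\<lambda>A. mconst (inverse tvar ^ s) * (var 1 * colour_series {m<..d} (flags_skip m y 1) A))"
    unfolding g_def mult_lincomb[symmetric] by (simp only: mult_ac)
  also have "lincomb L (\<lambda>A. mconst (inverse tvar ^ s) * (var 1 * colour_series {m<..d} (flags_skip m y 1) A)) =
    lincomb L (\<lambda>A. colour_series {m - 1<..d} (flags (m - 1) y) (add_column m y A))"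
    using colour_series_add_column[OF L m y] by (intro lincomb_cong) (simp add: s_def)
  also have "\<dots> = lincomb (map (\<lambda>(c, A). (c, add_column m y A)) L) (colour_series {m - 1<..d} (flags (m - 1) y))"
    using lincomb_map[of 1 "add_column m y" L] by simp
  finally show ?thesis by (simp add: colour_comb_def s_def)
qed

text \<open>The clique on the flagged positions forces the newly freed position \<open>y\<close> to take a colour
  at least \<open>y - m\<close>.\<close>

lemma mcoeff_colour_series_unflag:
  assumes A: "good_area m y d A" and y: "m < y" "y \<le> d" and M: "set_mset M \<subseteq> {..N}"
  shows "(\<Sum>a=y - m..N. mcoeff (colour_series {m<..d} ((flags m (y - 1))(y := {a})) A) M) =
         mcoeff (colour_series {m<..d} (flags m (y - 1)) A) M"
proof -
  let ?V = "{m<..d}" and ?L = "flags m (y - 1)"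
  define K where "K = (\<lambda>L. {\<kappa>. \<kappa> \<in> PiE ?V L \<and> image_mset \<kappa> (mset_set ?V) = M})"
  have yV: "y \<in> ?V" using y by auto
  have fin: "finite (K L)" for L unfolding K_def by (rule finite_colourings) simp
  have "\<not> y \<le> y - 1" using y by linarith
  hence Ly: "?L y = {1..}" by (simp only: flags_def if_False)
  have mem: "\<kappa> \<in> K (?L(y := {a})) \<longleftrightarrow> \<kappa> \<in> K ?L \<and> \<kappa> y = a" if "a \<ge> 1" for \<kappa> a
  proof
    assume \<kappa>: "\<kappa> \<in> K (?L(y := {a}))"
    hence \<kappa>v: "\<kappa> v \<in> (?L(y := {a})) v" if "v \<in> ?V" for v using PiE_mem[of \<kappa> ?V "?L(y := {a})"] that by (auto simp: K_def)
    have "\<kappa> y = a" using \<kappa>v[OF yV] by simp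
    moreover have "\<kappa> v \<in> ?L v" if "v \<in> ?V" for v
      using \<kappa>v[OF that] \<open>\<kappa> y = a\<close> Ly \<open>a \<ge> 1\<close> by (cases "v = y") auto
    ultimately show "\<kappa> \<in> K ?L \<and> \<kappa> y = a" using \<kappa> by (auto simp: K_def PiE_iff)
  next
    assume "\<kappa> \<in> K ?L \<and> \<kappa> y = a"
    thus "\<kappa> \<in> K (?L(y := {a}))" by (auto simp: K_def PiE_iff)
  qed
  have "(\<Sum>a=y - m..N. mcoeff (colour_series ?V (?L(y := {a})) A) M) =
        (\<Sum>a=y - m..N. \<Sum>\<kappa>\<in>K (?L(y := {a})). edges_weight (A \<inter> ?V \<times> ?V) \<kappa>)"
    by (simp add: colour_series_def K_def)
  also have "\<dots> = (\<Sum>\<kappa>\<in>(\<Union>a\<in>{y - m..N}. K (?L(y := {a}))). edges_weight (A \<inter> ?V \<times> ?V) \<kappa>)"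
  proof (rule sum.UNION_disjoint[symmetric])
    show "\<forall>a\<in>{y - m..N}. \<forall>b\<in>{y - m..N}. a \<noteq> b \<longrightarrow> K (?L(y := {a})) \<inter> K (?L(y := {b})) = {}"
    proof (intro ballI impI)
      fix a b assume ab: "a \<in> {y - m..N}" "b \<in> {y - m..N}" "a \<noteq> b"
      have "a \<ge> 1" "b \<ge> 1" using ab y by auto
      show "K (?L(y := {a})) \<inter> K (?L(y := {b})) = {}"
        using ab(3) by (auto simp only: mem[OF \<open>a \<ge> 1\<close>] mem[OF \<open>b \<ge> 1\<close>] Int_iff)
    qed
  qed (use fin in auto)
  also have "\<dots> = (\<Sum>\<kappa>\<in>K ?L. edges_weight (A \<inter> ?V \<times> ?V) \<kappa>)"
  proof (rule sum.mono_neutral_left[OF fin])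
    have ge: "a \<ge> 1" if "a \<in> {y - m..N}" for a using that y by auto
    show "(\<Union>a\<in>{y - m..N}. K (?L(y := {a}))) \<subseteq> K ?L"
      by (auto simp only: mem[OF ge])
    show "\<forall>\<kappa>\<in>K ?L - (\<Union>a\<in>{y - m..N}. K (?L(y := {a}))). edges_weight (A \<inter> ?V \<times> ?V) \<kappa> = 0"
    proof
      fix \<kappa> assume \<kappa>: "\<kappa> \<in> K ?L - (\<Union>a\<in>{y - m..N}. K (?L(y := {a})))"
      hence K: "\<kappa> \<in> PiE ?V ?L" "image_mset \<kappa> (mset_set ?V) = M" by (auto simp: K_def)
      have "\<kappa> y \<in># M" using K(2)[symmetric] yV by auto
      hence "\<kappa> y \<le> N" using subsetD[OF M] by simp
      moreover have "\<kappa> y \<notin> {y - m..N}" using \<kappa> by (auto simp only: mem[OF ge])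
      ultimately have lt: "\<kappa> y < y - m" by simp
      have ge1: "\<kappa> y \<ge> 1" using PiE_mem[OF K(1) yV] Ly by simp
      \<comment> \<open>The flagged position that already has this colour; it is adjacent to
        \<open>y\<close>.\<close>
      define u where "u = m + \<kappa> y"
      have u: "u \<in> ?V" "u < y" using lt ge1 y by (auto simp: u_def)
      have "u \<le> y - 1" using u(2) by linarith
      hence "flags m (y - 1) u = {\<kappa> y}" by (simp only: flags_def if_True u_def add_diff_cancel_left')
      hence "\<kappa> u = \<kappa> y" using PiE_mem[OF K(1) u(1)] by simp
      moreover have "(u, y) \<in> A" using good_area_clique[OF A, of u y] u by simp
      ultimately show "edges_weight (A \<inter> ?V \<times> ?V) \<kappa> = 0"
        using u yV by (intro edges_weight_eq_0[of _ u y]) auto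
    qed
  qed
  finally show ?thesis by (simp add: colour_series_def K_def)
qed

lemma colour_series_support:
  assumes "mcoeff (colour_series V L A) M \<noteq> 0"
  shows "\<exists>\<kappa>. \<kappa> \<in> PiE V L \<and> image_mset \<kappa> (mset_set V) = M"
proof (rule ccontr)
  assume "\<not> ?thesis"
  hence e: "{\<kappa>. \<kappa> \<in> PiE V L \<and> image_mset \<kappa> (mset_set V) = M} = {}" by blast
  from assms show False unfolding colour_series_def mcoeff_Abs e by simp
qed

lemma lincomb_support:
  assumes "mcoeff (lincomb L F) M \<noteq> 0"
  shows "\<exists>c A. (c, A) \<in> set L \<and> mcoeff (F A) M \<noteq> 0"
  using assms by (induction L) (auto, metis add_0 mult_zero_right)

text \<open>Let \<open>f a\<close> be the series in which position \<open>y\<close> has colour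
  \<open>a\<close>, starting from its flagged colour \<open>s = y - m\<close>. Apart from
  \<open>y\<close>, the colours \<open>a \<ge> s\<close> are open only to unflagged positions, all
  of them after \<open>y\<close>. Hence consecutive \<open>f a\<close> are Hecke pairs, and
  \<open>mcoeff_d_minus\<close> turns the operator into their sum.\<close>

lemma d_minus_colour_comb:
  assumes L: "\<And>c A. (c, A) \<in> set L \<Longrightarrow> good_area m y d A" and y: "m < y" "y \<le> d"
  shows "d_minus (y - m) (colour_comb m y d L) = colour_comb m (y - 1) d L"
proof -
  define s where "s = y - m"
  let ?V = "{m<..d}"
  let ?L = "\<lambda>a. (flags m (y - 1))(y := {a})"
  define f where "f = (\<lambda>a. mconst ((1 - tvar) ^ (d - y)) * lincomb L (colour_series ?V (?L a)))"
  have flags: "?L s = flags m y" using y by (auto simp: flags_def s_def fun_eq_iff)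
  have fs: "f s = colour_comb m y d L" unfolding f_def flags colour_comb_def ..
  have supp: "\<exists>\<kappa>. \<kappa> \<in> PiE ?V (flags m y) \<and> image_mset \<kappa> (mset_set ?V) = M" if "mcoeff (f s) M \<noteq> 0" for M
  proof -
    have "mcoeff (lincomb L (colour_series ?V (flags m y))) M \<noteq> 0" using that unfolding f_def flags by auto
    thus ?thesis using lincomb_support colour_series_support by blast
  qed
  have "f s \<in> P_space s"
  proof -
    have "size M \<le> d - m \<and> 0 \<notin># M" if "mcoeff (f s) M \<noteq> 0" for M
    proof -
      from supp[OF that] obtain \<kappa> where \<kappa>: "\<kappa> \<in> PiE ?V (flags m y)" "M = image_mset \<kappa> (mset_set ?V)" by blast
      have "\<kappa> v \<noteq> 0" if "v \<in> ?V" for v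
        using PiE_mem[OF \<kappa>(1) that] that by (auto simp: flags_def split: if_splits)
      hence "0 \<notin> \<kappa> ` ?V" by force
      thus ?thesis unfolding \<kappa>(2) by simp
    qed
    moreover have "mcoeff (f s) (image_mset (swap i) M) = mcoeff (f s) M" if i: "i > s" for i M
    proof -
      have "swap_vars i (colour_series ?V (flags m y) A) = colour_series ?V (flags m y) A" if "(c, A) \<in> set L" for c A
      proof (rule swap_vars_colour_series)
        show "interval_on ?V A" by (rule good_area_interval_on[OF L[OF that]])
        show "i < j" if "(i, j) \<in> A" for i j by (rule good_area_less[OF L[OF \<open>(c, A) \<in> set L\<close>] that])
      qed (use i in \<open>auto simp: flags_def s_def\<close>)
      hence "swap_vars i (f s) = f s" unfolding f_def flags by (auto intro!: swap_vars_lincomb)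
      thus ?thesis by (metis mcoeff_swap)
    qed
    ultimately show ?thesis unfolding P_space_def by blast
  qed
  moreover have "s \<in># M" if "mcoeff (f s) M \<noteq> 0" for M
  proof -
    from supp[OF that] obtain \<kappa> where \<kappa>: "\<kappa> \<in> PiE ?V (flags m y)" "M = image_mset \<kappa> (mset_set ?V)" by blast
    have "y \<in> ?V" using y by auto
    moreover from this have "\<kappa> y = s" using PiE_mem[OF \<kappa>(1), of y] by (simp add: flags_def s_def)
    ultimately show ?thesis unfolding \<kappa>(2) by force
  qed
  moreover have "hecke_pair a (f a) (f (Suc a))" if a: "a \<ge> s" for a
    unfolding f_def
  proof (intro hecke_pair_mconst hecke_pair_lincomb_list)
    fix c A assume cA: "(c, A) \<in> set L"
    show "hecke_pair a (colour_series ?V (?L a) A) (colour_series ?V (?L (Suc a)) A)"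
    proof (rule hecke_pair_colour_series)
      show "interval_on ?V A" by (rule good_area_interval_on[OF L[OF cA]])
      show "i < j" if "(i, j) \<in> A" for i j by (rule good_area_less[OF L[OF cA] that])
      show "a \<in> flags m (y - 1) v \<longleftrightarrow> Suc a \<in> flags m (y - 1) v" if "v \<in> ?V - {y}" for v
        using that a y by (auto simp: flags_def s_def)
      show "y < v" if "v \<in> ?V - {y}" "a \<in> flags m (y - 1) v" for v
        using that a y by (auto simp: flags_def s_def split: if_splits)
    qed (use y in auto)
  qed
  moreover have "s \<ge> 1" using y by (simp add: s_def)
  ultimately have key: "mcoeff (d_minus s (f s)) M = (1 - tvar) * (\<Sum>a=s..N. mcoeff (f a) M)"
    if "set_mset M \<subseteq> {..N}" for M N
    using mcoeff_d_minus[of s f M N] that by blast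
  have "d_minus s (f s) = colour_comb m (y - 1) d L"
  proof (rule mps_eqI)
    fix M :: "nat multiset"
    \<comment> \<open>The inserted \<open>0\<close> covers the empty monomial.\<close>
    define N where "N = Max (insert 0 (set_mset M))"
    have M: "set_mset M \<subseteq> {..N}" by (auto simp: N_def)
    have "(\<Sum>a=s..N. mcoeff (lincomb L (colour_series ?V (?L a))) M) =
          mcoeff (lincomb L (colour_series ?V (flags m (y - 1)))) M"
      using L
    proof (induction L)
      case (Cons x L)
      obtain c A where x: "x = (c, A)" by force
      have "good_area m y d A" using Cons.prems x by auto
      from mcoeff_colour_series_unflag[OF this y M]
      have "(\<Sum>a=s..N. mcoeff (colour_series ?V (?L a) A) M) = mcoeff (colour_series ?V (flags m (y - 1)) A) M"
        unfolding s_def .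
      moreover have "(\<Sum>a=s..N. mcoeff (lincomb L (colour_series ?V (?L a))) M) =
          mcoeff (lincomb L (colour_series ?V (flags m (y - 1)))) M"
        by (rule Cons.IH) (use Cons.prems in auto)
      ultimately show ?case
        by (simp only: x lincomb_simps mcoeff_add mcoeff_mconst_times sum.distrib sum_distrib_left[symmetric])
    qed simp
    hence "(1 - tvar) * (\<Sum>a=s..N. mcoeff (f a) M) = mcoeff (colour_comb m (y - 1) d L) M"
      using y by (simp add: f_def colour_comb_def Suc_diff_le flip: sum_distrib_left)
    thus "mcoeff (d_minus s (f s)) M = mcoeff (colour_comb m (y - 1) d L) M" using key[OF M] by simp
  qed
  thus ?thesis unfolding fs unfolding s_def .
qed

text \<open>Column \<open>m\<close> with height \<open>y\<close> and with height
  \<open>y - 1\<close>: the two orders of the north and the east step around the box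
  \<open>(m, y)\<close>. Both are read at the point \<open>(m - 1, y - 1)\<close> behind the
  corner.\<close>

definition corner_list ::
    "nat \<Rightarrow> nat \<Rightarrow> (ff \<times> (nat \<times> nat) set) list \<Rightarrow> (ff \<times> (nat \<times> nat) set) list" where
  "corner_list m y L =
     map (\<lambda>(c, A). (1 / (inverse tvar - 1) * c, add_column m y A)) L @
     map (\<lambda>(c, A). (- 1 / (inverse tvar - 1) * c, add_column m (y - 1) A)) L"

lemma corner_op_colour_comb:
  assumes L: "\<And>c A. (c, A) \<in> set L \<Longrightarrow> good_area m y d A" and m: "m \<ge> 1" and y: "m < y" "y \<le> d"
  shows "corner_op (y - m) (colour_comb m y d L) = colour_comb (m - 1) (y - 1) d (corner_list m y L)"
proof -
  let ?L1 = "map (\<lambda>(c, A). (c, add_column m y A)) L"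
  let ?L2 = "map (\<lambda>(c, A). (c, add_column m (y - 1) A)) L"
  have "good_area (m - 1) y d A" if "(c, A) \<in> set ?L1" for c A
    using that good_area_add_column[OF L m y(2)] by auto
  hence "d_minus (y - (m - 1)) (colour_comb (m - 1) y d ?L1) = colour_comb (m - 1) (y - 1) d ?L1"
    using m y by (intro d_minus_colour_comb) auto
  moreover have "y - (m - 1) = Suc (y - m)" using m y by auto
  moreover have "east_op (y - m) (colour_comb m y d L) = colour_comb (m - 1) y d ?L1"
    by (rule east_op_colour_comb) (use L m y in auto)
  ultimately have 1: "d_minus (Suc (y - m)) (east_op (y - m) (colour_comb m y d L)) = colour_comb (m - 1) (y - 1) d ?L1"
    by (simp only:)
  have "good_area m (y - 1) d A" if "(c, A) \<in> set L" for c A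
    by (rule good_area_lower_flag[OF L[OF that]]) simp
  hence "east_op (y - 1 - m) (colour_comb m (y - 1) d L) = colour_comb (m - 1) (y - 1) d ?L2"
    using m y by (intro east_op_colour_comb) auto
  moreover have "y - 1 - m = y - m - 1" by simp
  moreover have "d_minus (y - m) (colour_comb m y d L) = colour_comb m (y - 1) d L"
    by (rule d_minus_colour_comb) (use L y in auto)
  ultimately have 2: "east_op (y - m - 1) (d_minus (y - m) (colour_comb m y d L)) = colour_comb (m - 1) (y - 1) d ?L2"
    by (simp only:)
  define b where "b = 1 / (inverse tvar - 1)"
  have c: "corner_list m y L = map (\<lambda>(c, A). (b * c, add_column m y A)) L @ map (\<lambda>(c, A). (- b * c, add_column m (y - 1) A)) L"
    by (simp add: corner_list_def b_def)
  have l1: "lincomb ?L1 F = lincomb L (\<lambda>A. F (add_column m y A))" for F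
    using lincomb_map[of 1 "add_column m y" L F] by simp
  have l2: "lincomb ?L2 F = lincomb L (\<lambda>A. F (add_column m (y - 1) A))" for F
    using lincomb_map[of 1 "add_column m (y - 1)" L F] by simp
  show ?thesis
    unfolding corner_op_def 1 2 unfolding colour_comb_def c lincomb_simps lincomb_map l1 l2 b_def[symmetric]
    by (simp add: mconst_uminus algebra_simps)
qed

section \<open>Traversing the path\<close>

text \<open>The value of a combination on a single word. Combinations are compared with the marking
  word by word; no single edge set could serve, as its weight is never 0 while the indicator of a
  marked pair may be.\<close>

definition word_weight :: "(ff \<times> (nat \<times> nat) set) list \<Rightarrow> (nat \<Rightarrow> letter) \<Rightarrow> ff" where
  "word_weight L T = (\<Sum>(c, A)\<leftarrow>L. c * inverse tvar ^ inversions A T)"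

lemma word_weight_simps [simp]:
  "word_weight [] T = 0" "word_weight ((c, A) # L) T = c * inverse tvar ^ inversions A T + word_weight L T"
  "word_weight (L @ L') T = word_weight L T + word_weight L' T"
  by (simp_all add: word_weight_def)

definition column_inversions :: "nat \<Rightarrow> nat \<Rightarrow> (nat \<Rightarrow> letter) \<Rightarrow> nat" where
  "column_inversions m y T = card {j \<in> {m<..y}. column_decreasing (T j) (T m)}"

lemma inversions_add_column:
  assumes "finite A" "\<And>i j. (i, j) \<in> A \<Longrightarrow> m < i"
  shows "inversions (add_column m y A) T = inversions A T + column_inversions m y T"
proof -
  have "{(i, j) \<in> add_column m y A. column_decreasing (T j) (T i)} =
    {(i, j) \<in> A. column_decreasing (T j) (T i)} \<union> Pair m ` {j \<in> {m<..y}. column_decreasing (T j) (T m)}"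
    by (auto simp: add_column_def)
  moreover have "{(i, j) \<in> A. column_decreasing (T j) (T i)} \<inter> Pair m ` {j \<in> {m<..y}. column_decreasing (T j) (T m)} = {}"
    using assms(2) by blast
  moreover have "finite {(i, j) \<in> A. column_decreasing (T j) (T i)}"
    using assms(1) by (rule finite_subset[rotated]) auto
  ultimately show ?thesis
    by (simp add: inversions_def column_inversions_def card_Un_disjoint card_image inj_on_def)
qed

lemma word_weight_add_column:
  assumes "\<And>c A. (c, A) \<in> set L \<Longrightarrow> good_area m y' d A"
  shows "word_weight (map (\<lambda>(c, A). (b * c, add_column m y A)) L) T =
         b * inverse tvar ^ column_inversions m y T * word_weight L T"
  using assms
proof (induction L)
  case (Cons x L)
  obtain c A where x: "x = (c, A)" by force
  have A: "good_area m y' d A" using Cons.prems x by auto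
  have "inversions (add_column m y A) T = inversions A T + column_inversions m y T"
    using good_area_finite[OF A] good_area_bounds[OF A] by (intro inversions_add_column) auto
  thus ?case using Cons by (auto simp: x power_add algebra_simps)
qed simp

lemma column_inversions_top:
  assumes "m < y"
  shows "column_inversions m y T = column_inversions m (y - 1) T + (if column_decreasing (T y) (T m) then 1 else 0)"
proof -
  have "{m<..y} = insert y {m<..y - 1}" using assms by auto
  moreover define K where "K = {j \<in> {m<..y - 1}. column_decreasing (T j) (T m)}"
  ultimately have "{j \<in> {m<..y}. column_decreasing (T j) (T m)} =
    (if column_decreasing (T y) (T m) then insert y K else K)" by auto
  moreover have "y \<notin> K" "finite K" using assms by (auto simp: K_def)
  ultimately show ?thesis unfolding column_inversions_def K_def[symmetric] by simp
qed

lemma inverse_tvar_neq_1: "inverse tvar - 1 \<noteq> 0"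
  by (simp add: inverse_eq_1_iff)

lemma word_weight_corner_list:
  assumes L: "\<And>c A. (c, A) \<in> set L \<Longrightarrow> good_area m y d A" and y: "m < y"
  shows "word_weight (corner_list m y L) T =
    (if column_decreasing (T y) (T m) then inverse tvar ^ column_inversions m (y - 1) T * word_weight L T else 0)"
proof -
  define z where "z = inverse tvar ^ column_inversions m (y - 1) T * word_weight L T"
  have 1: "word_weight (corner_list m y L) T =
    1 / (inverse tvar - 1) * inverse tvar ^ column_inversions m y T * word_weight L T +
    - 1 / (inverse tvar - 1) * inverse tvar ^ column_inversions m (y - 1) T * word_weight L T"
    unfolding corner_list_def word_weight_simps
    using word_weight_add_column[of L m y d] L by metis
  show ?thesis
  proof (cases "column_decreasing (T y) (T m)")
    case True
    define b where "b = 1 / (inverse tvar - 1)"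
    have b': "- 1 / (inverse tvar - 1) = - b" by (simp add: b_def)
    have "word_weight (corner_list m y L) T = b * (inverse tvar - 1) * z"
      unfolding 1 column_inversions_top[OF y] z_def b' unfolding b_def[symmetric]
      using True by (simp add: algebra_simps)
    also have "b * (inverse tvar - 1) = 1" using inverse_tvar_neq_1 by (simp add: b_def)
    finally show ?thesis using True by (simp add: z_def)
  next
    case False
    thus ?thesis unfolding 1 column_inversions_top[OF y] by simp
  qed
qed

section \<open>Coordinates of the path; boxes by column\<close>

lemma xcoord_0 [simp]: "xcoord \<pi> 0 = 0" and ycoord_0 [simp]: "ycoord r \<pi> 0 = r"
  by (simp_all add: xcoord_def ycoord_def)

lemma coord_Suc:
  assumes "k < length \<pi>"
  shows "xcoord \<pi> (Suc k) = (if \<pi> ! k = East then Suc (xcoord \<pi> k) else xcoord \<pi> k)"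
    and "ycoord r \<pi> (Suc k) = (if \<pi> ! k = North then Suc (ycoord r \<pi> k) else ycoord r \<pi> k)"
  using assms by (auto simp: xcoord_def ycoord_def take_Suc_conv_app_nth)

lemma xcoord_mono: "k \<le> l \<Longrightarrow> l \<le> length \<pi> \<Longrightarrow> xcoord \<pi> k \<le> xcoord \<pi> l"
proof (induction rule: dec_induct)
  case (step l)
  thus ?case using coord_Suc(1)[of l \<pi>] by (auto split: if_splits)
qed simp

lemma ycoord_mono: "k \<le> l \<Longrightarrow> l \<le> length \<pi> \<Longrightarrow> ycoord r \<pi> k \<le> ycoord r \<pi> l"
proof (induction rule: dec_induct)
  case (step l)
  thus ?case using coord_Suc(2)[of l \<pi> r] by (auto split: if_splits)
qed simp

text \<open>The abscissa never decreases and grows at an east step, so each column has only one. Any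
  witness may therefore be used in \<open>below_iff\<close> and \<open>above_iff\<close>.\<close>

lemma east_step_unique:
  assumes "k < length \<pi>" "l < length \<pi>" "\<pi> ! k = East" "\<pi> ! l = East" "xcoord \<pi> k = xcoord \<pi> l"
  shows "k = l"
proof -
  have F: False if "k < l" "l < length \<pi>" "\<pi> ! k = East" "xcoord \<pi> k = xcoord \<pi> l" for k l
    using that xcoord_mono[of "Suc k" l \<pi>] coord_Suc(1)[of k \<pi>] by auto
  show ?thesis
    using F[of k l] F[of l k] assms by (metis linorder_neqE_nat)
qed

lemma below_iff:
  assumes "k < length \<pi>" "\<pi> ! k = East"
  shows "below r \<pi> (Suc (xcoord \<pi> k), j) \<longleftrightarrow> 1 \<le> j \<and> j \<le> ycoord r \<pi> k"
  unfolding below_def using assms east_step_unique[OF _ assms(1) _ assms(2)] by auto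

lemma above_iff:
  assumes "k < length \<pi>" "\<pi> ! k = East"
  shows "above r \<pi> (Suc (xcoord \<pi> k), j) \<longleftrightarrow> ycoord r \<pi> k < j"
  unfolding above_def using assms east_step_unique[OF _ assms(1) _ assms(2)] by auto

text \<open>The box is above the east step of its column and its south neighbour is not, so it rests
  on that step: a column has at most one corner.\<close>

lemma corner_in_column:
  assumes "k < length \<pi>" "\<pi> ! k = East" "(Suc (xcoord \<pi> k), j) \<in> corners r \<pi>"
  shows "j = Suc (ycoord r \<pi> k)" "below r \<pi> (Suc (Suc (xcoord \<pi> k)), j)"
  using assms below_iff[OF assms(1,2)] above_iff[OF assms(1,2)] by (auto simp: corners_def)

text \<open>The east neighbour must be below the path, so a corner never lies in the last
  column.\<close>

lemma corner_column_bounds: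
  assumes "(i, j) \<in> corners r \<pi>"
  shows "0 < i" "i < xcoord \<pi> (length \<pi>)"
proof -
  show "0 < i" using assms by (auto simp: corners_def above_def)
  from assms obtain k where k: "k < length \<pi>" "\<pi> ! k = East" "xcoord \<pi> k = i"
    by (auto simp: corners_def below_def)
  have "Suc (xcoord \<pi> k) \<le> xcoord \<pi> (length \<pi>)"
    using k xcoord_mono[of "Suc k" "length \<pi>" \<pi>] coord_Suc(1)[of k \<pi>] by auto
  thus "i < xcoord \<pi> (length \<pi>)" using k by simp
qed

lemma Area_column_bounds:
  assumes "(i, j) \<in> Area r \<pi>"
  shows "0 < i" "i \<le> xcoord \<pi> (length \<pi>)"
proof -
  from assms obtain k where k: "k < length \<pi>" "\<pi> ! k = East" "Suc (xcoord \<pi> k) = i"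
    by (auto simp: Area_def below_def)
  thus "0 < i" "i \<le> xcoord \<pi> (length \<pi>)"
    using xcoord_mono[of "Suc k" "length \<pi>" \<pi>] coord_Suc(1)[of k \<pi>] by auto
qed

section \<open>Areas, inversions and markings right of a column\<close>

definition area_right :: "nat \<Rightarrow> path \<Rightarrow> nat \<Rightarrow> (nat \<times> nat) set" where
  "area_right r \<pi> m = {(i, j) \<in> Area r \<pi>. m < i}"

text \<open>The value that \<open>word_weight\<close> must have once the columns right of
  \<open>m\<close> are traversed: marked pairs enter as an indicator, area boxes as a power of
  \<open>t\<close>.\<close>

definition weight_right :: "nat \<Rightarrow> path \<Rightarrow> box set \<Rightarrow> nat \<Rightarrow> (nat \<Rightarrow> letter) \<Rightarrow> ff" where
  "weight_right r \<pi> S m T =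
     (if \<forall>(i, j)\<in>S. m < i \<longrightarrow> column_decreasing (T j) (T i) then inverse tvar ^ inversions (area_right r \<pi> m) T else 0)"

lemma area_right_step:
  assumes "k < length \<pi>" "\<pi> ! k = East"
  shows "area_right r \<pi> (xcoord \<pi> k) = add_column (Suc (xcoord \<pi> k)) (ycoord r \<pi> k) (area_right r \<pi> (Suc (xcoord \<pi> k)))"
proof -
  have a: "(Suc (xcoord \<pi> k), j) \<in> Area r \<pi> \<longleftrightarrow> j \<in> {Suc (xcoord \<pi> k)<..ycoord r \<pi> k}" for j
    unfolding Area_def using below_iff[OF assms] by auto
  have b: "xcoord \<pi> k < i \<longleftrightarrow> i = Suc (xcoord \<pi> k) \<or> Suc (xcoord \<pi> k) < i" for i by auto
  have c: "(i, j) \<in> Pair m ` X \<longleftrightarrow> i = m \<and> j \<in> X" for i j m :: nat and X by auto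
  show ?thesis
    unfolding set_eq_iff split_paired_All area_right_def add_column_def mem_Collect_eq prod.case Un_iff b c
    using a by blast
qed

lemma finite_area_right: "finite (area_right r \<pi> m)"
proof (rule finite_subset)
  show "area_right r \<pi> m \<subseteq> {..xcoord \<pi> (length \<pi>)} \<times> {..ycoord r \<pi> (length \<pi>)}"
  proof clarify
    fix i j assume "(i, j) \<in> area_right r \<pi> m"
    hence A: "(i, j) \<in> Area r \<pi>" by (simp add: area_right_def)
    then obtain k where "k < length \<pi>" "j \<le> ycoord r \<pi> k" by (auto simp: Area_def below_def)
    hence "j \<le> ycoord r \<pi> (length \<pi>)" using ycoord_mono[of k "length \<pi>" \<pi> r] by auto
    thus "i \<in> {..xcoord \<pi> (length \<pi>)} \<and> j \<in> {..ycoord r \<pi> (length \<pi>)}"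
      using Area_column_bounds[OF A] by auto
  qed
qed simp

lemma inversions_area_right_step:
  assumes "k < length \<pi>" "\<pi> ! k = East"
  shows "inversions (area_right r \<pi> (xcoord \<pi> k)) T =
    inversions (area_right r \<pi> (Suc (xcoord \<pi> k))) T + column_inversions (Suc (xcoord \<pi> k)) (ycoord r \<pi> k) T"
  unfolding area_right_step[OF assms]
  by (rule inversions_add_column[OF finite_area_right]) (auto simp: area_right_def)

lemma weight_right_step_unmarked:
  assumes "k < length \<pi>" "\<pi> ! k = East" "\<And>j. (Suc (xcoord \<pi> k), j) \<notin> S"
  shows "weight_right r \<pi> S (xcoord \<pi> k) T =
    inverse tvar ^ column_inversions (Suc (xcoord \<pi> k)) (ycoord r \<pi> k) T * weight_right r \<pi> S (Suc (xcoord \<pi> k)) T"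
proof -
  have "xcoord \<pi> k < i \<longleftrightarrow> Suc (xcoord \<pi> k) < i" if "(i, j) \<in> S" for i j
    using that assms(3) by (metis Suc_lessI Suc_lessD)
  hence "(\<forall>(i, j)\<in>S. xcoord \<pi> k < i \<longrightarrow> column_decreasing (T j) (T i)) \<longleftrightarrow>
         (\<forall>(i, j)\<in>S. Suc (xcoord \<pi> k) < i \<longrightarrow> column_decreasing (T j) (T i))" by blast
  thus ?thesis unfolding weight_right_def inversions_area_right_step[OF assms(1,2)]
    by (simp add: power_add)
qed

lemma weight_right_step_marked:
  assumes "k < length \<pi>" "\<pi> ! k = East" "\<And>j. (Suc (xcoord \<pi> k), j) \<in> S \<longleftrightarrow> j = y"
  shows "weight_right r \<pi> S (xcoord \<pi> k) T =
    (if column_decreasing (T y) (T (Suc (xcoord \<pi> k)))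
     then inverse tvar ^ column_inversions (Suc (xcoord \<pi> k)) (ycoord r \<pi> k) T * weight_right r \<pi> S (Suc (xcoord \<pi> k)) T
     else 0)"
proof -
  let ?m = "Suc (xcoord \<pi> k)"
  have "(\<forall>(i, j)\<in>S. xcoord \<pi> k < i \<longrightarrow> column_decreasing (T j) (T i)) \<longleftrightarrow>
         column_decreasing (T y) (T ?m) \<and> (\<forall>(i, j)\<in>S. ?m < i \<longrightarrow> column_decreasing (T j) (T i))"
    (is "?A \<longleftrightarrow> ?B \<and> ?C")
  proof (intro iffI conjI)
    assume A: ?A
    have "(?m, y) \<in> S" using assms(3) by simp
    from bspec[OF A this] show ?B by simp
    show ?C using A by fastforce
  next
    assume BC: "?B \<and> ?C"
    show ?A
    proof clarify
      fix i j assume ij: "(i, j) \<in> S" "xcoord \<pi> k < i"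
      show "column_decreasing (T j) (T i)"
      proof (cases "i = ?m")
        case True
        hence "j = y" using ij(1) assms(3) by simp
        thus ?thesis using True BC by simp
      next
        case False
        hence "?m < i" using ij(2) by simp
        thus ?thesis using bspec[of S _ "(i, j)"] BC ij(1) by fastforce
      qed
    qed
  qed
  thus ?thesis unfolding weight_right_def inversions_area_right_step[OF assms(1,2)]
    by (simp add: power_add)
qed

section \<open>Back to super words, and the induction along the path\<close>

lemma finite_column_super_words:
  "finite {T. T \<in> column_super_words r d S \<and> word_monomial d T = M}"
proof (rule finite_subset)
  show "{T. T \<in> column_super_words r d S \<and> word_monomial d T = M} \<subseteq> PiE {1..d} (\<lambda>_. Pos ` set_mset M \<union> Neg ` set_mset M)"
  proof clarify
    fix T assume T: "T \<in> column_super_words r d S" "M = word_monomial d T"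
    have "T i \<in> Pos ` set_mset M \<union> Neg ` set_mset M" if "i \<in> {1..d}" for i
    proof -
      have "letter_abs (T i) \<in># M" unfolding T(2) word_monomial_def using that by auto
      thus ?thesis by (cases "T i") auto
    qed
    thus "T \<in> PiE {1..d} (\<lambda>_. Pos ` set_mset (word_monomial d T) \<union> Neg ` set_mset (word_monomial d T))"
      using T by (auto simp: column_super_words_def PiE_iff)
  qed
qed (auto intro: finite_PiE)

text \<open>The words are summed without the marking, for each edge set separately; the marking
  comes back through \<open>word_weight\<close>, which vanishes on the words that violate
  it.\<close>

lemma colour_comb_eq_G_col:
  assumes L: "\<And>c A. (c, A) \<in> set L \<Longrightarrow> good_area 0 r d A" and r: "r \<le> d"
    and S: "\<And>i j. (i, j) \<in> S \<Longrightarrow> 0 < i"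
    and w: "\<And>T. word_weight L T = weight_right r \<pi> S 0 T"
  shows "colour_comb 0 r d L = G_col r d \<pi> S (inverse tvar)"
proof (rule mps_eqI)
  fix M
  let ?W = "\<lambda>S. {T. T \<in> column_super_words r d S \<and> word_monomial d T = M}"
  have area: "area_right r \<pi> 0 = Area r \<pi>"
    using Area_column_bounds(1) by (auto simp: area_right_def)
  have "mcoeff (colour_comb 0 r d L) M =
    (\<Sum>(c, A)\<leftarrow>L. c * ((1 - tvar) ^ (d - r) * mcoeff (colour_series {0<..d} (flags 0 r) A) M))"
    unfolding colour_comb_def mult_lincomb mcoeff_lincomb by simp
  also have "\<dots> = (\<Sum>(c, A)\<leftarrow>L. c * (\<Sum>T\<in>?W {}. inverse tvar ^ inversions A T * (- tvar) ^ num_negative d T))"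
    using sum_column_super_words[OF L r] by (intro arg_cong[of _ _ sum_list] map_cong) auto
  also have "\<dots> = (\<Sum>T\<in>?W {}. word_weight L T * (- tvar) ^ num_negative d T)"
  proof (induction L)
    case (Cons x L)
    thus ?case by (cases x) (simp add: algebra_simps sum.distrib sum_distrib_left)
  qed simp
  also have "\<dots> = (\<Sum>T\<in>?W {}. if \<forall>(i, j)\<in>S. column_decreasing (T j) (T i)
      then inverse tvar ^ inversions (Area r \<pi>) T * (- tvar) ^ num_negative d T else 0)"
  proof (rule sum.cong[OF refl])
    fix T
    have "(\<forall>(i, j)\<in>S. 0 < i \<longrightarrow> column_decreasing (T j) (T i)) \<longleftrightarrow> (\<forall>(i, j)\<in>S. column_decreasing (T j) (T i))"
      unfolding Ball_def split_paired_All prod.case using S by blast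
    thus "word_weight L T * (- tvar) ^ num_negative d T = (if \<forall>(i, j)\<in>S. column_decreasing (T j) (T i)
      then inverse tvar ^ inversions (Area r \<pi>) T * (- tvar) ^ num_negative d T else 0)"
      unfolding w weight_right_def area by simp
  qed
  also have "\<dots> = (\<Sum>T\<in>{T \<in> ?W {}. \<forall>(i, j)\<in>S. column_decreasing (T j) (T i)}.
      inverse tvar ^ inversions (Area r \<pi>) T * (- tvar) ^ num_negative d T)"
    by (rule sum.inter_filter[OF finite_column_super_words, symmetric])
  also have "{T \<in> ?W {}. \<forall>(i, j)\<in>S. column_decreasing (T j) (T i)} = ?W S"
    by (auto simp: column_super_words_def)
  also have "(\<Sum>T\<in>?W S. inverse tvar ^ inversions (Area r \<pi>) T * (- tvar) ^ num_negative d T) =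
    mcoeff (G_col r d \<pi> S (inverse tvar)) M"
    by (simp add: G_col_def inv_tilde_def inversions_def power_int_minus inverse_minus_eq power_inverse
             flip: inverse_minus_eq)
  finally show "mcoeff (colour_comb 0 r d L) M = mcoeff (G_col r d \<pi> S (inverse tvar)) M" .
qed

text \<open>A corner would rest on step \<open>k\<close>, and its east neighbour would lie above the
  next step, which has the same height.\<close>

lemma no_corner_after_east:
  assumes "Suc k < length \<pi>" "\<pi> ! k = East" "\<pi> ! Suc k = East"
  shows "(xcoord \<pi> (Suc k), j) \<notin> corners r \<pi>"
proof
  assume *: "(xcoord \<pi> (Suc k), j) \<in> corners r \<pi>"
  have k: "k < length \<pi>" using assms by simp
  have x: "xcoord \<pi> (Suc k) = Suc (xcoord \<pi> k)" and y: "ycoord r \<pi> (Suc k) = ycoord r \<pi> k"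
    using coord_Suc[OF k] assms by auto
  have "j = Suc (ycoord r \<pi> k)" "below r \<pi> (Suc (xcoord \<pi> (Suc k)), j)"
    using corner_in_column[OF k assms(2)] * unfolding x by auto
  thus False using below_iff[OF assms(1,3)] y by simp
qed

text \<open>A marked corner consumes two steps at once, hence the strong induction. The last
  hypothesis says that an east step about to be treated by itself lies in an unmarked column; in a
  marked column it is consumed together with the north step that follows it on the path.\<close>

lemma traverse_eq_G_col:
  assumes \<pi>: "\<pi> \<in> Dyck_paths r d" and S: "S \<subseteq> corners r \<pi>"
    and n: "n \<le> length \<pi>"
    and L: "\<And>c A. (c, A) \<in> set L \<Longrightarrow> good_area (xcoord \<pi> n) (ycoord r \<pi> n) d A"
    and w: "\<And>T. word_weight L T = weight_right r \<pi> S (xcoord \<pi> n) T"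
    and marks: "\<And>j k. n = Suc k \<Longrightarrow> \<pi> ! k = East \<Longrightarrow> (xcoord \<pi> n, j) \<notin> S"
  shows "traverse d S (d - xcoord \<pi> n) (d - ycoord r \<pi> n) (rev (take n \<pi>))
           (colour_comb (xcoord \<pi> n) (ycoord r \<pi> n) d L) = G_col r d \<pi> S (inverse tvar)"
  using n L w marks
proof (induction n arbitrary: L rule: less_induct)
  case (less n)
  have xy: "xcoord \<pi> k \<le> ycoord r \<pi> k" and yd: "ycoord r \<pi> k \<le> d" if "k \<le> length \<pi>" for k
    using \<pi> that ycoord_mono[of k "length \<pi>" \<pi> r] by (auto simp: Dyck_paths_def)
  show ?case
  proof (cases n)
    case 0
    have "colour_comb 0 r d L = G_col r d \<pi> S (inverse tvar)"
    proof (rule colour_comb_eq_G_col)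
      show "good_area 0 r d A" if "(c, A) \<in> set L" for c A using less.prems(2)[OF that] 0 by simp
      show "r \<le> d" using yd[of 0] by simp
      show "0 < i" if "(i, j) \<in> S" for i j using corner_column_bounds(1) S that by blast
      show "word_weight L T = weight_right r \<pi> S 0 T" for T using less.prems(3) 0 by simp
    qed
    thus ?thesis using 0 by simp
  next
    case (Suc k)
    define m y where "m = xcoord \<pi> n" and "y = ycoord r \<pi> n"
    have k: "k < length \<pi>" using less.prems(1) Suc by simp
    have my: "m \<le> y" "y \<le> d" using xy[OF less.prems(1)] yd[OF less.prems(1)] by (auto simp: m_def y_def)
    have good: "good_area m y d A" if "(c, A) \<in> set L" for c A
      using less.prems(2)[OF that] by (simp add: m_def y_def)
    have weight: "word_weight L T = weight_right r \<pi> S m T" for T using less.prems(3) by (simp add: m_def)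
    \<comment> \<open>\<open>h - v\<close> is the height of the point over the diagonal; the second
      form is the one left by simplification.\<close>
    have s: "(d - m) - (d - y) = y - m" "d - (m + (d - y)) = y - m" using my by auto
    have rev: "rev (take (Suc k) \<pi>) = \<pi> ! k # rev (take k \<pi>)" using k by (simp add: take_Suc_conv_app_nth)
    show ?thesis
    proof (cases "\<pi> ! k")
      case East
      have x: "m = Suc (xcoord \<pi> k)" and yk: "ycoord r \<pi> k = y"
        using coord_Suc[OF k] East Suc by (auto simp: m_def y_def)
      have unmarked: "(m, j) \<notin> S" for j using less.prems(4)[OF Suc East] by (simp add: m_def)
      let ?L = "map (\<lambda>(c, A). (c, add_column m y A)) L"
      have "traverse d S (d - xcoord \<pi> k) (d - ycoord r \<pi> k) (rev (take k \<pi>))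
             (colour_comb (xcoord \<pi> k) (ycoord r \<pi> k) d ?L) = G_col r d \<pi> S (inverse tvar)"
      proof (rule less.IH)
        show "good_area (xcoord \<pi> k) (ycoord r \<pi> k) d A" if "(c, A) \<in> set ?L" for c A
          using that good_area_add_column[OF good] x yk my by auto
        have "word_weight ?L T = inverse tvar ^ column_inversions m y T * word_weight L T" for T
          using word_weight_add_column[of L m y d 1 y T] good by simp
        thus "word_weight ?L T = weight_right r \<pi> S (xcoord \<pi> k) T" for T
          using weight_right_step_unmarked[OF k East] unmarked weight x yk by simp
        \<comment> \<open>Restores the hypothesis on marks: two east steps in a row leave no corner
          on the first.\<close>
        show "(xcoord \<pi> k, j) \<notin> S" if "k = Suc l" "\<pi> ! l = East" for j l
          using no_corner_after_east[of l \<pi> j r] k East that S by blast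
      qed (use k Suc in auto)
      moreover have "east_op (y - m) (colour_comb m y d L) = colour_comb (xcoord \<pi> k) (ycoord r \<pi> k) d ?L"
        using east_op_colour_comb[of L m y d] good my x yk by simp
      moreover have "Suc (d - m) = d - xcoord \<pi> k" using x my by auto
      ultimately show ?thesis
        unfolding m_def[symmetric] y_def[symmetric] unfolding Suc rev East by (simp add: s yk)
    next
      case North
      have x: "xcoord \<pi> k = m" and yk: "y = Suc (ycoord r \<pi> k)"
        using coord_Suc[OF k] North Suc by (auto simp: m_def y_def)
      have lt: "m < y" using xy[of k] k x yk by simp
      have v: "Suc (d - y) = d - ycoord r \<pi> k" using my yk by auto
      have IH: "traverse d S (d - m) (Suc (d - y)) (rev (take k \<pi>)) (d_minus (y - m) (colour_comb m y d L)) =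
          G_col r d \<pi> S (inverse tvar)" if "\<And>j l. k = Suc l \<Longrightarrow> \<pi> ! l = East \<Longrightarrow> (m, j) \<notin> S"
      proof -
        have "d_minus (y - m) (colour_comb m y d L) = colour_comb (xcoord \<pi> k) (ycoord r \<pi> k) d L"
          using d_minus_colour_comb[of L m y d] good lt my x yk by simp
        moreover have "traverse d S (d - xcoord \<pi> k) (d - ycoord r \<pi> k) (rev (take k \<pi>))
             (colour_comb (xcoord \<pi> k) (ycoord r \<pi> k) d L) = G_col r d \<pi> S (inverse tvar)"
        proof (rule less.IH)
          show "good_area (xcoord \<pi> k) (ycoord r \<pi> k) d A" if "(c, A) \<in> set L" for c A
            using good_area_lower_flag[OF good[OF that]] x yk by simp
        qed (use k Suc x weight that in auto)
        ultimately show ?thesis by (simp add: x v)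
      qed
      show ?thesis
      proof (cases k)
        case 0
        thus ?thesis using IH North
          unfolding m_def[symmetric] y_def[symmetric] unfolding Suc rev by (simp add: s)
      next
        case (Suc l)
        have l: "l < length \<pi>" using k Suc by simp
        have rev': "rev (take k \<pi>) = \<pi> ! l # rev (take l \<pi>)" using l Suc by (simp add: take_Suc_conv_app_nth)
        show ?thesis
        proof (cases "\<pi> ! l")
          case North': North
          hence "traverse d S (d - m) (d - y) (North # rev (take k \<pi>)) (colour_comb m y d L) =
            traverse d S (d - m) (Suc (d - y)) (rev (take k \<pi>)) (d_minus (y - m) (colour_comb m y d L))"
            unfolding rev' by (simp add: s)
          also have "\<dots> = G_col r d \<pi> S (inverse tvar)" by (rule IH) (use Suc North' in auto)
          finally show ?thesis
            unfolding m_def[symmetric] y_def[symmetric] unfolding \<open>n = Suc k\<close> rev North .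
        next
          case East
          have xl: "m = Suc (xcoord \<pi> l)" and yl: "ycoord r \<pi> l = y - 1"
            using coord_Suc[OF l] East Suc x yk by auto
          \<comment> \<open>The corner of column \<open>m\<close> rests on the east step
            \<open>l\<close>, which has height \<open>y - 1\<close>.\<close>
          have corner: "j = y" if "(m, j) \<in> S" for j
            using corner_in_column(1)[OF l East, of j r] that S xl yl lt by auto
          have point: "(d - (d - m), d - (d - y)) = (m, y)" using my by auto
          show ?thesis
          proof (cases "(m, y) \<in> S")
            case False
            hence "traverse d S (d - m) (d - y) (North # rev (take k \<pi>)) (colour_comb m y d L) =
              traverse d S (d - m) (Suc (d - y)) (rev (take k \<pi>)) (d_minus (y - m) (colour_comb m y d L))"
              unfolding rev' East traverse.simps(3) point s by simp
            also have "\<dots> = G_col r d \<pi> S (inverse tvar)" by (rule IH) (use False corner in blast)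
            finally show ?thesis
              unfolding m_def[symmetric] y_def[symmetric] unfolding \<open>n = Suc k\<close> rev North .
          next
            case True
            have "traverse d S (d - xcoord \<pi> l) (d - ycoord r \<pi> l) (rev (take l \<pi>))
              (colour_comb (xcoord \<pi> l) (ycoord r \<pi> l) d (corner_list m y L)) = G_col r d \<pi> S (inverse tvar)"
            proof (rule less.IH)
              show "good_area (xcoord \<pi> l) (ycoord r \<pi> l) d A" if cA: "(c, A) \<in> set (corner_list m y L)" for c A
              proof -
                from cA obtain B where B: "good_area m y d B"
                  and A: "A = add_column m y B \<or> A = add_column m (y - 1) B"
                  unfolding corner_list_def using good by auto
                have "good_area (m - 1) y d (add_column m y B)"
                  using good_area_add_column[OF B] xl my by simp
                hence "good_area (m - 1) (y - 1) d (add_column m y B)" by (rule good_area_lower_flag) simp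
                moreover have "good_area (m - 1) (y - 1) d (add_column m (y - 1) B)"
                  using good_area_add_column[OF good_area_lower_flag[OF B, of "y - 1"]] xl my by simp
                ultimately show ?thesis using A xl yl by auto
              qed
              have "(Suc (xcoord \<pi> l), j) \<in> S \<longleftrightarrow> j = y" for j
                unfolding xl[symmetric] using corner True by blast
              thus "word_weight (corner_list m y L) T = weight_right r \<pi> S (xcoord \<pi> l) T" for T
                using word_weight_corner_list[of L m y d T] weight_right_step_marked[OF l East] good lt weight xl yl by simp
              show "(xcoord \<pi> l, j) \<notin> S" if "l = Suc l'" "\<pi> ! l' = East" for j l'
                using no_corner_after_east[of l' \<pi> j r] l East that S by blast
            qed (use l Suc \<open>n = Suc k\<close> in auto)
            moreover have "corner_op (y - m) (colour_comb m y d L) =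
                colour_comb (xcoord \<pi> l) (ycoord r \<pi> l) d (corner_list m y L)"
              using corner_op_colour_comb[of L m y d] good lt my xl yl by simp
            moreover have "Suc (d - m) = d - xcoord \<pi> l" "Suc (d - y) = d - ycoord r \<pi> l"
              using xl yl my lt by auto
            ultimately show ?thesis
              using True unfolding m_def[symmetric] y_def[symmetric] unfolding \<open>n = Suc k\<close> rev rev' North East traverse.simps(3) point s
              by simp
          qed
        qed
      qed
    qed
  qed
qed

theorem theorem5p19:
  fixes r d :: nat and \<pi> :: path and S :: "box set"
  assumes "\<pi> \<in> Dyck_paths r d"
    and "is_marking r \<pi> S"
  shows "G_col r d \<pi> S (inverse tvar) = chi_tilde d \<pi> S"
proof -
  let ?n = "length \<pi>"
  have n: "xcoord \<pi> ?n = d" "ycoord r \<pi> ?n = d" using assms(1) by (auto simp: Dyck_paths_def)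
  have S: "S \<subseteq> corners r \<pi>" using assms(2) by (simp add: is_marking_def)
  have bound: "i < d" if "(i, j) \<in> S" for i j
    using corner_column_bounds(2) S that n by fastforce
  \<comment> \<open>At \<open>(d, d)\<close> no position is left, and the empty colouring gives the
    series \<open>1\<close>.\<close>
  have one: "colour_comb d d d [(1, {})] = 1"
    by (rule mps_eqI) (simp add: colour_comb_def colour_series_def mcoeff_1 edges_weight_def)
  have "area_right r \<pi> d = {}"
    using Area_column_bounds(2) n by (fastforce simp: area_right_def)
  moreover have "\<forall>(i, j)\<in>S. d < i \<longrightarrow> column_decreasing (T j) (T i)" for T
    using bound by fastforce
  ultimately have weight: "word_weight [(1, {})] T = weight_right r \<pi> S (xcoord \<pi> ?n) T" for T
    unfolding weight_right_def n by (simp add: inversions_def)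
  have "traverse d S (d - xcoord \<pi> ?n) (d - ycoord r \<pi> ?n) (rev (take ?n \<pi>))
      (colour_comb (xcoord \<pi> ?n) (ycoord r \<pi> ?n) d [(1, {})]) = G_col r d \<pi> S (inverse tvar)"
  proof (rule traverse_eq_G_col[OF assms(1) S order_refl])
    show "good_area (xcoord \<pi> ?n) (ycoord r \<pi> ?n) d A" if "(c, A) \<in> set [(1, {})]" for c A
      using that unfolding n by (auto simp: good_area_def)
    show "(xcoord \<pi> ?n, j) \<notin> S" for j using bound n by blast
  qed (rule weight)
  thus ?thesis by (simp add: chi_tilde_def n one)
qed

end
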